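(* For large (but finite) $n$ and $m$, and $c=\frac{n}{m}\in(0,1)$, the first three cumulants of $W_1$ are given by $$\kappa_{W_1,1}=e\,(1-c)^{\frac{1-c}{c}}\,\Psi_1\Psi_2+O\left(\frac1{n^2}\right),$$ $$\kappa_{W_1,2}=\frac{1}{n^2}\Psi_1^2\,e^2(1-c)^{2\frac{1-c}{c}}\left[\left(\ln\left(\frac1{1-c}\right)-2c\right)\Psi_2^2+c\,\Psi_3\right]+O\left(\frac1{n^4}\right),$$ $$\kappa_{W_1,3}=\frac{1}{n^4}\Psi_1^3\,e^3(1-c)^{3\frac{1-c}{c}}\left[\left(\frac{c^2(-10+9c)}{-1+c}+3\ln(1-c)\left(4c+\ln(1-c)\right)\right)\Psi_2^3-3c\left(3c+2\ln(1-c)\right)\Psi_2\Psi_3+2c^2\,\Psi_4\right]+O\left(\frac1{n^6}\right),$$ where, with $y_1,\dots,y_n$ denoting the eigenvalues of $\mathbf{H}\mathbf{H}^\dagger+N_0\mathbf{I}_n$, $$\Psi_1=\prod_{i=1}^n y_i^{-\frac1n},\qquad \Psi_{\ell+1}=\frac1n\sum_{i=1}^n y_i^{\ell},\quad \ell\ge1.$$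
   Context: Here $N_0>0$, and $\mathbf{H}\in\mathbb{C}^{n\times k}$ is a given matrix with $k\ge n$ and $\mathbf{H}\mathbf{H}^\dagger$ positive definite. The random variable is $W_1=\frac{\frac1n\operatorname{Tr}(\mathbf{X}\mathbf{X}^\dagger)}{\det(\mathbf{X}\mathbf{X}^\dagger)^{1/n}}$, where $\mathbf{X}$ is an $n\times m$ random matrix whose columns are independent circularly symmetric complex Gaussian vectors in $\mathbb{C}^n$ with mean zero and covariance matrix $\mathbf{H}\mathbf{H}^\dagger+N_0\mathbf{I}_n$ (the matrix $\mathbf{H}$ being the same for all $m$ columns). Writing $\mu_p=\mathrm{E}[W_1^p]$, the cumulants are $\kappa_{W_1,1}=\mu_1$, $\kappa_{W_1,2}=\mu_2-\mu_1^2$, $\kappa_{W_1,3}=\mu_3-3\mu_2\mu_1+2\mu_1^3$.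
   Formalization: The O-terms are taken along families with n→∞, c=n/m in a fixed compact subinterval of (0,1), and Ψ₁Ψ₂, Ψ₁²Ψ₃, Ψ₁³Ψ₄ assumed bounded; without such bounds on the Ψ's the stated error orders are false. *)

theory Defs
  imports
    "HOL-Probability.Probability"
    "HOL-Library.Landau_Symbols"
    "Jordan_Normal_Form.Schur_Decomposition"
    "Jordan_Normal_Form.Gauss_Jordan_Elimination"
begin

definition gram :: "complex mat \<Rightarrow> complex mat" where
  "gram A = A * mat_adjoint A"

definition positive_definite :: "nat \<Rightarrow> complex mat \<Rightarrow> bool" where
  "positive_definite n A \<longleftrightarrow>
     A \<in> carrier_mat n n \<and> mat_adjoint A = A \<and>
     (\<forall>v \<in> carrier_vec n. v \<noteq> 0\<^sub>v n \<longrightarrow> 0 < Re ((A *\<^sub>v v) \<bullet>c v))"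

text \<open>
  A vector in $\mathbb{C}^n$ is represented, on the measure-theoretic side, by a function in
  the product space over \<open>{..<n}\<close>. For an invertible covariance matrix \<open>S\<close>, the circularly
  symmetric complex Gaussian law with mean zero and covariance $S = E[z z^\dagger]$ has density
  $\pi^{-n} \det(S)^{-1} \exp(-z^\dagger S^{-1} z)$ with respect to Lebesgue measure on
  $\mathbb{C}^n = \mathbb{R}^{2n}$. For Hermitian \<open>S\<close> the quadratic form and the determinant are
  real, so \<open>Re\<close> only changes the type. The function \<open>mat_inverse\<close> returns \<open>Some\<close> of the inverse
  if \<open>S\<close> is invertible.
\<close>

abbreviation cvec_space :: "nat \<Rightarrow> (nat \<Rightarrow> complex) measure" where
  "cvec_space n \<equiv> \<Pi>\<^sub>M i\<in>{..<n}. lborel"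

definition complex_gaussian_density :: "nat \<Rightarrow> complex mat \<Rightarrow> (nat \<Rightarrow> complex) \<Rightarrow> real" where
  "complex_gaussian_density n S z =
     exp (- Re ((the (mat_inverse S) *\<^sub>v vec n z) \<bullet>c vec n z)) / (pi ^ n * Re (Determinant.det S))"

definition complex_gaussian ::
    "'a measure \<Rightarrow> nat \<Rightarrow> complex mat \<Rightarrow> ('a \<Rightarrow> nat \<Rightarrow> complex) \<Rightarrow> bool" where
  "complex_gaussian M n S Z \<longleftrightarrow>
     distributed M (cvec_space n) Z (\<lambda>z. ennreal (complex_gaussian_density n S z))"

definition random_column :: "nat \<Rightarrow> ('a \<Rightarrow> complex mat) \<Rightarrow> nat \<Rightarrow> 'a \<Rightarrow> nat \<Rightarrow> complex" where
  "random_column n X r = (\<lambda>\<omega>. \<lambda>i\<in>{..<n}. X \<omega> $$ (i, r))"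

definition iid_gaussian_columns ::
    "'a measure \<Rightarrow> nat \<Rightarrow> nat \<Rightarrow> complex mat \<Rightarrow> ('a \<Rightarrow> complex mat) \<Rightarrow> bool" where
  "iid_gaussian_columns M n m S X \<longleftrightarrow>
     (\<forall>\<omega> \<in> space M. X \<omega> \<in> carrier_mat n m) \<and>
     prob_space.indep_vars M (\<lambda>_. cvec_space n) (random_column n X) {..<m} \<and>
     (\<forall>r<m. complex_gaussian M n S (random_column n X r))"

text \<open>Both the trace and the determinant of $A A^\dagger$ are real and nonnegative.\<close>

definition W1 :: "nat \<Rightarrow> complex mat \<Rightarrow> real" where
  "W1 n A = (1 / real n * Re (\<Sum>i<n. gram A $$ (i, i)))
              / Re (Determinant.det (gram A)) powr (1 / real n)"

definition moment :: "'a measure \<Rightarrow> ('a \<Rightarrow> real) \<Rightarrow> nat \<Rightarrow> real" where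
  "moment M W p = (\<integral>\<omega>. W \<omega> ^ p \<partial>M)"

definition cumulant1 :: "'a measure \<Rightarrow> ('a \<Rightarrow> real) \<Rightarrow> real" where
  "cumulant1 M W = moment M W 1"

definition cumulant2 :: "'a measure \<Rightarrow> ('a \<Rightarrow> real) \<Rightarrow> real" where
  "cumulant2 M W = moment M W 2 - (moment M W 1)\<^sup>2"

definition cumulant3 :: "'a measure \<Rightarrow> ('a \<Rightarrow> real) \<Rightarrow> real" where
  "cumulant3 M W = moment M W 3 - 3 * moment M W 2 * moment M W 1 + 2 * (moment M W 1) ^ 3"

text \<open>
  The eigenvalues are listed with algebraic multiplicity, as the roots of the characteristic
  polynomial, and are indexed from zero.
\<close>

definition eigenvalue_list :: "nat \<Rightarrow> complex mat \<Rightarrow> (nat \<Rightarrow> real) \<Rightarrow> bool" where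
  "eigenvalue_list n S y \<longleftrightarrow> char_poly S = (\<Prod>i<n. [:- complex_of_real (y i), 1:])"

definition Psi1 :: "nat \<Rightarrow> (nat \<Rightarrow> real) \<Rightarrow> real" where
  "Psi1 n y = (\<Prod>i<n. y i powr (- 1 / real n))"

text \<open>\<open>Psi_succ l\<close> is $\Psi_{l+1}$, for $l \ge 1$.\<close>

definition Psi_succ :: "nat \<Rightarrow> nat \<Rightarrow> (nat \<Rightarrow> real) \<Rightarrow> real" where
  "Psi_succ l n y = 1 / real n * (\<Sum>i<n. y i ^ l)"

end

theory Submission
  imports Defs "HOL-Real_Asymp.Real_Asymp"
begin

text \<open>
  Let \<open>X\<close> have independent Gaussian columns with covariance \<open>S\<close>, whose eigenvalues are
  \<open>y\<^sub>i > 0\<close>. Write \<open>S = A A\<^sup>*\<close> with \<open>A\<^sup>* A\<close> the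
  diagonal matrix of the \<open>y\<^sub>i\<close>. Then \<open>X\<close> is distributed like \<open>A Z\<close>
  with independent standard Gaussian entries in \<open>Z\<close>, and
  \[ W_1 = \frac{\Psi_1}{n}\, \det(Z Z^\dagger)^{-1/n} \sum_i y_i \rho_i, \]
  where \<open>\<rho>\<^sub>i\<close> is the squared norm of row \<open>i\<close> of \<open>Z\<close> (lemmas
  \<open>covariance_square_root\<close>, \<open>nn_integral_iid_gaussian_columns\<close>,
  \<open>W1_mult_square_root\<close>).

  From this the moments are computed exactly. Put \<open>s = p / n\<close>. The determinant has degree 2 in
  every row of \<open>Z\<close>, and a scaling argument (\<open>gauss_integral_mult_row_energy\<close>) shows that
  under the weight \<open>det(Z Z\<^sup>*)\<^bsup>-s\<^esup>\<close> the row energies have the same moments, up to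
  order three, as independent Gamma variables with shape \<open>\<nu> = m - s\<close>. The total mass of this
  weight is found by adding the rows one at a time: each new row multiplies the determinant by its squared distance
  from the span of the previous rows, a Gamma variable with integer shape
  (\<open>gauss_integral_gram_det_powr\<close>). Together
  \[ \mathrm{E}[W_1^p] = \frac{\Psi_1^p}{n^p} \prod_{i<n} \frac{\Gamma(m-i-s)}{\Gamma(m-i)}\, E_p, \]
  where \<open>E\<^sub>1 = \<nu> n \<Psi>\<^sub>2\<close>,
  \<open>E\<^sub>2 = (\<nu> n \<Psi>\<^sub>2)\<^sup>2 + \<nu> n \<Psi>\<^sub>3\<close> and
  \<open>E\<^sub>3 = (\<nu> n \<Psi>\<^sub>2)\<^sup>3 + 3 (\<nu> n \<Psi>\<^sub>2) (\<nu> n \<Psi>\<^sub>3) + 2 \<nu> n \<Psi>\<^sub>4\<close>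
  (lemma \<open>moment_W1\<close> and the locale \<open>gram_det_weight\<close>).

  What remains is asymptotics in \<open>1 / n\<^sup>2\<close>. A Taylor expansion of \<open>ln \<Gamma>\<close>
  in the step \<open>s\<close> reduces the Gamma product to sums of polygamma functions, which telescope up to
  small errors:
  \[ m^p \prod_{i<n} \frac{\Gamma(m-i-s)}{\Gamma(m-i)} = \exp\Bigl(p g + \frac{p^2 L}{2 n^2} + \frac{p^2 \delta + p^3 \gamma}{n^4} + O(n^{-6})\Bigr), \]
  with \<open>L = - ln (1 - c)\<close>, \<open>\<gamma> = c\<^sup>2 / (6 (1 - c))\<close>,
  \<open>\<delta>\<close> bounded and
  \<open>g = 1 + ((1 - c) / c) ln (1 - c) + O(n\<^sup>-\<^sup>2)\<close> (lemmas
  \<open>u_expands\<close>, \<open>g_approx\<close>). The factor \<open>exp (p g)\<close> is common to all terms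
  of a cumulant of order \<open>p\<close> and gives the constant \<open>e (1-c)\<^bsup>(1-c)/c\<^esup>\<close>.
  For the other factors, expanding the moments up to \<open>n\<^sup>-\<^sup>4\<close> suffices: in the second
  cumulant the terms of order 1 cancel, in the third also those of order \<open>n\<^sup>-\<^sup>2\<close> and every
  contribution of \<open>\<delta>\<close>, and the leading terms that survive are those of the theorem
  (\<open>expands_cumulant2\<close>, \<open>expands_cumulant3\<close>).
\<close>

section \<open>Lebesgue measure on the complex plane\<close>

lemma measurable_Complex [measurable (raw)]:
  assumes [measurable]: "f \<in> borel_measurable M" "g \<in> borel_measurable M"
  shows "(\<lambda>x. Complex (f x) (g x)) \<in> borel_measurable M"
proof -
  have "(\<lambda>x. Complex (f x) (g x)) = (\<lambda>x. complex_of_real (f x) + \<i> * complex_of_real (g x))"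
    by (auto simp: complex_eq_iff)
  then show ?thesis by simp
qed

lemma complex_lborel_eq_distr:
  "(lborel :: complex measure) = distr (lborel \<Otimes>\<^sub>M lborel) borel (\<lambda>(x,y). Complex x y)"
proof (rule lborel_eqI)
  have [measurable]: "(\<lambda>(x,y). Complex x y) \<in> borel_measurable (lborel \<Otimes>\<^sub>M (lborel :: real measure))"
    unfolding case_prod_beta by measurable
  fix l u :: complex
  assume le: "\<And>b. b \<in> Basis \<Longrightarrow> l \<bullet> b \<le> u \<bullet> b"
  have le': "Re l \<le> Re u" "Im l \<le> Im u" using le[of 1] le[of \<i>] by (auto simp: Basis_complex_def inner_complex_def)
  have box: "(\<lambda>(x,y). Complex x y) -` box l u \<inter> space (lborel \<Otimes>\<^sub>M lborel) = {Re l<..<Re u} \<times> {Im l<..<Im u}"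
    by (auto simp: box_def Basis_complex_def inner_complex_def space_pair_measure)
  have "emeasure (distr (lborel \<Otimes>\<^sub>M lborel) borel (\<lambda>(x,y). Complex x y)) (box l u)
      = emeasure (lborel \<Otimes>\<^sub>M lborel) ({Re l<..<Re u} \<times> {Im l<..<Im u})"
    by (subst emeasure_distr) (auto simp: box)
  also have "\<dots> = ennreal (Re u - Re l) * ennreal (Im u - Im l)"
    using le' by (simp add: lborel.emeasure_pair_measure_Times)
  also have "\<dots> = ennreal (\<Prod>b\<in>Basis. (u - l) \<bullet> b)"
    using le' by (simp add: Basis_complex_def inner_complex_def ennreal_mult)
  finally show "emeasure (distr (lborel \<Otimes>\<^sub>M lborel) borel (\<lambda>(x,y). Complex x y)) (box l u)
      = ennreal (\<Prod>b\<in>Basis. (u - l) \<bullet> b)" .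
qed simp

lemma nn_integral_complex:
  assumes [measurable]: "f \<in> borel_measurable (borel :: complex measure)"
  shows "(\<integral>\<^sup>+z. f z \<partial>lborel) = (\<integral>\<^sup>+x. \<integral>\<^sup>+y. f (Complex x y) \<partial>lborel \<partial>lborel)"
proof -
  have "(\<integral>\<^sup>+z. f z \<partial>lborel) = (\<integral>\<^sup>+p. f (case p of (x,y) \<Rightarrow> Complex x y) \<partial>(lborel \<Otimes>\<^sub>M lborel))"
    unfolding complex_lborel_eq_distr by (subst nn_integral_distr) (auto simp: case_prod_beta)
  also have "\<dots> = (\<integral>\<^sup>+x. \<integral>\<^sup>+y. f (Complex x y) \<partial>lborel \<partial>lborel)"
    by (subst lborel.nn_integral_fst[symmetric]) (auto simp: case_prod_beta)
  finally show ?thesis .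
qed

lemma nn_integral_real_affine_scaled:
  fixes f :: "real \<Rightarrow> ennreal"
  assumes "f \<in> borel_measurable borel" "c \<noteq> 0"
  shows "ennreal \<bar>c\<bar> * (\<integral>\<^sup>+x. f (c * x + t) \<partial>lborel) = (\<integral>\<^sup>+x. f x \<partial>lborel)"
  using nn_integral_real_affine[OF assms, of t] by (simp add: add.commute)

text \<open>
  Multiplication by \<open>a\<close> is a rotation composed with a scaling by \<open>\<bar>a\<bar>\<close>, hence
  scales areas by \<open>\<bar>a\<bar>\<^sup>2\<close>. The proof substitutes one real coordinate at a time. The
  matrix with rows \<open>(p, -q)\<close> and \<open>(q, p)\<close> has the pivot \<open>p\<close> in its lower
  right corner; for \<open>p = 0\<close> it is a permutation of scaled coordinates.
\<close>

lemma nn_integral_complex_affine: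
  fixes a b :: complex
  assumes [measurable]: "f \<in> borel_measurable borel" and a: "a \<noteq> 0"
  shows "ennreal ((cmod a)\<^sup>2) * (\<integral>\<^sup>+z. f (a * z + b) \<partial>lborel) = (\<integral>\<^sup>+z. f z \<partial>lborel)"
proof -
  define p q where "p = Re a" "q = Im a"
  define d where "d = p\<^sup>2 + q\<^sup>2"
  have d: "d > 0" "(cmod a)\<^sup>2 = d"
    using a unfolding d_def p_q_def by (auto simp: cmod_power2 complex_eq_iff sum_power2_gt_zero_iff)
  have F: "f (a * Complex x y + b) = f (Complex (p * x - q * y + Re b) (q * x + p * y + Im b))" for x y
    by (rule arg_cong[of _ _ f]) (simp add: complex_eq_iff p_q_def)
  have I: "(\<integral>\<^sup>+z. f (a * z + b) \<partial>lborel)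
      = (\<integral>\<^sup>+x. \<integral>\<^sup>+y. f (Complex (p * x - q * y + Re b) (q * x + p * y + Im b)) \<partial>lborel \<partial>lborel)"
    by (subst nn_integral_complex) (auto simp: F)
  show ?thesis
  proof (cases "p = 0")
    case True
    then have q: "q \<noteq> 0" using d(1) by (auto simp: d_def)
    have "ennreal ((cmod a)\<^sup>2) * (\<integral>\<^sup>+z. f (a * z + b) \<partial>lborel)
      = ennreal \<bar>q\<bar> * (\<integral>\<^sup>+x. ennreal \<bar>- q\<bar> * (\<integral>\<^sup>+y. f (Complex ((- q) * y + Re b) (q * x + Im b)) \<partial>lborel) \<partial>lborel)"
      unfolding I d(2) using True q
      by (subst nn_integral_cmult) (auto simp: d_def power2_eq_square ennreal_mult[symmetric] mult.assoc[symmetric])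
    also have "\<dots> = ennreal \<bar>q\<bar> * (\<integral>\<^sup>+x. \<integral>\<^sup>+y. f (Complex y (q * x + Im b)) \<partial>lborel \<partial>lborel)"
      using q by (subst nn_integral_real_affine_scaled) auto
    also have "\<dots> = (\<integral>\<^sup>+x. \<integral>\<^sup>+y. f (Complex y x) \<partial>lborel \<partial>lborel)"
      using q by (subst nn_integral_real_affine_scaled) auto
    also have "\<dots> = (\<integral>\<^sup>+z. f z \<partial>lborel)"
      by (subst nn_integral_complex, simp) (subst lborel_pair.Fubini', auto)
    finally show ?thesis .
  next
    case False
    \<comment> \<open>With the second coordinate \<open>v = p y + q x + Im b\<close> as new variable, the first depends on \<open>x\<close> with slope \<open>d / p\<close>.\<close>
    have eq: "f (Complex (p * x - q * y + Re b) (q * x + p * y + Im b))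
        = (\<lambda>v. f (Complex ((d / p) * x + (Re b - (q / p) * (v - Im b))) v)) (p * y + (q * x + Im b))" for x y
      using False by (intro arg_cong[of _ _ f]) (auto simp: complex_eq_iff d_def field_simps power2_eq_square)
    have "ennreal ((cmod a)\<^sup>2) * (\<integral>\<^sup>+z. f (a * z + b) \<partial>lborel)
      = ennreal \<bar>d / p\<bar> * (\<integral>\<^sup>+x. ennreal \<bar>p\<bar> * (\<integral>\<^sup>+y. f (Complex (p * x - q * y + Re b) (q * x + p * y + Im b)) \<partial>lborel) \<partial>lborel)"
      unfolding I d(2) using False d(1)
      by (subst nn_integral_cmult) (auto simp: ennreal_mult[symmetric] mult.assoc[symmetric] abs_mult[symmetric])
    also have "\<dots> = ennreal \<bar>d / p\<bar> * (\<integral>\<^sup>+x. \<integral>\<^sup>+v. f (Complex ((d / p) * x + (Re b - (q / p) * (v - Im b))) v) \<partial>lborel \<partial>lborel)"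
      unfolding eq using False by (subst nn_integral_real_affine_scaled) auto
    also have "\<dots> = (\<integral>\<^sup>+v. ennreal \<bar>d / p\<bar> * (\<integral>\<^sup>+x. f (Complex ((d / p) * x + (Re b - (q / p) * (v - Im b))) v) \<partial>lborel) \<partial>lborel)"
      by (subst lborel_pair.Fubini', simp, subst nn_integral_cmult) auto
    also have "\<dots> = (\<integral>\<^sup>+v. \<integral>\<^sup>+x. f (Complex x v) \<partial>lborel \<partial>lborel)"
    proof -
      have "ennreal \<bar>d / p\<bar> * (\<integral>\<^sup>+x. f (Complex ((d / p) * x + (Re b - (q / p) * (v - Im b))) v) \<partial>lborel)
          = (\<integral>\<^sup>+x. f (Complex x v) \<partial>lborel)" for v
        using nn_integral_real_affine_scaled[of "\<lambda>x. f (Complex x v)" "d / p" "Re b - (q / p) * (v - Im b)"] d(1) False by auto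
      then show ?thesis by simp
    qed
    also have "\<dots> = (\<integral>\<^sup>+z. f z \<partial>lborel)"
      by (subst nn_integral_complex, simp) (subst lborel_pair.Fubini', auto)
    finally show ?thesis .
  qed
qed

lemma nn_integral_complex_gaussian:
  assumes "l > 0"
  shows "(\<integral>\<^sup>+z. ennreal (exp (- l * (cmod z)\<^sup>2)) \<partial>lborel) = ennreal (pi / l)"
proof -
  define c where "c = sqrt (pi / l)"
  have c: "c > 0" using assms by (simp add: c_def)
  have G: "(\<integral>\<^sup>+x. ennreal (exp (- l * x\<^sup>2)) \<partial>lborel) = ennreal c"
  proof -
    have "(\<integral>\<^sup>+x. ennreal (normal_density 0 (1 / sqrt (2 * l)) x) \<partial>lborel) = 1"
      using prob_space.emeasure_space_1[OF prob_space_normal_density, of "1 / sqrt (2 * l)" 0] assms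
      by (simp add: emeasure_density)
    moreover have "ennreal (normal_density 0 (1 / sqrt (2 * l)) x) = ennreal (1 / c) * ennreal (exp (- l * x\<^sup>2))" for x
      using assms by (simp add: normal_density_def c_def power_divide real_sqrt_divide real_sqrt_mult field_simps ennreal_mult[symmetric])
    ultimately have "ennreal (1 / c) * (\<integral>\<^sup>+x. ennreal (exp (- l * x\<^sup>2)) \<partial>lborel) = 1"
      by (simp add: nn_integral_cmult)
    then have "ennreal c * (ennreal (1 / c) * (\<integral>\<^sup>+x. ennreal (exp (- l * x\<^sup>2)) \<partial>lborel)) = ennreal c" by simp
    then show ?thesis using c by (simp add: mult.assoc[symmetric] ennreal_mult[symmetric])
  qed
  have "(\<integral>\<^sup>+z. ennreal (exp (- l * (cmod z)\<^sup>2)) \<partial>lborel)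
    = (\<integral>\<^sup>+x. \<integral>\<^sup>+y. ennreal (exp (- l * x\<^sup>2)) * ennreal (exp (- l * y\<^sup>2)) \<partial>lborel \<partial>lborel)"
    by (subst nn_integral_complex)
       (auto simp: cmod_power2 ring_distribs exp_add[symmetric] ennreal_mult[symmetric] simp del: minus_add_distrib)
  also have "\<dots> = ennreal c * ennreal c"
    using G by (simp add: nn_integral_cmult nn_integral_multc)
  also have "\<dots> = ennreal (pi / l)" using c assms by (simp add: ennreal_mult[symmetric] c_def)
  finally show ?thesis .
qed

section \<open>Unitary diagonalization of Hermitian matrices\<close>

lemma mat_adjoint_eq: "mat_adjoint A = mat (dim_col A) (dim_row A) (\<lambda>(i,j). conjugate (A $$ (j,i)))"
  by (rule eq_matI) (auto simp: mat_adjoint_def mat_of_rows_def)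

lemma dim_mat_adjoint [simp]: "dim_row (mat_adjoint A) = dim_col A" "dim_col (mat_adjoint A) = dim_row A"
  by (simp_all add: mat_adjoint_eq)

lemma mat_adjoint_carrier [simp]: "A \<in> carrier_mat n m \<Longrightarrow> mat_adjoint A \<in> carrier_mat m n"
  by (auto simp: mat_adjoint_eq)

lemma mat_adjoint_index:
  "A \<in> carrier_mat n m \<Longrightarrow> i < m \<Longrightarrow> j < n \<Longrightarrow> mat_adjoint A $$ (i,j) = conjugate (A $$ (j,i))"
  by (auto simp: mat_adjoint_eq)

lemma index_mult_sum:
  assumes "A \<in> carrier_mat n k" "B \<in> carrier_mat k m" "i < n" "j < m"
  shows "(A * B) $$ (i,j) = (\<Sum>l<k. A $$ (i,l) * B $$ (l,j))"
  using assms by (auto simp: scalar_prod_def atLeast0LessThan)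

lemma mat_adjoint_mult:
  fixes A B :: "complex mat"
  assumes A: "A \<in> carrier_mat n k" and B: "B \<in> carrier_mat k m"
  shows "mat_adjoint (A * B) = mat_adjoint B * mat_adjoint A"
proof (rule eq_matI)
  fix i j assume "i < dim_row (mat_adjoint B * mat_adjoint A)" "j < dim_col (mat_adjoint B * mat_adjoint A)"
  then have ij: "i < m" "j < n" using A B by (auto simp: mat_adjoint_eq)
  show "mat_adjoint (A * B) $$ (i, j) = (mat_adjoint B * mat_adjoint A) $$ (i, j)"
    using ij A B
    by (simp add: mat_adjoint_index[of "A * B" n m] index_mult_sum[of _ n k _ m] index_mult_sum[of _ m k _ n]
        mat_adjoint_index[of A n k] mat_adjoint_index[of B k m] del: index_mult_mat)
       (simp add: mult.commute)
qed (use A B in \<open>auto simp: mat_adjoint_eq\<close>)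

lemma mat_adjoint_adjoint [simp]:
  fixes A :: "complex mat"
  shows "mat_adjoint (mat_adjoint A) = A"
  by (rule eq_matI) (auto simp: mat_adjoint_eq)

lemma det_mat_adjoint:
  fixes A :: "complex mat"
  assumes A: "A \<in> carrier_mat n n"
  shows "Determinant.det (mat_adjoint A) = cnj (Determinant.det A)"
proof -
  interpret comm_ring_hom cnj by unfold_locales auto
  have "mat_adjoint A = map_mat cnj (transpose_mat A)"
    by (rule eq_matI) (auto simp: mat_adjoint_eq)
  then show ?thesis using A by (simp add: hom_det det_transpose)
qed

lemma unitary_det_norm:
  assumes U: "U \<in> carrier_mat n n" "U * mat_adjoint U = 1\<^sub>m n"
  shows "(cmod (Determinant.det U))\<^sup>2 = 1"
proof -
  have "Determinant.det U * Determinant.det (mat_adjoint U) = 1"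
    using det_mult[OF U(1) mat_adjoint_carrier[OF U(1)]] U(2) by simp
  then have "of_real ((cmod (Determinant.det U))\<^sup>2) = (1::complex)"
    using det_mat_adjoint[OF U(1)] by (simp only: complex_norm_square)
  then show ?thesis by (simp only: of_real_eq_1_iff)
qed

definition diag_of :: "nat \<Rightarrow> (nat \<Rightarrow> 'a::zero) \<Rightarrow> 'a mat" where
  "diag_of n y = mat n n (\<lambda>(i,j). if i = j then y i else 0)"

lemma diag_of_carrier [simp]: "diag_of n y \<in> carrier_mat n n"
  by (simp add: diag_of_def)

lemma diag_of_mult:
  fixes y z :: "nat \<Rightarrow> complex"
  shows "diag_of n y * diag_of n z = diag_of n (\<lambda>i. y i * z i)"
  by (rule eq_matI) (auto simp: diag_of_def scalar_prod_def if_distrib[of "\<lambda>x. x * _"] if_distrib[of "\<lambda>x. _ * x"] cong: if_cong)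

lemma mat_adjoint_diag_of: "mat_adjoint (diag_of n y) = diag_of n (\<lambda>i. cnj (y i))"
  by (rule eq_matI) (auto simp: diag_of_def mat_adjoint_eq)

lemma det_diag_of:
  fixes y :: "nat \<Rightarrow> 'a::comm_ring_1"
  shows "Determinant.det (diag_of n y) = (\<Prod>i<n. y i)"
proof -
  have "Determinant.det (diag_of n y) = prod_list (diag_mat (diag_of n y))"
    by (rule det_upper_triangular) (auto simp: diag_of_def)
  also have "\<dots> = (\<Prod>i<n. y i)"
    by (simp add: prod_list_diag_prod diag_of_def atLeast0LessThan)
  finally show ?thesis .
qed

text \<open>
  Gram-Schmidt orthogonalization of a basis that starts with \<open>v\<close> leaves \<open>v\<close> in the first
  column; dividing each column by its norm makes the matrix unitary.
\<close>

lemma exists_unitary_first_column_parallel: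
  fixes v :: "complex vec"
  assumes v: "v \<in> carrier_vec (Suc n)" "v \<noteq> 0\<^sub>v (Suc n)"
  obtains U c where "U \<in> carrier_mat (Suc n) (Suc n)" "mat_adjoint U * U = 1\<^sub>m (Suc n)" "col U 0 = c \<cdot>\<^sub>v v"
proof -
  let ?n = "Suc n"
  interpret cof_vec_space ?n "TYPE(complex)" .
  define b where "b = basis_completion v"
  define ws where "ws = gram_schmidt ?n b"
  define W where "W = mat_of_cols ?n ws"
  from basis_completion[OF v, folded b_def]
  have dist_b: "distinct b" and indep: "\<not> lin_dep (set b)" and b: "set b \<subseteq> carrier_vec ?n"
    and hdb: "hd b = v" and len_b: "length b = ?n" by auto
  from hdb len_b obtain vs where bv: "b = v # vs" by (cases b) auto
  from gram_schmidt_result[OF b dist_b indep refl, folded ws_def]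
  have ws: "set ws \<subseteq> carrier_vec ?n" "corthogonal ws" "length ws = ?n"
    by (auto simp: len_b)
  from gram_schmidt_hd[OF v(1), of vs, folded bv] have hdws: "hd ws = v" unfolding ws_def .
  have orth: "corthogonal_mat W" unfolding W_def using orthogonal_mat_of_cols ws by blast
  have W: "W \<in> carrier_mat ?n ?n" unfolding W_def using ws mat_of_cols_carrier(1)[of ?n ws] by auto
  have "ws ! 0 = v" using hdws ws(3) by (cases ws) auto
  then have W0: "col W 0 = v" using ws unfolding W_def by (subst col_mat_of_cols) auto
  define s where "s i = (\<Sum>l<?n. (cmod (W $$ (l,i)))\<^sup>2)" for i
  have prod: "(\<Sum>l<?n. cnj (W $$ (l,i)) * W $$ (l,j)) = (if i = j then of_real (s i) else 0)"
    if "i < ?n" "j < ?n" for i j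
  proof (cases "i = j")
    case True
    then show ?thesis by (simp add: s_def complex_norm_square[symmetric] mult.commute of_real_sum del: sum.lessThan_Suc)
  next
    case False
    have "col W j \<bullet>c col W i = 0" using corthogonal_matD[OF orth, of j i] that False W by auto
    then show ?thesis using that W False
      by (simp add: scalar_prod_def atLeast0LessThan mult.commute del: sum.lessThan_Suc)
  qed
  have spos: "s i > 0" if "i < ?n" for i
  proof -
    have "col W i \<bullet>c col W i \<noteq> 0" using corthogonal_matD[OF orth, of i i] that W by auto
    then have "of_real (s i) \<noteq> (0::complex)" using that W
      by (simp add: scalar_prod_def atLeast0LessThan s_def complex_norm_square[symmetric] mult.commute del: sum.lessThan_Suc)
    moreover have "s i \<ge> 0" unfolding s_def by (intro sum_nonneg) auto
    ultimately show ?thesis by (simp add: less_le)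
  qed
  define U where "U = mat ?n ?n (\<lambda>(i,j). W $$ (i,j) / of_real (sqrt (s j)))"
  have U: "U \<in> carrier_mat ?n ?n" by (simp add: U_def)
  have "mat_adjoint U * U = 1\<^sub>m ?n"
  proof (rule eq_matI)
    fix i j assume "i < dim_row (1\<^sub>m ?n :: complex mat)" "j < dim_col (1\<^sub>m ?n :: complex mat)"
    then have ij: "i < ?n" "j < ?n" by auto
    have "(mat_adjoint U * U) $$ (i,j)
        = (\<Sum>l<?n. cnj (W $$ (l,i)) * W $$ (l,j)) / (of_real (sqrt (s i)) * of_real (sqrt (s j)))"
      unfolding sum_divide_distrib
      by (subst index_mult_sum[OF _ U ij], simp add: U, intro sum.cong)
         (use ij in \<open>auto simp: mat_adjoint_eq U_def\<close>)
    also have "\<dots> = (1\<^sub>m ?n :: complex mat) $$ (i,j)"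
      unfolding prod[OF ij] using ij spos[OF ij(1)]
      by (auto simp flip: of_real_mult)
    finally show "(mat_adjoint U * U) $$ (i,j) = (1\<^sub>m ?n :: complex mat) $$ (i,j)" .
  qed (use U in \<open>auto simp: mat_adjoint_eq\<close>)
  moreover have "col U 0 = (1 / of_real (sqrt (s 0))) \<cdot>\<^sub>v v"
    by (rule eq_vecI) (use W W0[symmetric] in \<open>auto simp: U_def\<close>)
  ultimately show ?thesis using U that by blast
qed

text \<open>
  The diagonal entries are prescribed, in the given order, by a factorization of the characteristic polynomial:
  this is how the numbers \<open>y i\<close> of the theorem enter. A unitary matrix whose first column is an
  eigenvector for \<open>y 0\<close> splits off a \<open>1 \<times> 1\<close> block. The complementary block is
  again Hermitian, and its characteristic polynomial is the remaining product, so induction applies to it.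
\<close>

lemma hermitian_unitarily_diagonalizable:
  fixes A :: "complex mat"
  assumes "A \<in> carrier_mat n n" "mat_adjoint A = A" "char_poly A = (\<Prod>i<n. [:- y i, 1:])"
  shows "\<exists>U. U \<in> carrier_mat n n \<and> mat_adjoint U * U = 1\<^sub>m n \<and> A = U * diag_of n y * mat_adjoint U"
  using assms
proof (induction n arbitrary: A y)
  case 0
  then show ?case by (intro exI[of _ "1\<^sub>m 0"]) (auto intro!: eq_matI simp: mat_adjoint_eq)
next
  case (Suc n)
  let ?n = "Suc n"
  note A = Suc.prems(1) and herm = Suc.prems(2) and cp = Suc.prems(3)
  have "eigenvalue A (y 0)"
    unfolding eigenvalue_root_char_poly[OF A] cp by (simp add: prod.lessThan_Suc_shift del: prod.lessThan_Suc)
  then obtain v where "eigenvector A v (y 0)" unfolding eigenvalue_def by blast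
  then have v: "v \<in> carrier_vec ?n" "v \<noteq> 0\<^sub>v ?n" and ev: "A *\<^sub>v v = y 0 \<cdot>\<^sub>v v"
    using A by (auto simp: eigenvector_def)
  obtain W c where W: "W \<in> carrier_mat ?n ?n" and WW: "mat_adjoint W * W = 1\<^sub>m ?n"
    and W0: "col W 0 = c \<cdot>\<^sub>v v"
    using exists_unitary_first_column_parallel[OF v] .
  have W': "mat_adjoint W \<in> carrier_mat ?n ?n" using W by simp
  have WW2: "W * mat_adjoint W = 1\<^sub>m ?n" using mat_mult_left_right_inverse[OF W' W WW] .
  define B where "B = mat_adjoint W * A * W"
  have B: "B \<in> carrier_mat ?n ?n" unfolding B_def using A W W' by (intro mult_carrier_mat)
  have Bherm: "mat_adjoint B = B"
    using A W W' unfolding B_def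
    by (simp add: mat_adjoint_mult[of _ ?n ?n _ ?n] herm assoc_mult_mat[of _ ?n ?n _ ?n _ ?n] mult_carrier_mat[of _ ?n ?n _ ?n])
  have A_eq: "A = W * B * mat_adjoint W"
  proof -
    have "W * B * mat_adjoint W = (W * mat_adjoint W) * A * (W * mat_adjoint W)"
      using A W W' unfolding B_def by (simp add: assoc_mult_mat[of _ ?n ?n _ ?n _ ?n] mult_carrier_mat[of _ ?n ?n _ ?n])
    then show ?thesis using A WW2 by simp
  qed
  have Bcol: "B $$ (i,0) = (if i = 0 then y 0 else 0)" if "i < ?n" for i
  proof -
    have "col B 0 = mat_adjoint W *\<^sub>v (A *\<^sub>v col W 0)"
      using A W W' unfolding B_def
      by (simp add: assoc_mult_mat[of _ ?n ?n _ ?n _ ?n] mult_carrier_mat[of _ ?n ?n _ ?n] col_mult2[of _ ?n ?n _ ?n]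
          del: col_mult)
    also have "A *\<^sub>v col W 0 = y 0 \<cdot>\<^sub>v col W 0"
      unfolding W0 using A v ev by (simp add: mult_mat_vec[of _ ?n ?n] smult_smult_assoc mult.commute)
    also have "mat_adjoint W *\<^sub>v (y 0 \<cdot>\<^sub>v col W 0) = y 0 \<cdot>\<^sub>v (mat_adjoint W *\<^sub>v col W 0)"
      by (rule mult_mat_vec[OF W']) (rule carrier_vecI, use W in simp)
    also have "mat_adjoint W *\<^sub>v col W 0 = col (mat_adjoint W * W) 0"
      using W W' by (simp add: col_mult2[of _ ?n ?n _ ?n] del: col_mult)
    also have "\<dots> = unit_vec ?n 0" unfolding WW by simp
    finally have c0: "col B 0 = y 0 \<cdot>\<^sub>v unit_vec ?n 0" .
    have "B $$ (i,0) = col B 0 $ i" using B that by (simp del: c0)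
    also have "\<dots> = (if i = 0 then y 0 else 0)" using c0 that by simp
    finally show ?thesis .
  qed
  \<comment> \<open>The first row of \<open>B\<close> vanishes off the diagonal because the first column does and \<open>B\<close> is Hermitian.\<close>
  have Brow: "B $$ (0,i) = (if i = 0 then y 0 else 0)" if "i < ?n" for i
  proof (cases "i = 0")
    case False
    have "B $$ (0,i) = mat_adjoint B $$ (0,i)" by (simp add: Bherm)
    also have "\<dots> = cnj (B $$ (i,0))" using B that by (simp add: mat_adjoint_index[of _ ?n ?n])
    finally show ?thesis using Bcol[OF that] False by simp
  qed (use Bcol[of 0] in simp)
  define B3 where "B3 = mat n n (\<lambda>(i,j). B $$ (Suc i, Suc j))"
  have B3: "B3 \<in> carrier_mat n n" by (simp add: B3_def)
  define D1 where "D1 = mat 1 1 (\<lambda>_. y 0)"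
  have D1: "D1 \<in> carrier_mat 1 1" by (simp add: D1_def)
  have Bblock: "B = four_block_mat D1 (0\<^sub>m 1 n) (0\<^sub>m n 1) B3"
  proof (rule eq_matI)
    fix i j assume "i < dim_row (four_block_mat D1 (0\<^sub>m 1 n) (0\<^sub>m n 1) B3)"
      "j < dim_col (four_block_mat D1 (0\<^sub>m 1 n) (0\<^sub>m n 1) B3)"
    then show "B $$ (i,j) = four_block_mat D1 (0\<^sub>m 1 n) (0\<^sub>m n 1) B3 $$ (i,j)"
      using Bcol[of i] Brow[of j] by (cases i; cases j) (auto simp: D1_def B3_def)
  qed (use B in \<open>auto simp: D1_def B3_def\<close>)
  have "similar_mat B A"
    by (rule similar_matI[of _ _ "mat_adjoint W" W ?n]) (use A W W' B WW WW2 in \<open>auto simp: B_def\<close>)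
  then have "char_poly B = (\<Prod>i<?n. [:- y i, 1:])" using char_poly_similar cp by metis
  moreover have "char_poly B = char_poly D1 * char_poly B3"
    unfolding Bblock by (rule char_poly_four_block_zeros_col[OF D1 _ B3]) simp
  moreover have "char_poly D1 = [:- y 0, 1:]"
    by (simp add: D1_def char_poly_defs det_def sign_def)
  ultimately have "[:- y 0, 1:] * char_poly B3 = (\<Prod>i<?n. [:- y i, 1:])" by (simp only:)
  also have "\<dots> = [:- y 0, 1:] * (\<Prod>i<n. [:- y (Suc i), 1:])" by (rule prod.lessThan_Suc_shift)
  finally have cpB3: "char_poly B3 = (\<Prod>i<n. [:- y (Suc i), 1:])" by (subst (asm) mult_cancel_left) auto
  have "mat_adjoint B3 = B3"
  proof (rule eq_matI)
    fix i j assume "i < dim_row B3" "j < dim_col B3"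
    then have ij: "i < n" "j < n" by (auto simp: B3_def)
    have "B $$ (Suc i, Suc j) = mat_adjoint B $$ (Suc i, Suc j)" by (simp add: Bherm)
    also have "\<dots> = cnj (B $$ (Suc j, Suc i))" using B ij by (simp add: mat_adjoint_index[of _ ?n ?n])
    finally show "mat_adjoint B3 $$ (i,j) = B3 $$ (i,j)"
      using ij B3 by (simp add: mat_adjoint_index[of _ n n]) (simp add: B3_def)
  qed (auto simp: mat_adjoint_eq B3_def)
  from Suc.IH[OF B3 this cpB3] obtain V where V: "V \<in> carrier_mat n n"
    and VV: "mat_adjoint V * V = 1\<^sub>m n" and B3_eq: "B3 = V * diag_of n (\<lambda>i. y (Suc i)) * mat_adjoint V" by blast
  define V1 where "V1 = four_block_mat (1\<^sub>m 1) (0\<^sub>m 1 n) (0\<^sub>m n 1) V"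
  have V1: "V1 \<in> carrier_mat ?n ?n" using V by (auto simp: V1_def)
  have V': "mat_adjoint V \<in> carrier_mat n n" using V by simp
  have V1adj: "mat_adjoint V1 = four_block_mat (1\<^sub>m 1) (0\<^sub>m 1 n) (0\<^sub>m n 1) (mat_adjoint V)"
    by (rule eq_matI) (use V in \<open>auto simp: V1_def mat_adjoint_eq\<close>)
  have V1V1: "mat_adjoint V1 * V1 = 1\<^sub>m ?n"
  proof -
    have "mat_adjoint V1 * V1 = four_block_mat (1\<^sub>m 1) (0\<^sub>m 1 n) (0\<^sub>m n 1) (1\<^sub>m n)"
      unfolding V1adj unfolding V1_def
      by (subst mult_four_block_mat[of _ 1 1 _ n _ n _ _ 1 _ n]) (use V V' VV in \<open>auto simp: right_mult_zero_mat[of _ n n]\<close>)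
    also have "\<dots> = 1\<^sub>m ?n" by (rule eq_matI) auto
    finally show ?thesis .
  qed
  have Deq: "diag_of ?n y = four_block_mat D1 (0\<^sub>m 1 n) (0\<^sub>m n 1) (diag_of n (\<lambda>i. y (Suc i)))"
    by (rule eq_matI) (auto simp: diag_of_def D1_def)
  have VDV: "V1 * diag_of ?n y * mat_adjoint V1 = B"
  proof -
    have "V1 * diag_of ?n y = four_block_mat D1 (0\<^sub>m 1 n) (0\<^sub>m n 1) (V * diag_of n (\<lambda>i. y (Suc i)))"
      unfolding V1_def Deq
      by (subst mult_four_block_mat[of _ 1 1 _ n _ n _ _ 1 _ n]) (use V D1 in \<open>auto simp: diag_of_def\<close>)
    also have "\<dots> * mat_adjoint V1 = four_block_mat D1 (0\<^sub>m 1 n) (0\<^sub>m n 1) B3"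
      unfolding V1adj
      by (subst mult_four_block_mat[of _ 1 1 _ n _ n _ _ 1 _ n]) (use V V' D1 B3_eq in \<open>auto simp: diag_of_def\<close>)
    finally show ?thesis using Bblock by simp
  qed
  have "A = W * (V1 * diag_of ?n y * mat_adjoint V1) * mat_adjoint W" using A_eq unfolding VDV .
  also have "\<dots> = (W * V1) * diag_of ?n y * mat_adjoint (W * V1)"
    using W W' V1 mat_adjoint_carrier[OF V1] diag_of_carrier[of ?n y]
    by (simp add: mat_adjoint_mult[of _ ?n ?n _ ?n] assoc_mult_mat[of _ ?n ?n _ ?n _ ?n] mult_carrier_mat[of _ ?n ?n _ ?n])
  finally have A_eq': "A = (W * V1) * diag_of ?n y * mat_adjoint (W * V1)" .
  have "mat_adjoint (W * V1) * (W * V1) = mat_adjoint V1 * (mat_adjoint W * W) * V1"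
    using W W' V1 mat_adjoint_carrier[OF V1]
    by (simp add: mat_adjoint_mult[of _ ?n ?n _ ?n] assoc_mult_mat[of _ ?n ?n _ ?n _ ?n] mult_carrier_mat[of _ ?n ?n _ ?n])
  also have "\<dots> = 1\<^sub>m ?n" using V1 mat_adjoint_carrier[OF V1] WW V1V1 by simp
  finally show ?case using A_eq' W V1 by (intro exI[of _ "W * V1"]) auto
qed

lemma hermitian_unitarily_diagonalizableE:
  fixes A :: "complex mat"
  assumes "A \<in> carrier_mat n n" "mat_adjoint A = A"
  obtains U y where "U \<in> carrier_mat n n" "mat_adjoint U * U = 1\<^sub>m n" "U * mat_adjoint U = 1\<^sub>m n"
    "A = U * diag_of n y * mat_adjoint U"
proof -
  obtain as where as: "char_poly A = (\<Prod>a\<leftarrow>as. [:- a, 1:])" "length as = n"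
    using char_poly_factorized[OF assms(1)] by blast
  have "char_poly A = (\<Prod>i<n. [:- (as ! i), 1:])"
    unfolding as(1) using as(2) by (simp add: prod.list_conv_set_nth atLeast0LessThan)
  from hermitian_unitarily_diagonalizable[OF assms this] obtain U where
    "U \<in> carrier_mat n n" "mat_adjoint U * U = 1\<^sub>m n" "A = U * diag_of n (\<lambda>i. as ! i) * mat_adjoint U" by blast
  moreover from this have "U * mat_adjoint U = 1\<^sub>m n"
    using mat_mult_left_right_inverse[of "mat_adjoint U" n U] by simp
  ultimately show ?thesis using that by blast
qed

lemma unitary_conjugation:
  fixes A :: "complex mat"
  assumes U: "U \<in> carrier_mat n n" "mat_adjoint U * U = 1\<^sub>m n" and D: "D \<in> carrier_mat n n"
    and A: "A = U * D * mat_adjoint U"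
  shows "mat_adjoint U * A * U = D"
proof -
  have U': "mat_adjoint U \<in> carrier_mat n n" using U by simp
  have "mat_adjoint U * A * U = (mat_adjoint U * U) * D * (mat_adjoint U * U)"
    unfolding A using U(1) U' D by (simp add: assoc_mult_mat[of _ n n _ n _ n] mult_carrier_mat[of _ n n _ n])
  then show ?thesis using U(2) D by simp
qed

section \<open>Linear change of variables in complex coordinate space\<close>

lemma
  fixes N :: "'b measure"
  assumes N: "sigma_finite_measure N" and [measurable]: "f \<in> borel_measurable (PiM {..<Suc m} (\<lambda>_. N))"
  shows nn_integral_PiM_Suc:
      "(\<integral>\<^sup>+x. f x \<partial>PiM {..<Suc m} (\<lambda>_. N)) = (\<integral>\<^sup>+x. \<integral>\<^sup>+u. f (x(m := u)) \<partial>N \<partial>PiM {..<m} (\<lambda>_. N))"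
    and nn_integral_PiM_Suc_rev:
      "(\<integral>\<^sup>+x. f x \<partial>PiM {..<Suc m} (\<lambda>_. N)) = (\<integral>\<^sup>+u. \<integral>\<^sup>+x. f (x(m := u)) \<partial>PiM {..<m} (\<lambda>_. N) \<partial>N)"
proof -
  interpret N: sigma_finite_measure N by fact
  interpret product_sigma_finite "\<lambda>_::nat. N" by unfold_locales
  show "(\<integral>\<^sup>+x. f x \<partial>PiM {..<Suc m} (\<lambda>_. N)) = (\<integral>\<^sup>+x. \<integral>\<^sup>+u. f (x(m := u)) \<partial>N \<partial>PiM {..<m} (\<lambda>_. N))"
    using product_nn_integral_insert[of "{..<m}" m f] assms by (simp add: lessThan_Suc)
  show "(\<integral>\<^sup>+x. f x \<partial>PiM {..<Suc m} (\<lambda>_. N)) = (\<integral>\<^sup>+u. \<integral>\<^sup>+x. f (x(m := u)) \<partial>PiM {..<m} (\<lambda>_. N) \<partial>N)"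
    using product_nn_integral_insert_rev[of "{..<m}" m f] assms by (simp add: lessThan_Suc)
qed

lemma sigma_finite_PiM:
  assumes "sigma_finite_measure N"
  shows "sigma_finite_measure (PiM {..<m::nat} (\<lambda>_. N))"
proof -
  interpret N: sigma_finite_measure N by fact
  interpret product_sigma_finite "\<lambda>_::nat. N" by unfold_locales
  show ?thesis by (rule sigma_finite) simp
qed

lemma sigma_finite_cvec_space: "sigma_finite_measure (cvec_space n)"
  by (rule sigma_finite_PiM) (rule lborel.sigma_finite_measure_axioms)

lemma measurable_fun_upd_Suc [measurable (raw)]:
  assumes "f \<in> measurable M (PiM {..<m} (\<lambda>_. N))" "g \<in> measurable M N"
  shows "(\<lambda>x. (f x)(m := g x)) \<in> measurable M (PiM {..<Suc m} (\<lambda>_. N))"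
  by (rule measurable_fun_upd[OF _ assms]) (auto simp: lessThan_Suc)

text \<open>
  The translation \<open>b\<close> is there for the induction below: once the last coordinate is fixed, its
  contribution to the other coordinates is a translation.
\<close>

definition affine_map :: "nat \<Rightarrow> complex mat \<Rightarrow> (nat \<Rightarrow> complex) \<Rightarrow> (nat \<Rightarrow> complex) \<Rightarrow> nat \<Rightarrow> complex" where
  "affine_map n A b z = (\<lambda>i\<in>{..<n}. (\<Sum>j<n. A $$ (i,j) * z j) + b i)"

lemma measurable_affine_map [measurable (raw)]:
  assumes [measurable]: "f \<in> measurable M (PiM {..<n} (\<lambda>_. borel))" "\<And>i. i < n \<Longrightarrow> (\<lambda>x. b x i) \<in> borel_measurable M"
  shows "(\<lambda>x. affine_map n A (b x) (f x)) \<in> measurable M (PiM {..<n} (\<lambda>_. borel))"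
  unfolding affine_map_def by measurable

text \<open>
  For fixed values of the other coordinates, this is translation invariance in the coordinate \<open>i\<close>.
\<close>

lemma nn_integral_shear:
  assumes [measurable]: "f \<in> borel_measurable (cvec_space n)" and ij: "i < n" "j < n" "i \<noteq> j"
  shows "(\<integral>\<^sup>+z. f (z(i := z i + z j)) \<partial>cvec_space n) = (\<integral>\<^sup>+z. f z \<partial>cvec_space n)"
proof -
  interpret product_sigma_finite "\<lambda>_::nat. lborel :: complex measure" by unfold_locales
  define I where "I = {..<n} - {i}"
  have I: "{..<n} = insert i I" "finite I" "i \<notin> I" using ij by (auto simp: I_def)
  have f'[measurable]: "f \<in> borel_measurable (PiM (insert i I) (\<lambda>_. lborel))" using assms(1) by (simp add: I(1))
  have "j \<in> I" using ij by (auto simp: I_def)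
  then have [measurable]: "(\<lambda>z. z j) \<in> borel_measurable (PiM I (\<lambda>_. lborel :: complex measure))"
    by (metis measurable_component_singleton measurable_lborel1)
  have upd[measurable]: "(\<lambda>z. z(i := z i + z j)) \<in> measurable (PiM (insert i I) (\<lambda>_. lborel)) (PiM (insert i I) (\<lambda>_. lborel :: complex measure))"
  proof (rule measurable_fun_upd[where J = "insert i I"])
    have "(\<lambda>z. z i) \<in> borel_measurable (PiM (insert i I) (\<lambda>_. lborel :: complex measure))"
       "(\<lambda>z. z j) \<in> borel_measurable (PiM (insert i I) (\<lambda>_. lborel :: complex measure))"
      using \<open>j \<in> I\<close> by (metis insertI1 insertI2 measurable_component_singleton measurable_lborel1)+
    then show "(\<lambda>z. z i + z j) \<in> measurable (PiM (insert i I) (\<lambda>_. lborel)) (lborel :: complex measure)" by simp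
  qed auto
  have "(\<integral>\<^sup>+z. f (z(i := z i + z j)) \<partial>PiM (insert i I) (\<lambda>_. lborel))
      = (\<integral>\<^sup>+x. \<integral>\<^sup>+t. f (x(i := t + x j)) \<partial>lborel \<partial>PiM I (\<lambda>_. lborel))"
    by (subst product_nn_integral_insert[OF I(2,3)]) (use ij(3)[symmetric] in \<open>auto intro!: measurable_compose[OF upd f']\<close>)
  also have "\<dots> = (\<integral>\<^sup>+x. \<integral>\<^sup>+t. f (x(i := t)) \<partial>lborel \<partial>PiM I (\<lambda>_. lborel))"
  proof (rule nn_integral_cong)
    fix x :: "nat \<Rightarrow> complex" assume x: "x \<in> space (PiM I (\<lambda>_. lborel))"
    have "(\<lambda>t. f (x(i := t))) \<in> borel_measurable borel"
      using measurable_compose[OF measurable_component_update[OF x I(3)] f'] by simp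
    then show "(\<integral>\<^sup>+t. f (x(i := t + x j)) \<partial>lborel) = (\<integral>\<^sup>+t. f (x(i := t)) \<partial>lborel)"
      using nn_integral_complex_affine[of "\<lambda>t. f (x(i := t))" 1 "x j"] by simp
  qed
  also have "\<dots> = (\<integral>\<^sup>+z. f z \<partial>PiM (insert i I) (\<lambda>_. lborel))"
    by (rule product_nn_integral_insert[OF I(2,3) f', symmetric])
  finally show ?thesis unfolding I(1) .
qed

text \<open>
  The inner matrix is the Schur complement of the entry \<open>A $$ (n,n)\<close>.
\<close>

lemma det_pivot:
  fixes A :: "'a::field mat"
  assumes A: "A \<in> carrier_mat (Suc n) (Suc n)" and a: "A $$ (n,n) \<noteq> 0"
  shows "Determinant.det A = A $$ (n,n) *
    Determinant.det (mat n n (\<lambda>(i,j). A $$ (i,j) - A $$ (i,n) * A $$ (n,j) / A $$ (n,n)))"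
proof -
  let ?a = "A $$ (n,n)"
  define B where "B = mat n n (\<lambda>(i,j). A $$ (i,j) - A $$ (i,n) * A $$ (n,j) / ?a)"
  define L where "L = mat (Suc n) (Suc n) (\<lambda>(i,j). if i = j then 1 else if j = n then A $$ (i,n) / ?a else 0)"
  define R where "R = four_block_mat B (0\<^sub>m n 1) (mat 1 n (\<lambda>(_,j). A $$ (n,j))) (mat 1 1 (\<lambda>_. ?a))"
  have L: "L \<in> carrier_mat (Suc n) (Suc n)" and R: "R \<in> carrier_mat (Suc n) (Suc n)"
    by (auto simp: L_def R_def B_def)
  \<comment> \<open>Gaussian elimination of the last column: \<open>L\<close> is unipotent, \<open>R\<close> is block lower triangular.\<close>
  have "A = L * R"
  proof (rule eq_matI)
    fix i j assume "i < dim_row (L * R)" "j < dim_col (L * R)"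
    then have ij: "i < Suc n" "j < Suc n" using L R by auto
    have Rl: "R $$ (l,j) = (if l < n then if j < n then B $$ (l,j) else 0 else A $$ (n,j))" if "l < Suc n" for l
      using that ij by (auto simp: R_def B_def less_Suc_eq)
    have "(L * R) $$ (i,j) = (\<Sum>l<Suc n. L $$ (i,l) * R $$ (l,j))"
      using ij L R by (auto simp: scalar_prod_def atLeast0LessThan)
    also have "\<dots> = (\<Sum>l<n. L $$ (i,l) * R $$ (l,j)) + L $$ (i,n) * A $$ (n,j)" by (simp add: Rl)
    also have "(\<Sum>l<n. L $$ (i,l) * R $$ (l,j)) = (\<Sum>l<n. if l = i then R $$ (l,j) else 0)"
      by (rule sum.cong) (use ij in \<open>auto simp: L_def\<close>)
    also have "\<dots> = (if i < n then R $$ (i,j) else 0)" by simp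
    finally show "A $$ (i,j) = (L * R) $$ (i,j)"
      using ij a by (auto simp: Rl L_def B_def less_Suc_eq)
  qed (use A L R in auto)
  then have "Determinant.det A = Determinant.det L * Determinant.det R" using det_mult[OF L R] by simp
  also have "Determinant.det L = prod_list (diag_mat L)"
    by (rule det_upper_triangular[OF _ L]) (auto simp: L_def)
  also have "\<dots> = 1" by (simp add: prod_list_diag_prod L_def)
  also have "Determinant.det R = Determinant.det B * Determinant.det (mat 1 1 (\<lambda>_. ?a))"
    unfolding R_def by (rule det_four_block_mat_upper_right_zero) (auto simp: B_def)
  also have "Determinant.det (mat 1 1 (\<lambda>_. ?a)) = ?a" by (simp add: det_def sign_def)
  finally show ?thesis by (simp add: B_def mult.commute)
qed

text \<open>
  Substitute \<open>s = (A z + b)\<^sub>n\<close> for the last coordinate \<open>t\<close> of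
  \<open>z\<close>. This costs the factor \<open>\<bar>A $$ (n,n)\<bar>\<^sup>2\<close>. For fixed
  \<open>s\<close>, the remaining coordinates of \<open>A z + b\<close> are an affine function of the remaining
  coordinates of \<open>z\<close>, whose linear part is the Schur complement \<open>B\<close>.
\<close>

lemma nn_integral_affine_map_pivot:
  assumes A: "A \<in> carrier_mat (Suc n) (Suc n)" and a: "A $$ (n,n) \<noteq> 0" and det: "Determinant.det A \<noteq> 0"
    and f[measurable]: "f \<in> borel_measurable (cvec_space (Suc n))"
    and IH: "\<And>B b f. B \<in> carrier_mat n n \<Longrightarrow> Determinant.det B \<noteq> 0 \<Longrightarrow> f \<in> borel_measurable (cvec_space n) \<Longrightarrow>
      ennreal ((cmod (Determinant.det B))\<^sup>2) * (\<integral>\<^sup>+z. f (affine_map n B b z) \<partial>cvec_space n) = (\<integral>\<^sup>+z. f z \<partial>cvec_space n)"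
  shows "ennreal ((cmod (Determinant.det A))\<^sup>2) * (\<integral>\<^sup>+z. f (affine_map (Suc n) A b z) \<partial>cvec_space (Suc n))
       = (\<integral>\<^sup>+z. f z \<partial>cvec_space (Suc n))"
proof -
  let ?a = "A $$ (n,n)"
  define B where "B = mat n n (\<lambda>(i,j). A $$ (i,j) - A $$ (i,n) * A $$ (n,j) / ?a)"
  define b' where "b' s i = A $$ (i,n) * (s - b n) / ?a + b i" for s i
  define w where "w x = (\<Sum>j<n. A $$ (n,j) * x j) + b n" for x
  have detA: "Determinant.det A = ?a * Determinant.det B" unfolding B_def by (rule det_pivot[OF A a])
  have B: "B \<in> carrier_mat n n" "Determinant.det B \<noteq> 0" using det detA by (auto simp: B_def)
  note sf = lborel.sigma_finite_measure_axioms sigma_finite_cvec_space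
  have eq: "affine_map (Suc n) A b (x(n := t)) = (affine_map n B (b' (?a * t + w x)) x)(n := ?a * t + w x)" for x t
  proof
    fix i
    have "(\<Sum>j<n. B $$ (i,j) * x j) = (\<Sum>j<n. A $$ (i,j) * x j) - A $$ (i,n) / ?a * (\<Sum>j<n. A $$ (n,j) * x j)" if "i < n"
      using that unfolding sum_distrib_left sum_subtractf[symmetric] by (intro sum.cong) (auto simp: B_def algebra_simps)
    then show "affine_map (Suc n) A b (x(n := t)) i = ((affine_map n B (b' (?a * t + w x)) x)(n := ?a * t + w x)) i"
      using a by (auto simp: affine_map_def b'_def w_def less_Suc_eq field_simps)
  qed
  define G where "G s x = f ((affine_map n B (b' s) x)(n := s))" for s x
  have G[measurable]: "case_prod G \<in> borel_measurable (lborel \<Otimes>\<^sub>M cvec_space n)"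
    unfolding G_def b'_def by measurable
  have w[measurable]: "w \<in> borel_measurable (cvec_space n)" unfolding w_def by measurable
  interpret C: sigma_finite_measure "cvec_space n" by (rule sf)
  have "(\<integral>\<^sup>+z. f (affine_map (Suc n) A b z) \<partial>cvec_space (Suc n))
      = (\<integral>\<^sup>+x. \<integral>\<^sup>+t. f (affine_map (Suc n) A b (x(n := t))) \<partial>lborel \<partial>cvec_space n)"
    by (rule nn_integral_PiM_Suc[OF sf(1)]) measurable
  also have "\<dots> = (\<integral>\<^sup>+x. \<integral>\<^sup>+t. G (?a * t + w x) x \<partial>lborel \<partial>cvec_space n)"
    by (simp add: eq G_def)
  finally have "ennreal ((cmod ?a)\<^sup>2) * (\<integral>\<^sup>+z. f (affine_map (Suc n) A b z) \<partial>cvec_space (Suc n))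
      = (\<integral>\<^sup>+x. ennreal ((cmod ?a)\<^sup>2) * (\<integral>\<^sup>+t. G (?a * t + w x) x \<partial>lborel) \<partial>cvec_space n)"
    by (simp add: nn_integral_cmult)
  also have "\<dots> = (\<integral>\<^sup>+x. \<integral>\<^sup>+s. G s x \<partial>lborel \<partial>cvec_space n)"
  proof (rule nn_integral_cong)
    fix x :: "nat \<Rightarrow> complex" assume x[measurable]: "x \<in> space (cvec_space n)"
    have "(\<lambda>s. G s x) \<in> borel_measurable borel" by measurable
    then show "ennreal ((cmod ?a)\<^sup>2) * (\<integral>\<^sup>+t. G (?a * t + w x) x \<partial>lborel) = (\<integral>\<^sup>+s. G s x \<partial>lborel)"
      by (rule nn_integral_complex_affine[OF _ a])
  qed
  also have "\<dots> = (\<integral>\<^sup>+s. \<integral>\<^sup>+x. G s x \<partial>cvec_space n \<partial>lborel)"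
    by (rule pair_sigma_finite.Fubini'[symmetric]) (use sf G in \<open>auto simp: pair_sigma_finite_def\<close>)
  finally have 1: "ennreal ((cmod ?a)\<^sup>2) * (\<integral>\<^sup>+z. f (affine_map (Suc n) A b z) \<partial>cvec_space (Suc n))
    = (\<integral>\<^sup>+s. \<integral>\<^sup>+x. G s x \<partial>cvec_space n \<partial>lborel)" .
  have "ennreal ((cmod (Determinant.det A))\<^sup>2) * (\<integral>\<^sup>+z. f (affine_map (Suc n) A b z) \<partial>cvec_space (Suc n))
    = ennreal ((cmod (Determinant.det B))\<^sup>2) * (ennreal ((cmod ?a)\<^sup>2) * (\<integral>\<^sup>+z. f (affine_map (Suc n) A b z) \<partial>cvec_space (Suc n)))"
    unfolding detA by (simp add: norm_mult power_mult_distrib ennreal_mult mult_ac)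
  also have "\<dots> = (\<integral>\<^sup>+s. ennreal ((cmod (Determinant.det B))\<^sup>2) * (\<integral>\<^sup>+x. G s x \<partial>cvec_space n) \<partial>lborel)"
    unfolding 1 by (rule nn_integral_cmult[symmetric]) measurable
  also have "\<dots> = (\<integral>\<^sup>+s. \<integral>\<^sup>+x. f (x(n := s)) \<partial>cvec_space n \<partial>lborel)"
  proof (rule nn_integral_cong)
    fix s :: complex
    have "(\<lambda>x. f (x(n := s))) \<in> borel_measurable (cvec_space n)"
      by (rule measurable_compose[OF _ f], rule measurable_fun_upd_Suc) auto
    then show "ennreal ((cmod (Determinant.det B))\<^sup>2) * (\<integral>\<^sup>+x. G s x \<partial>cvec_space n)
      = (\<integral>\<^sup>+x. f (x(n := s)) \<partial>cvec_space n)"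
      using IH[OF B, of "\<lambda>x. f (x(n := s))" "b' s"] by (simp add: G_def)
  qed
  also have "\<dots> = (\<integral>\<^sup>+z. f z \<partial>cvec_space (Suc n))"
    by (rule nn_integral_PiM_Suc_rev[OF sf(1) f, symmetric])
  finally show ?thesis .
qed

text \<open>
  Induction on the dimension. A vanishing pivot is made nonzero by a shear, which changes neither the integral nor
  the determinant.
\<close>

lemma nn_integral_affine_map:
  assumes "A \<in> carrier_mat n n" "Determinant.det A \<noteq> 0" "f \<in> borel_measurable (cvec_space n)"
  shows "ennreal ((cmod (Determinant.det A))\<^sup>2) * (\<integral>\<^sup>+z. f (affine_map n A b z) \<partial>cvec_space n)
       = (\<integral>\<^sup>+z. f z \<partial>cvec_space n)"
  using assms
proof (induction n arbitrary: A b f)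
  case 0
  have "affine_map 0 A b z = z" if "z \<in> space (cvec_space 0)" for z
    using that by (auto simp: affine_map_def space_PiM)
  then have "(\<integral>\<^sup>+z. f (affine_map 0 A b z) \<partial>cvec_space 0) = (\<integral>\<^sup>+z. f z \<partial>cvec_space 0)"
    by (intro nn_integral_cong) auto
  then show ?case using 0 by (simp add: det_dim_zero)
next
  case (Suc n)
  note A = Suc.prems(1) and det = Suc.prems(2) and f[measurable] = Suc.prems(3)
  show ?case
  proof (cases "A $$ (n,n) = 0")
    case False
    show ?thesis by (rule nn_integral_affine_map_pivot[OF A False det f Suc.IH])
  next
    case True
    have "\<exists>j<Suc n. A $$ (n,j) \<noteq> 0"
    proof (rule ccontr)
      assume *: "\<not> ?thesis"
      have T: "transpose_mat A \<in> carrier_mat (Suc n) (Suc n)" using A by simp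
      have "transpose_mat A *\<^sub>v unit_vec (Suc n) n = 0\<^sub>v (Suc n)"
        by (rule eq_vecI) (use A * in auto)
      then have "Determinant.det (transpose_mat A) = 0"
        unfolding det_0_iff_vec_prod_zero_field[OF T] by (intro exI[of _ "unit_vec (Suc n) n"]) auto
      then show False using det det_transpose[OF A] by simp
    qed
    then obtain j where j: "j < n" "A $$ (n,j) \<noteq> 0" using True by (auto simp: less_Suc_eq)
    \<comment> \<open>Right multiplication by \<open>E\<close> adds column \<open>j\<close> to the last column, in which the entry \<open>(n,n)\<close> becomes \<open>A $$ (n,j)\<close>.\<close>
    define E where "E = mat (Suc n) (Suc n) (\<lambda>(i,k). if i = k then 1 else if i = j \<and> k = n then 1 else (0::complex))"
    define A' where "A' = A * E"
    have E: "E \<in> carrier_mat (Suc n) (Suc n)" by (simp add: E_def)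
    have A': "A' \<in> carrier_mat (Suc n) (Suc n)" unfolding A'_def using A E by simp
    have "Determinant.det E = prod_list (diag_mat E)"
      by (rule det_upper_triangular[OF _ E]) (use j in \<open>auto simp: E_def\<close>)
    then have "Determinant.det E = 1" by (simp add: prod_list_diag_prod E_def)
    then have det': "Determinant.det A' = Determinant.det A" using det_mult[OF A E] by (simp add: A'_def)
    have ent: "A' $$ (i,k) = (if k = n then A $$ (i,n) + A $$ (i,j) else A $$ (i,k))" if "i < Suc n" "k < Suc n" for i k
    proof -
      have "A' $$ (i,k) = (\<Sum>l<Suc n. A $$ (i,l) * E $$ (l,k))"
        using that A E by (auto simp: A'_def scalar_prod_def atLeast0LessThan)
      also have "\<dots> = (\<Sum>l<Suc n. (if l = k then A $$ (i,l) else 0) + (if l = j then if k = n then A $$ (i,l) else 0 else 0))"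
        by (rule sum.cong) (use that j in \<open>auto simp: E_def\<close>)
      also have "\<dots> = (if k = n then A $$ (i,n) + A $$ (i,j) else A $$ (i,k))"
        unfolding sum.distrib using that j by (simp del: sum.lessThan_Suc)
      finally show ?thesis .
    qed
    have eq: "affine_map (Suc n) A b (z(j := z j + z n)) = affine_map (Suc n) A' b z" for z
    proof
      fix i
      have "(\<Sum>k<Suc n. A $$ (i,k) * (z(j := z j + z n)) k) = (\<Sum>k<Suc n. A' $$ (i,k) * z k)" if i: "i < Suc n"
      proof -
        have "(\<Sum>k<Suc n. A $$ (i,k) * (z(j := z j + z n)) k)
            = (\<Sum>k<Suc n. A $$ (i,k) * z k + (if k = j then A $$ (i,k) * z n else 0))"
          by (rule sum.cong) (auto simp: algebra_simps)
        also have "\<dots> = (\<Sum>k<Suc n. A $$ (i,k) * z k) + A $$ (i,j) * z n"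
          unfolding sum.distrib using j by (simp del: sum.lessThan_Suc)
        also have "\<dots> = (\<Sum>k<Suc n. A $$ (i,k) * z k + (if k = n then A $$ (i,j) * z k else 0))"
          unfolding sum.distrib by (simp del: sum.lessThan_Suc)
        also have "\<dots> = (\<Sum>k<Suc n. A' $$ (i,k) * z k)"
          by (rule sum.cong) (use i in \<open>auto simp: ent algebra_simps\<close>)
        finally show ?thesis .
      qed
      then show "affine_map (Suc n) A b (z(j := z j + z n)) i = affine_map (Suc n) A' b z i"
        by (auto simp: affine_map_def simp del: sum.lessThan_Suc)
    qed
    have "(\<integral>\<^sup>+z. f (affine_map (Suc n) A b z) \<partial>cvec_space (Suc n))
        = (\<integral>\<^sup>+z. f (affine_map (Suc n) A b (z(j := z j + z n))) \<partial>cvec_space (Suc n))"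
      by (rule nn_integral_shear[symmetric]) (use j in \<open>measurable, auto\<close>)
    also have "\<dots> = (\<integral>\<^sup>+z. f (affine_map (Suc n) A' b z) \<partial>cvec_space (Suc n))" by (simp add: eq)
    finally have shear: "(\<integral>\<^sup>+z. f (affine_map (Suc n) A b z) \<partial>cvec_space (Suc n))
        = (\<integral>\<^sup>+z. f (affine_map (Suc n) A' b z) \<partial>cvec_space (Suc n))" .
    have piv: "A' $$ (n,n) \<noteq> 0" using ent[of n n] True j by simp
    have "Determinant.det A' \<noteq> 0" using det det' by simp
    from nn_integral_affine_map_pivot[OF A' piv this f Suc.IH, of b]
    show ?thesis unfolding shear det' .
  qed
qed

text \<open>
  If a map changes the measure \<open>N\<close> by the factor \<open>c\<close>, then applying it in each of
  \<open>m\<close> independent coordinates changes the product measure by \<open>c ^ m\<close>.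
\<close>

lemma nn_integral_PiM_map:
  fixes N :: "'b measure"
  assumes N: "sigma_finite_measure N" and T[measurable]: "T \<in> measurable N N"
    and c: "\<And>g. g \<in> borel_measurable N \<Longrightarrow> c * (\<integral>\<^sup>+x. g (T x) \<partial>N) = (\<integral>\<^sup>+x. g x \<partial>N)"
    and f: "f \<in> borel_measurable (PiM {..<m} (\<lambda>_. N))"
  shows "c ^ m * (\<integral>\<^sup>+x. f (\<lambda>r\<in>{..<m}. T (x r)) \<partial>PiM {..<m} (\<lambda>_. N)) = (\<integral>\<^sup>+x. f x \<partial>PiM {..<m} (\<lambda>_. N))"
  using f
proof (induction m arbitrary: f)
  case 0
  interpret N: sigma_finite_measure N by fact
  interpret product_sigma_finite "\<lambda>_::nat. N" by unfold_locales
  show ?case unfolding lessThan_0 power_0 mult_1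
    by (subst (1 2) nn_integral_empty) (use 0 in \<open>simp_all add: restrict_def\<close>)
next
  case (Suc m)
  let ?P = "\<lambda>k. PiM {..<k::nat} (\<lambda>_. N)"
  define R where "R x = (\<lambda>r\<in>{..<m}. T (x r))" for x
  interpret N: sigma_finite_measure N by (rule N)
  have comp: "(\<lambda>x. T (x r)) \<in> measurable (?P k) N" if "r < k" for r k
    by (rule measurable_compose[OF measurable_component_singleton[of r "{..<k}" "\<lambda>_. N"]]) (use that T in simp_all)
  have R: "R \<in> measurable (?P m) (?P m)"
    unfolding R_def by (rule measurable_restrict) (rule comp, simp)
  have R': "(\<lambda>x. \<lambda>r\<in>{..<Suc m}. T (x r)) \<in> measurable (?P (Suc m)) (?P (Suc m))"
    by (rule measurable_restrict) (rule comp, simp)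
  have eq: "(\<lambda>r\<in>{..<Suc m}. T ((x(m := u)) r)) = (R x)(m := T u)" for x u
    by (auto simp: R_def fun_eq_iff)
  have fR: "(\<lambda>x. f (\<lambda>r\<in>{..<Suc m}. T (x r))) \<in> borel_measurable (?P (Suc m))"
    by (rule measurable_compose[OF R' Suc.prems])
  have f_upd: "(\<lambda>u. f (X(m := u))) \<in> borel_measurable N" if "X \<in> space (?P m)" for X
    by (rule measurable_compose[OF measurable_fun_upd_Suc Suc.prems]) (use that in auto)
  have h: "(\<lambda>X. \<integral>\<^sup>+u. f (X(m := u)) \<partial>N) \<in> borel_measurable (?P m)"
  proof (rule N.borel_measurable_nn_integral)
    have "(\<lambda>p. f ((fst p)(m := snd p))) \<in> borel_measurable (?P m \<Otimes>\<^sub>M N)"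
      by (rule measurable_compose[OF measurable_fun_upd_Suc Suc.prems]) auto
    then show "(\<lambda>(X, u). f (X(m := u))) \<in> borel_measurable (?P m \<Otimes>\<^sub>M N)" by (simp add: case_prod_beta)
  qed
  have "(\<integral>\<^sup>+x. f (\<lambda>r\<in>{..<Suc m}. T (x r)) \<partial>?P (Suc m)) = (\<integral>\<^sup>+x. \<integral>\<^sup>+u. f ((R x)(m := T u)) \<partial>N \<partial>?P m)"
    unfolding nn_integral_PiM_Suc[OF N fR] eq ..
  then have "c ^ Suc m * (\<integral>\<^sup>+x. f (\<lambda>r\<in>{..<Suc m}. T (x r)) \<partial>?P (Suc m))
      = c ^ m * (c * (\<integral>\<^sup>+x. \<integral>\<^sup>+u. f ((R x)(m := T u)) \<partial>N \<partial>?P m))"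
    by (simp only: power_Suc2 mult.assoc)
  also have "c * (\<integral>\<^sup>+x. \<integral>\<^sup>+u. f ((R x)(m := T u)) \<partial>N \<partial>?P m) = (\<integral>\<^sup>+x. c * (\<integral>\<^sup>+u. f ((R x)(m := T u)) \<partial>N) \<partial>?P m)"
  proof (rule nn_integral_cmult[symmetric], rule N.borel_measurable_nn_integral)
    have "(\<lambda>p. f ((R (fst p))(m := T (snd p)))) \<in> borel_measurable (?P m \<Otimes>\<^sub>M N)"
      by (rule measurable_compose[OF measurable_fun_upd_Suc Suc.prems])
         (rule measurable_compose[OF measurable_fst R], rule measurable_compose[OF measurable_snd T])
    then show "(\<lambda>(x, u). f ((R x)(m := T u))) \<in> borel_measurable (?P m \<Otimes>\<^sub>M N)" by (simp add: case_prod_beta)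
  qed
  also have "\<dots> = (\<integral>\<^sup>+x. (\<integral>\<^sup>+u. f ((R x)(m := u)) \<partial>N) \<partial>?P m)"
    by (intro nn_integral_cong c f_upd measurable_space[OF R])
  also have "c ^ m * \<dots> = (\<integral>\<^sup>+x. \<integral>\<^sup>+u. f (x(m := u)) \<partial>N \<partial>?P m)"
    using Suc.IH[OF h] unfolding R_def .
  also have "\<dots> = (\<integral>\<^sup>+x. f x \<partial>?P (Suc m))"
    by (rule nn_integral_PiM_Suc[OF N Suc.prems, symmetric])
  finally show ?case .
qed

section \<open>Gram determinants and row energies\<close>

text \<open>
  A complex \<open>n \<times> m\<close> matrix is represented by its family of columns, so that
  \<open>Z r i\<close> is the entry in row \<open>i\<close> and column \<open>r\<close>. Independent columns then
  amount to a product measure, and Lebesgue measure on matrices is a product of products.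
\<close>

abbreviation cmat_space :: "nat \<Rightarrow> nat \<Rightarrow> (nat \<Rightarrow> nat \<Rightarrow> complex) measure" where
  "cmat_space n m \<equiv> \<Pi>\<^sub>M r\<in>{..<m}. cvec_space n"

definition to_mat :: "nat \<Rightarrow> nat \<Rightarrow> (nat \<Rightarrow> nat \<Rightarrow> complex) \<Rightarrow> complex mat" where
  "to_mat n m Z = mat n m (\<lambda>(i,r). Z r i)"

definition gram_det :: "nat \<Rightarrow> nat \<Rightarrow> (nat \<Rightarrow> nat \<Rightarrow> complex) \<Rightarrow> real" where
  "gram_det n m Z = Re (Determinant.det (gram (to_mat n m Z)))"

definition row_energy :: "nat \<Rightarrow> (nat \<Rightarrow> nat \<Rightarrow> complex) \<Rightarrow> nat \<Rightarrow> real" where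
  "row_energy m Z i = (\<Sum>r<m. (cmod (Z r i))\<^sup>2)"

definition columnwise :: "nat \<Rightarrow> nat \<Rightarrow> complex mat \<Rightarrow> (nat \<Rightarrow> nat \<Rightarrow> complex) \<Rightarrow> nat \<Rightarrow> nat \<Rightarrow> complex" where
  "columnwise n m A Z = (\<lambda>r\<in>{..<m}. affine_map n A (\<lambda>_. 0) (Z r))"

lemma to_mat_carrier [simp]: "to_mat n m Z \<in> carrier_mat n m"
  by (simp add: to_mat_def)

lemma gram_carrier [simp]: "A \<in> carrier_mat n m \<Longrightarrow> gram A \<in> carrier_mat n n"
  by (auto simp: gram_def intro!: mult_carrier_mat)

lemma gram_index:
  assumes "A \<in> carrier_mat n m" "i < n" "j < n"
  shows "gram A $$ (i,j) = (\<Sum>r<m. A $$ (i,r) * cnj (A $$ (j,r)))"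
  unfolding gram_def using assms
  by (subst index_mult_sum[of _ n m _ n]) (auto simp: mat_adjoint_index)

lemma gram_diag_index:
  "A \<in> carrier_mat n m \<Longrightarrow> i < n \<Longrightarrow> gram A $$ (i,i) = of_real (\<Sum>r<m. (cmod (A $$ (i,r)))\<^sup>2)"
  by (simp add: gram_index complex_norm_square del: of_real_power)

lemma gram_hermitian: "A \<in> carrier_mat n m \<Longrightarrow> mat_adjoint (gram A) = gram A"
  unfolding gram_def by (subst mat_adjoint_mult[of _ n m _ n]) auto

lemma gram_mult:
  assumes A: "A \<in> carrier_mat k n" and B: "B \<in> carrier_mat n m"
  shows "gram (A * B) = A * gram B * mat_adjoint A"
proof -
  have A': "mat_adjoint A \<in> carrier_mat n k" and B': "mat_adjoint B \<in> carrier_mat m n" using A B by auto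
  show ?thesis
    unfolding gram_def mat_adjoint_mult[OF A B]
    using A B A' B' by (simp add: assoc_mult_mat[of _ k n _ m _ k] assoc_mult_mat[of _ k n _ n _ k] assoc_mult_mat[of _ n m _ n _ k] mult_carrier_mat[of _ m n _ k]
        mult_carrier_mat[of _ n m _ n])
qed

lemma det_gram_mult:
  assumes A: "A \<in> carrier_mat n n" and B: "B \<in> carrier_mat n m"
  shows "Determinant.det (gram (A * B)) = of_real ((cmod (Determinant.det A))\<^sup>2) * Determinant.det (gram B)"
proof -
  have gB: "gram B \<in> carrier_mat n n" using B by simp
  have "Determinant.det (gram (A * B)) = Determinant.det A * Determinant.det (gram B) * cnj (Determinant.det A)"
    unfolding gram_mult[OF A B]
    using A gB by (simp add: det_mult[of _ n] mult_carrier_mat[of _ n n _ n] det_mat_adjoint[OF A])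
  then show ?thesis by (simp add: complex_norm_square[symmetric] mult_ac)
qed

text \<open>
  Unitary conjugation turns the Gram matrix into a diagonal matrix, which is itself the Gram matrix of
  \<open>U\<^sup>* A\<close>. Its diagonal entries are squared norms of rows.
\<close>

lemma det_gram_nonneg:
  assumes A: "A \<in> carrier_mat n m"
  shows "Im (Determinant.det (gram A)) = 0" "0 \<le> Re (Determinant.det (gram A))"
proof -
  have G: "gram A \<in> carrier_mat n n" using A by simp
  obtain U y where U: "U \<in> carrier_mat n n" "mat_adjoint U * U = 1\<^sub>m n" "U * mat_adjoint U = 1\<^sub>m n"
    and eq: "gram A = U * diag_of n y * mat_adjoint U"
    using hermitian_unitarily_diagonalizableE[OF G gram_hermitian[OF A]] by blast
  have U': "mat_adjoint U \<in> carrier_mat n n" using U by simp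
  have D: "mat_adjoint U * gram A * U = diag_of n y"
    by (rule unitary_conjugation[OF U(1,2) _ eq]) simp
  have gD: "gram (mat_adjoint U * A) = diag_of n y"
    using gram_mult[OF U' A] D by simp
  have y: "y i = of_real (\<Sum>r<m. (cmod ((mat_adjoint U * A) $$ (i,r)))\<^sup>2)" if "i < n" for i
  proof -
    have "y i = gram (mat_adjoint U * A) $$ (i,i)" using that by (simp add: gD diag_of_def)
    then show ?thesis using gram_diag_index[OF mult_carrier_mat[OF U' A] that] by simp
  qed
  have "(cmod (Determinant.det (mat_adjoint U)))\<^sup>2 = 1"
    using unitary_det_norm[OF U'] U(2) by simp
  then have "Determinant.det (gram A) = Determinant.det (diag_of n y)"
    using det_gram_mult[OF U' A] gD by simp
  also have "\<dots> = (\<Prod>i<n. of_real (\<Sum>r<m. (cmod ((mat_adjoint U * A) $$ (i,r)))\<^sup>2))"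
    unfolding det_diag_of by (intro prod.cong) (auto simp: y)
  finally have *: "Determinant.det (gram A) = of_real (\<Prod>i<n. \<Sum>r<m. (cmod ((mat_adjoint U * A) $$ (i,r)))\<^sup>2)" by simp
  show "Im (Determinant.det (gram A)) = 0" "0 \<le> Re (Determinant.det (gram A))"
    unfolding * Re_complex_of_real Im_complex_of_real by (auto intro!: prod_nonneg sum_nonneg)
qed

lemma gram_det_nonneg: "0 \<le> gram_det n m Z"
  unfolding gram_det_def by (rule det_gram_nonneg[OF to_mat_carrier])

lemma row_energy_nonneg: "0 \<le> row_energy m Z i"
  unfolding row_energy_def by (intro sum_nonneg) auto

lemma gram_to_mat_diag: "i < n \<Longrightarrow> gram (to_mat n m Z) $$ (i,i) = of_real (row_energy m Z i)"
  using gram_diag_index[OF to_mat_carrier, of i n m Z] by (simp add: row_energy_def to_mat_def)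

lemma cmat_entry_borel:
  assumes "i < n" "r < m"
  shows "(\<lambda>Z. Z r i) \<in> borel_measurable (cmat_space n m)"
proof -
  have "(\<lambda>Z. Z r i) \<in> measurable (cmat_space n m) lborel"
    by (rule measurable_compose[OF measurable_component_singleton[of r "{..<m}" "\<lambda>_. cvec_space n"]
          measurable_component_singleton[of i "{..<n}" "\<lambda>_. lborel"]]) (use assms in auto)
  then show ?thesis by simp
qed

text \<open>
  By the Leibniz formula the Gram determinant is a polynomial in the entries and their conjugates.
\<close>

lemma measurable_gram_det [measurable]: "gram_det n m \<in> borel_measurable (cmat_space n m)"
proof -
  have eq: "gram_det n m = (\<lambda>Z. Re (\<Sum>p | p permutes {0..<n}. signof p * (\<Prod>i = 0..<n. \<Sum>r<m. Z r i * cnj (Z r (p i)))))"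
  proof
    fix Z
    have "gram (to_mat n m Z) \<in> carrier_mat n n" by (rule gram_carrier[OF to_mat_carrier])
    then show "gram_det n m Z = Re (\<Sum>p | p permutes {0..<n}. signof p * (\<Prod>i = 0..<n. \<Sum>r<m. Z r i * cnj (Z r (p i))))"
      unfolding gram_det_def det_def'[OF \<open>gram (to_mat n m Z) \<in> _\<close>]
      by (intro arg_cong[of _ _ Re] sum.cong prod.cong arg_cong2[of _ _ _ _ "(*)"])
         (auto simp: gram_index[of _ n m] to_mat_def permutes_in_image dest: permutes_in_image)
  qed
  have cnj_entry: "(\<lambda>Z. cnj (Z r i)) \<in> borel_measurable (cmat_space n m)" if "i < n" "r < m" for r i
    using cmat_entry_borel[OF that] by (rule measurable_compose) (simp add: borel_measurable_continuous_onI continuous_intros)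
  have "(\<lambda>Z. \<Sum>p | p permutes {0..<n}. signof p * (\<Prod>i = 0..<n. \<Sum>r<m. Z r i * cnj (Z r (p i)))) \<in> borel_measurable (cmat_space n m)"
  proof (intro borel_measurable_sum borel_measurable_times borel_measurable_prod borel_measurable_const)
    fix p i r assume "p \<in> {p. p permutes {0..<n}}" "i \<in> {0..<n}" "r \<in> {..<m}"
    then have "i < n" "p i < n" "r < m" using permutes_in_image[of p "{0..<n}" i] by auto
    then show "(\<lambda>Z. Z r i) \<in> borel_measurable (cmat_space n m)" "(\<lambda>Z. cnj (Z r (p i))) \<in> borel_measurable (cmat_space n m)"
      by (simp_all add: cmat_entry_borel cnj_entry)
  qed
  then show ?thesis unfolding eq by measurable
qed

lemma measurable_row_energy [measurable]: "i < n \<Longrightarrow> (\<lambda>Z. row_energy m Z i) \<in> borel_measurable (cmat_space n m)"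
  unfolding row_energy_def
  by (intro borel_measurable_sum borel_measurable_power measurable_compose[OF _ borel_measurable_norm] cmat_entry_borel) auto

lemma measurable_total_energy [measurable]: "(\<lambda>Z. \<Sum>k<n. row_energy m Z k) \<in> borel_measurable (cmat_space n m)"
  by (intro borel_measurable_sum measurable_row_energy) auto

lemma measurable_columnwise [measurable]: "columnwise n m A \<in> measurable (cmat_space n m) (cmat_space n m)"
  unfolding columnwise_def by measurable

lemma to_mat_columnwise:
  assumes A: "A \<in> carrier_mat n n"
  shows "to_mat n m (columnwise n m A Z) = A * to_mat n m Z"
proof (rule eq_matI)
  fix i j assume "i < dim_row (A * to_mat n m Z)" "j < dim_col (A * to_mat n m Z)"
  then have ij: "i < n" "j < m" using A by (auto simp: to_mat_def)
  have "(A * to_mat n m Z) $$ (i,j) = (\<Sum>l<n. A $$ (i,l) * to_mat n m Z $$ (l,j))"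
    by (rule index_mult_sum[OF A _ ij]) simp
  then show "to_mat n m (columnwise n m A Z) $$ (i,j) = (A * to_mat n m Z) $$ (i,j)"
    using ij by (simp add: to_mat_def columnwise_def affine_map_def)
qed (use A in \<open>auto simp: to_mat_def\<close>)

lemma gram_det_columnwise:
  assumes A: "A \<in> carrier_mat n n"
  shows "gram_det n m (columnwise n m A Z) = (cmod (Determinant.det A))\<^sup>2 * gram_det n m Z"
  unfolding gram_det_def to_mat_columnwise[OF A]
  by (subst det_gram_mult[OF A to_mat_carrier]) auto

lemma nn_integral_columnwise:
  assumes A: "A \<in> carrier_mat n n" "Determinant.det A \<noteq> 0" and f: "f \<in> borel_measurable (cmat_space n m)"
  shows "ennreal ((cmod (Determinant.det A))\<^sup>2 ^ m) * (\<integral>\<^sup>+Z. f (columnwise n m A Z) \<partial>cmat_space n m)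
       = (\<integral>\<^sup>+Z. f Z \<partial>cmat_space n m)"
proof -
  have T: "affine_map n A (\<lambda>_. 0) \<in> measurable (cvec_space n) (cvec_space n)" by measurable
  have "ennreal ((cmod (Determinant.det A))\<^sup>2) ^ m * (\<integral>\<^sup>+Z. f (\<lambda>r\<in>{..<m}. affine_map n A (\<lambda>_. 0) (Z r)) \<partial>cmat_space n m)
       = (\<integral>\<^sup>+Z. f Z \<partial>cmat_space n m)"
    by (rule nn_integral_PiM_map[OF sigma_finite_cvec_space T _ f]) (rule nn_integral_affine_map[OF A])
  then show ?thesis by (simp add: columnwise_def ennreal_power)
qed

definition row_scaling :: "nat \<Rightarrow> nat \<Rightarrow> real \<Rightarrow> complex mat" where
  "row_scaling n i c = diag_of n (\<lambda>k. if k = i then of_real c else 1)"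

lemma row_scaling_carrier [simp]: "row_scaling n i c \<in> carrier_mat n n"
  by (simp add: row_scaling_def)

lemma det_row_scaling: "i < n \<Longrightarrow> Determinant.det (row_scaling n i c) = of_real c"
  unfolding row_scaling_def det_diag_of by (subst prod.delta) auto

lemma columnwise_row_scaling:
  assumes "k < n" "r < m"
  shows "columnwise n m (row_scaling n i c) Z r k = (if k = i then of_real c else 1) * Z r k"
proof -
  have "(\<Sum>j<n. row_scaling n i c $$ (k,j) * Z r j) = (\<Sum>j<n. if j = k then (if k = i then of_real c else 1) * Z r j else 0)"
    by (intro sum.cong) (use assms in \<open>auto simp: row_scaling_def diag_of_def\<close>)
  then show ?thesis using assms by (simp add: columnwise_def affine_map_def)
qed

lemma row_energy_row_scaling:
  assumes "k < n"
  shows "row_energy m (columnwise n m (row_scaling n i c) Z) k = (if k = i then c\<^sup>2 else 1) * row_energy m Z k"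
  unfolding row_energy_def sum_distrib_left
  by (intro sum.cong) (use assms in \<open>auto simp: columnwise_row_scaling norm_mult power_mult_distrib\<close>)

lemma gram_det_row_scaling:
  "i < n \<Longrightarrow> gram_det n m (columnwise n m (row_scaling n i c) Z) = c\<^sup>2 * gram_det n m Z"
  by (subst gram_det_columnwise) (auto simp: det_row_scaling)

text \<open>
  Doubling a zero row changes nothing, but multiplies the Gram determinant by 4.
\<close>

lemma gram_det_eq_0:
  assumes i: "i < n" and 0: "row_energy m Z i = 0"
  shows "gram_det n m Z = 0"
proof -
  have z: "Z r i = 0" if "r < m" for r
    using 0 that by (simp add: row_energy_def sum_nonneg_eq_0_iff)
  have "to_mat n m (columnwise n m (row_scaling n i 2) Z) = to_mat n m Z"
    by (rule eq_matI) (auto simp: to_mat_def columnwise_row_scaling z)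
  then have "gram_det n m Z = 2\<^sup>2 * gram_det n m Z"
    using gram_det_row_scaling[OF i, of m 2 Z] by (simp add: gram_det_def)
  then show ?thesis by simp
qed

section \<open>Row energies under homogeneous weights\<close>

text \<open>
  Up to the factor \<open>pi ^ (n * m)\<close> this is the expectation of \<open>H\<close> for a matrix whose
  entries are independent standard complex Gaussian variables. An unnormalized nonnegative integral avoids all
  questions of integrability until the moments are known to be finite.
\<close>

definition gauss_integral :: "nat \<Rightarrow> nat \<Rightarrow> ((nat \<Rightarrow> nat \<Rightarrow> complex) \<Rightarrow> real) \<Rightarrow> ennreal" where
  "gauss_integral n m H = (\<integral>\<^sup>+Z. ennreal (H Z * exp (- (\<Sum>k<n. row_energy m Z k))) \<partial>cmat_space n m)"

lemma nn_integral_exp_tail: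
  assumes "0 < (a::real)"
  shows "(\<integral>\<^sup>+l. ennreal (a * exp (- (l * a))) * indicator {1..} l \<partial>lborel) = ennreal (exp (- a))"
proof -
  have "(\<integral>\<^sup>+l. ennreal (a * exp (- (l * a))) * indicator {1..} l \<partial>lborel) = ennreal (0 - (- exp (- (1 * a))))"
  proof (rule nn_integral_FTC_atLeast)
    show "((\<lambda>l. - exp (- (l * a))) \<longlongrightarrow> 0) at_top"
      using assms by real_asymp
  qed (use assms in \<open>auto intro!: derivative_eq_intros\<close>)
  then show ?thesis by simp
qed

lemma nn_integral_powr_tail:
  assumes "0 < (a::real)"
  shows "(\<integral>\<^sup>+l. ennreal (l powr (- (a + 1))) * indicator {1..} l \<partial>lborel) = ennreal (1 / a)"
proof -
  have "(\<integral>\<^sup>+l. ennreal (l powr (- (a + 1))) * indicator {1..} l \<partial>lborel) = ennreal (0 - (- (1 powr (- a)) / a))"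
  proof (rule nn_integral_FTC_atLeast)
    show "((\<lambda>l. - (l powr (- a)) / a) \<longlongrightarrow> 0) at_top"
      using assms by real_asymp
    show "((\<lambda>l. - (l powr (- a)) / a) has_real_derivative x powr (- (a + 1))) (at x)" if "1 \<le> x" for x
      using assms that
      by (auto intro!: derivative_eq_intros simp: field_simps) (rule arg_cong[of _ _ "\<lambda>t. x powr t"], simp)
  qed auto
  then show ?thesis by simp
qed

text \<open>
  If \<open>H\<close> has degree \<open>2 * \<beta>\<close> in row \<open>i\<close>, then under the weight
  \<open>H\<close> the energy of row \<open>i\<close> behaves like a Gamma variable with shape
  \<open>m + \<beta>\<close>, because the row has \<open>m\<close> complex coordinates. In particular its mean is
  \<open>m + \<beta>\<close>. No density of the energy is needed. Writing
  \[ e^{-\rho} = \int_1^\infty \rho\, e^{-l \rho}\, dl \]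
  and scaling the row by \<open>l powr (- 1/2)\<close> turns the integral of \<open>H\<close> into the integral
  of \<open>H * \<rho>\<close> times
  \<open>\<integral> l powr (- (m + \<beta> + 1)) dl = 1 / (m + \<beta>)\<close>. The identity fails
  for \<open>\<rho> = 0\<close>, which is why \<open>H\<close> must vanish there; the weight
  \<open>gram_det powr (- s)\<close> does, since \<open>0 powr (- s) = 0\<close>.
\<close>

lemma gauss_integral_mult_row_energy:
  assumes i: "i < n" and [measurable]: "H \<in> borel_measurable (cmat_space n m)"
    and H0: "\<And>Z. 0 \<le> H Z" "\<And>Z. row_energy m Z i = 0 \<Longrightarrow> H Z = 0"
    and hom: "\<And>c Z. 0 < c \<Longrightarrow> H (columnwise n m (row_scaling n i c) Z) = c powr (2 * \<beta>) * H Z"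
    and pos: "0 < real m + \<beta>"
  shows "gauss_integral n m (\<lambda>Z. H Z * row_energy m Z i) = ennreal (real m + \<beta>) * gauss_integral n m H"
proof -
  define e where "e Z = (\<Sum>k\<in>{..<n} - {i}. row_energy m Z k)" for Z
  let ?r = "\<lambda>Z. row_energy m Z i"
  have split: "(\<Sum>k<n. row_energy m Z k) = e Z + ?r Z" for Z
    unfolding e_def using i by (subst sum.remove[of _ i]) auto
  have [measurable]: "e \<in> borel_measurable (cmat_space n m)" "?r \<in> borel_measurable (cmat_space n m)"
    unfolding e_def using i by (auto intro!: borel_measurable_sum measurable_row_energy)
  define F where "F l Z = H Z * ?r Z * exp (- (e Z + l * ?r Z))" for l Z
  have F: "(\<integral>\<^sup>+Z. ennreal (F l Z) \<partial>cmat_space n m)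
      = ennreal (l powr (- (real m + \<beta> + 1))) * gauss_integral n m (\<lambda>Z. H Z * ?r Z)" if "1 \<le> l" for l
  proof -
    define c where "c = l powr (- 1 / 2)"
    have c: "c > 0" "c\<^sup>2 = 1 / l" using that by (auto simp: c_def powr_powr[symmetric] powr_minus_divide powr_half_sqrt power_divide)
    let ?A = "row_scaling n i c"
    have eA: "e (columnwise n m ?A Z) = e Z" for Z
      unfolding e_def by (intro sum.cong) (auto simp: row_energy_row_scaling)
    have rA: "?r (columnwise n m ?A Z) = ?r Z / l" for Z
      using i by (simp add: row_energy_row_scaling c)
    \<comment> \<open>Jacobian \<open>c ^ (2 * m)\<close>, homogeneity of \<open>H\<close>, and one further factor \<open>1 / l\<close> from \<open>\<rho>\<close>.\<close>
    have pw: "(c\<^sup>2) ^ m * (c powr (2 * \<beta>) / l) = l powr (- (real m + \<beta> + 1))"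
    proof -
      have "(c\<^sup>2) ^ m = l powr (- real m)" "c powr (2 * \<beta>) = l powr (- \<beta>)"
        using that by (simp_all add: c(2) power_one_over powr_minus powr_realpow divide_inverse power_inverse)
          (simp add: c_def powr_powr powr_minus[symmetric])
      then have "(c\<^sup>2) ^ m * (c powr (2 * \<beta>) / l) = l powr (- real m) * (l powr (- \<beta>) * l powr (- 1))"
        using that by (simp add: powr_minus_divide)
      moreover have "- real m + (- \<beta> + - 1) = - (real m + \<beta> + 1)" by simp
      ultimately show ?thesis by (simp only: powr_add[symmetric])
    qed
    have "(\<integral>\<^sup>+Z. ennreal (F l Z) \<partial>cmat_space n m)
      = ennreal ((c\<^sup>2) ^ m) * (\<integral>\<^sup>+Z. ennreal (F l (columnwise n m ?A Z)) \<partial>cmat_space n m)"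
      using nn_integral_columnwise[of ?A n "\<lambda>Z. ennreal (F l Z)" m] i c(1)
      by (simp add: F_def det_row_scaling)
    also have "(\<integral>\<^sup>+Z. ennreal (F l (columnwise n m ?A Z)) \<partial>cmat_space n m)
       = (\<integral>\<^sup>+Z. ennreal (c powr (2 * \<beta>) / l) * ennreal (H Z * ?r Z * exp (- (\<Sum>k<n. row_energy m Z k))) \<partial>cmat_space n m)"
      using that by (intro nn_integral_cong) (simp add: F_def eA rA hom[OF c(1)] split ennreal_mult'[symmetric] mult.assoc)
    also have "\<dots> = ennreal (c powr (2 * \<beta>) / l) * gauss_integral n m (\<lambda>Z. H Z * ?r Z)"
      unfolding gauss_integral_def split by (rule nn_integral_cmult) measurable
    finally have "(\<integral>\<^sup>+Z. ennreal (F l Z) \<partial>cmat_space n m)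
       = (ennreal ((c\<^sup>2) ^ m) * ennreal (c powr (2 * \<beta>) / l)) * gauss_integral n m (\<lambda>Z. H Z * ?r Z)"
      by (simp only: mult.assoc)
    also have "ennreal ((c\<^sup>2) ^ m) * ennreal (c powr (2 * \<beta>) / l) = ennreal (l powr (- (real m + \<beta> + 1)))"
      unfolding pw[symmetric] by (rule ennreal_mult[symmetric]) (use that in auto)
    finally show ?thesis .
  qed
  have sf: "pair_sigma_finite lborel (cmat_space n m)"
    using lborel.sigma_finite_measure_axioms sigma_finite_PiM[OF sigma_finite_cvec_space] by (simp add: pair_sigma_finite_def)
  have "gauss_integral n m H
     = (\<integral>\<^sup>+Z. (\<integral>\<^sup>+l. ennreal (F l Z) * indicator {1..} l \<partial>lborel) \<partial>cmat_space n m)"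
    unfolding gauss_integral_def
  proof (rule nn_integral_cong)
    fix Z
    show "ennreal (H Z * exp (- (\<Sum>k<n. row_energy m Z k))) = (\<integral>\<^sup>+l. ennreal (F l Z) * indicator {1..} l \<partial>lborel)"
    proof (cases "?r Z = 0")
      case True
      then show ?thesis using H0(2)[of Z] by (simp add: F_def)
    next
      case False
      then have r: "?r Z > 0" using row_energy_nonneg[of m Z i] by simp
      have "(\<integral>\<^sup>+l. ennreal (F l Z) * indicator {1..} l \<partial>lborel)
        = (\<integral>\<^sup>+l. ennreal (H Z * exp (- e Z)) * (ennreal (?r Z * exp (- (l * ?r Z))) * indicator {1..} l) \<partial>lborel)"
        using H0(1)[of Z] r
        by (intro nn_integral_cong) (auto simp: F_def ennreal_mult[symmetric] mult.assoc[symmetric] exp_diff exp_minus field_simps exp_add)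
      also have "\<dots> = ennreal (H Z * exp (- e Z)) * ennreal (exp (- ?r Z))"
        using r by (simp add: nn_integral_cmult nn_integral_exp_tail)
      finally show ?thesis
        using H0(1)[of Z] unfolding split by (simp add: ennreal_mult[symmetric] mult.assoc exp_add[symmetric])
    qed
  qed
  also have "\<dots> = (\<integral>\<^sup>+l. (\<integral>\<^sup>+Z. ennreal (F l Z) * indicator {1..} l \<partial>cmat_space n m) \<partial>lborel)"
  proof (rule pair_sigma_finite.Fubini'[OF sf])
    show "(\<lambda>(l, Z). ennreal (F l Z) * indicator {1..} l) \<in> borel_measurable (lborel \<Otimes>\<^sub>M cmat_space n m)"
      unfolding F_def by measurable
  qed
  also have "\<dots> = (\<integral>\<^sup>+l. ennreal (l powr (- (real m + \<beta> + 1))) * indicator {1..} l * gauss_integral n m (\<lambda>Z. H Z * ?r Z) \<partial>lborel)"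
  proof (rule nn_integral_cong)
    fix l :: real
    show "(\<integral>\<^sup>+Z. ennreal (F l Z) * indicator {1..} l \<partial>cmat_space n m)
        = ennreal (l powr (- (real m + \<beta> + 1))) * indicator {1..} l * gauss_integral n m (\<lambda>Z. H Z * ?r Z)"
      using F[of l] by (cases "1 \<le> l") auto
  qed
  also have "\<dots> = ennreal (1 / (real m + \<beta>)) * gauss_integral n m (\<lambda>Z. H Z * ?r Z)"
    by (subst nn_integral_multc) (use pos in \<open>simp_all only: nn_integral_powr_tail[of "real m + \<beta>"], measurable\<close>)
  finally have "ennreal (real m + \<beta>) * gauss_integral n m H
     = ennreal (real m + \<beta>) * (ennreal (1 / (real m + \<beta>)) * gauss_integral n m (\<lambda>Z. H Z * ?r Z))" by simp
  also have "\<dots> = gauss_integral n m (\<lambda>Z. H Z * ?r Z)"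
  proof -
    have "ennreal (real m + \<beta>) * ennreal (1 / (real m + \<beta>)) = 1"
      using pos by (subst ennreal_mult[symmetric]) auto
    then show ?thesis by (simp only: mult.assoc[symmetric] mult_1)
  qed
  finally show ?thesis by (rule sym)
qed

section \<open>Adding a row to a matrix\<close>

definition add_row :: "nat \<Rightarrow> nat \<Rightarrow> (nat \<Rightarrow> nat \<Rightarrow> complex) \<Rightarrow> (nat \<Rightarrow> complex) \<Rightarrow> nat \<Rightarrow> nat \<Rightarrow> complex" where
  "add_row n m A b = (\<lambda>r\<in>{..<m}. (A r)(n := b r))"

lemma measurable_add_row:
  assumes f: "f \<in> measurable M (cmat_space n m)" and g: "g \<in> measurable M (cvec_space m)"
  shows "(\<lambda>x. add_row n m (f x) (g x)) \<in> measurable M (cmat_space (Suc n) m)"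
  unfolding add_row_def
proof (rule measurable_restrict, rule measurable_fun_upd_Suc)
  fix r assume r: "r \<in> {..<m}"
  show "(\<lambda>x. f x r) \<in> measurable M (cvec_space n)"
    by (rule measurable_compose[OF f measurable_component_singleton[of r "{..<m}" "\<lambda>_. cvec_space n"]]) (rule r)
  show "(\<lambda>x. g x r) \<in> measurable M lborel"
    by (rule measurable_compose[OF g measurable_component_singleton[of r "{..<m}" "\<lambda>_. lborel"]]) (rule r)
qed

text \<open>
  Lebesgue measure on matrices is built column by column, but the recursion for the Gram determinant removes a row.
  This is Fubini for the two orders, by induction on the number of columns: the new column consists of its first
  \<open>n\<close> entries \<open>v\<close> and its last entry \<open>t\<close>.
\<close>

lemma nn_integral_add_row:
  assumes "f \<in> borel_measurable (cmat_space (Suc n) m)"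
  shows "(\<integral>\<^sup>+Z. f Z \<partial>cmat_space (Suc n) m) = (\<integral>\<^sup>+A. \<integral>\<^sup>+b. f (add_row n m A b) \<partial>cvec_space m \<partial>cmat_space n m)"
  using assms
proof (induction m arbitrary: f)
  case 0
  interpret C: sigma_finite_measure "cvec_space n" by (rule sigma_finite_cvec_space)
  interpret C': sigma_finite_measure "cvec_space (Suc n)" by (rule sigma_finite_cvec_space)
  interpret P: product_sigma_finite "\<lambda>_::nat. cvec_space n" by unfold_locales
  interpret P': product_sigma_finite "\<lambda>_::nat. cvec_space (Suc n)" by unfold_locales
  interpret L: product_sigma_finite "\<lambda>_::nat. lborel :: complex measure" by unfold_locales
  have e: "add_row n 0 A b = (\<lambda>_. undefined)" for A b by (simp add: add_row_def restrict_def)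
  show ?case unfolding e lessThan_0
    by (subst P'.nn_integral_empty, simp, subst P.nn_integral_empty, simp, subst L.nn_integral_empty) simp_all
next
  case (Suc m)
  note f = Suc.prems
  note sfC = sigma_finite_cvec_space
  note sfL = lborel.sigma_finite_measure_axioms
  interpret C: sigma_finite_measure "cvec_space n" by (rule sfC)
  interpret Cm: sigma_finite_measure "cvec_space m" by (rule sfC)
  interpret Cs: sigma_finite_measure "cvec_space (Suc m)" by (rule sfC)
  let ?g = "\<lambda>X v t. f (X(m := v(n := t)))"
  have eq: "add_row n (Suc m) (A(m := v)) (b(m := t)) = (add_row n m A b)(m := v(n := t))" for A v b t
    by (auto simp: add_row_def fun_eq_iff)
  have upd: "(\<lambda>x. (h x)(m := (k x)(n := l x))) \<in> measurable M (cmat_space (Suc n) (Suc m))"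
    if "h \<in> measurable M (cmat_space (Suc n) m)" "k \<in> measurable M (cvec_space n)" "l \<in> measurable M lborel" for M :: "'m measure" and h k l
    by (rule measurable_fun_upd_Suc[OF that(1) measurable_fun_upd_Suc[OF that(2,3)]])
  \<comment> \<open>Joint measurability is spelled out because every iterated integral below depends on parameters.\<close>
  have m1: "(\<lambda>X. \<integral>\<^sup>+v. \<integral>\<^sup>+t. ?g X v t \<partial>lborel \<partial>cvec_space n) \<in> borel_measurable (cmat_space (Suc n) m)"
  proof (rule C.borel_measurable_nn_integral)
    have "(\<lambda>p. \<integral>\<^sup>+t. ?g (fst p) (snd p) t \<partial>lborel) \<in> borel_measurable (cmat_space (Suc n) m \<Otimes>\<^sub>M cvec_space n)"
    proof (rule lborel.borel_measurable_nn_integral)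
      have "(\<lambda>q. ?g (fst (fst q)) (snd (fst q)) (snd q)) \<in> borel_measurable ((cmat_space (Suc n) m \<Otimes>\<^sub>M cvec_space n) \<Otimes>\<^sub>M lborel)"
        by (rule measurable_compose[OF upd f]) (intro measurable_compose[OF measurable_fst] measurable_fst measurable_snd measurable_compose[OF measurable_fst measurable_snd])+
      then show "(\<lambda>(p, t). ?g (fst p) (snd p) t) \<in> borel_measurable ((cmat_space (Suc n) m \<Otimes>\<^sub>M cvec_space n) \<Otimes>\<^sub>M lborel)"
        by (simp add: case_prod_beta)
    qed
    then show "(\<lambda>(X, v). \<integral>\<^sup>+t. ?g X v t \<partial>lborel) \<in> borel_measurable (cmat_space (Suc n) m \<Otimes>\<^sub>M cvec_space n)"
      by (simp add: case_prod_beta)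
  qed
  have "(\<integral>\<^sup>+Z. f Z \<partial>cmat_space (Suc n) (Suc m))
      = (\<integral>\<^sup>+X. \<integral>\<^sup>+u. f (X(m := u)) \<partial>cvec_space (Suc n) \<partial>cmat_space (Suc n) m)"
    by (rule nn_integral_PiM_Suc[OF sfC f])
  also have "\<dots> = (\<integral>\<^sup>+X. \<integral>\<^sup>+v. \<integral>\<^sup>+t. ?g X v t \<partial>lborel \<partial>cvec_space n \<partial>cmat_space (Suc n) m)"
  proof (rule nn_integral_cong)
    fix X assume X: "X \<in> space (cmat_space (Suc n) m)"
    have "(\<lambda>u. f (X(m := u))) \<in> borel_measurable (cvec_space (Suc n))"
      by (rule measurable_compose[OF measurable_fun_upd_Suc f]) (use X in auto)
    then show "(\<integral>\<^sup>+u. f (X(m := u)) \<partial>cvec_space (Suc n)) = (\<integral>\<^sup>+v. \<integral>\<^sup>+t. ?g X v t \<partial>lborel \<partial>cvec_space n)"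
      by (rule nn_integral_PiM_Suc[OF sfL])
  qed
  also have "\<dots> = (\<integral>\<^sup>+A. \<integral>\<^sup>+b. \<integral>\<^sup>+v. \<integral>\<^sup>+t. ?g (add_row n m A b) v t \<partial>lborel \<partial>cvec_space n \<partial>cvec_space m \<partial>cmat_space n m)"
    by (rule Suc.IH[OF m1])
  also have "\<dots> = (\<integral>\<^sup>+A. \<integral>\<^sup>+v. \<integral>\<^sup>+b. \<integral>\<^sup>+t. ?g (add_row n m A b) v t \<partial>lborel \<partial>cvec_space m \<partial>cvec_space n \<partial>cmat_space n m)"
  proof (rule nn_integral_cong, rule pair_sigma_finite.Fubini')
    fix A assume A: "A \<in> space (cmat_space n m)"
    show "pair_sigma_finite (cvec_space n) (cvec_space m)" using sfC by (simp add: pair_sigma_finite_def)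
    have ar: "(\<lambda>x. add_row n m A (h x)) \<in> measurable M (cmat_space (Suc n) m)" if "h \<in> measurable M (cvec_space m)" for M :: "'m measure" and h
      by (rule measurable_add_row[OF _ that]) (use A in simp)
    have "(\<lambda>p. \<integral>\<^sup>+t. ?g (add_row n m A (snd p)) (fst p) t \<partial>lborel) \<in> borel_measurable (cvec_space n \<Otimes>\<^sub>M cvec_space m)"
    proof (rule lborel.borel_measurable_nn_integral)
      have "(\<lambda>q. ?g (add_row n m A (snd (fst q))) (fst (fst q)) (snd q)) \<in> borel_measurable ((cvec_space n \<Otimes>\<^sub>M cvec_space m) \<Otimes>\<^sub>M lborel)"
        by (rule measurable_compose[OF upd[OF ar] f]) (intro measurable_compose[OF measurable_fst] measurable_fst measurable_snd measurable_compose[OF measurable_fst measurable_snd])+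
      then show "(\<lambda>(p, t). ?g (add_row n m A (snd p)) (fst p) t) \<in> borel_measurable ((cvec_space n \<Otimes>\<^sub>M cvec_space m) \<Otimes>\<^sub>M lborel)"
        by (simp add: case_prod_beta)
    qed
    then show "(\<lambda>(v, b). \<integral>\<^sup>+t. ?g (add_row n m A b) v t \<partial>lborel) \<in> borel_measurable (cvec_space n \<Otimes>\<^sub>M cvec_space m)"
      by (simp add: case_prod_beta)
  qed
  also have "\<dots> = (\<integral>\<^sup>+A. \<integral>\<^sup>+v. \<integral>\<^sup>+b'. f (add_row n (Suc m) (A(m := v)) b') \<partial>cvec_space (Suc m) \<partial>cvec_space n \<partial>cmat_space n m)"
  proof (intro nn_integral_cong)
    fix A v assume "A \<in> space (cmat_space n m)" "v \<in> space (cvec_space n)"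
    then have Av: "A(m := v) \<in> space (cmat_space n (Suc m))"
      by (auto simp: space_PiM PiE_iff extensional_def less_Suc_eq)
    have "(\<lambda>b'. f (add_row n (Suc m) (A(m := v)) b')) \<in> borel_measurable (cvec_space (Suc m))"
      by (rule measurable_compose[OF measurable_add_row f]) (use Av in simp_all)
    from nn_integral_PiM_Suc[OF sfL this]
    show "(\<integral>\<^sup>+b. \<integral>\<^sup>+t. ?g (add_row n m A b) v t \<partial>lborel \<partial>cvec_space m)
        = (\<integral>\<^sup>+b'. f (add_row n (Suc m) (A(m := v)) b') \<partial>cvec_space (Suc m))" by (simp only: eq)
  qed
  also have "\<dots> = (\<integral>\<^sup>+A. \<integral>\<^sup>+b'. f (add_row n (Suc m) A b') \<partial>cvec_space (Suc m) \<partial>cmat_space n (Suc m))"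
  proof (rule nn_integral_PiM_Suc[OF sfC, symmetric], rule Cs.borel_measurable_nn_integral)
    have "(\<lambda>p. f (add_row n (Suc m) (fst p) (snd p))) \<in> borel_measurable (cmat_space n (Suc m) \<Otimes>\<^sub>M cvec_space (Suc m))"
      by (rule measurable_compose[OF measurable_add_row f]) simp_all
    then show "(\<lambda>(A, b'). f (add_row n (Suc m) A b')) \<in> borel_measurable (cmat_space n (Suc m) \<Otimes>\<^sub>M cvec_space (Suc m))"
      by (simp add: case_prod_beta)
  qed
  finally show ?case .
qed

definition append_row :: "nat \<Rightarrow> nat \<Rightarrow> complex mat \<Rightarrow> (nat \<Rightarrow> complex) \<Rightarrow> complex mat" where
  "append_row n m a b = mat (Suc n) m (\<lambda>(i,r). if i < n then a $$ (i,r) else b r)"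

lemma append_row_carrier [simp]: "append_row n m a b \<in> carrier_mat (Suc n) m"
  by (simp add: append_row_def)

lemma to_mat_add_row: "to_mat (Suc n) m (add_row n m A b) = append_row n m (to_mat n m A) b"
  by (rule eq_matI) (auto simp: to_mat_def add_row_def append_row_def)

text \<open>
  A kernel vector \<open>v\<close> of \<open>a a\<^sup>*\<close> satisfies \<open>a\<^sup>* v = 0\<close>,
  because the squared norm of \<open>a\<^sup>* v\<close> is \<open>v\<^sup>* a a\<^sup>* v\<close>. Extended by
  zero it lies in the kernel of the larger Gram matrix.
\<close>

lemma det_gram_append_row_singular:
  assumes a: "a \<in> carrier_mat n m" and 0: "Determinant.det (gram a) = 0"
  shows "Determinant.det (gram (append_row n m a b)) = 0"
proof -
  have G: "gram a \<in> carrier_mat n n" using a by simp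
  obtain v where v: "v \<in> carrier_vec n" "v \<noteq> 0\<^sub>v n" "gram a *\<^sub>v v = 0\<^sub>v n"
    using 0 det_0_iff_vec_prod_zero_field[OF G] by blast
  define u where "u r = (\<Sum>j<n. cnj (a $$ (j,r)) * v $ j)" for r
  have au: "(\<Sum>r<m. a $$ (i,r) * u r) = 0" if "i < n" for i
  proof -
    have "(gram a *\<^sub>v v) $ i = (\<Sum>j<n. gram a $$ (i,j) * v $ j)"
      using that v(1) G by (auto simp: scalar_prod_def atLeast0LessThan)
    also have "\<dots> = (\<Sum>j<n. \<Sum>r<m. a $$ (i,r) * cnj (a $$ (j,r)) * v $ j)"
      using that by (intro sum.cong) (auto simp: gram_index[OF a] sum_distrib_right)
    also have "\<dots> = (\<Sum>r<m. a $$ (i,r) * u r)"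
      by (subst sum.swap) (simp add: u_def sum_distrib_left mult.assoc)
    finally show ?thesis using v(3) that by (simp only: index_zero_vec)
  qed
  have "(\<Sum>r<m. cnj (u r) * u r) = (\<Sum>r<m. \<Sum>i<n. cnj (v $ i) * (a $$ (i,r) * u r))"
    by (intro sum.cong) (auto simp: u_def sum_distrib_right sum_distrib_left mult_ac)
  also have "\<dots> = (\<Sum>i<n. cnj (v $ i) * (\<Sum>r<m. a $$ (i,r) * u r))"
    by (subst sum.swap) (simp add: sum_distrib_left)
  also have "\<dots> = 0" by (simp add: au)
  finally have "of_real (\<Sum>r<m. (cmod (u r))\<^sup>2) = (0::complex)"
    by (simp add: complex_norm_square mult.commute del: of_real_power)
  then have "(\<Sum>r<m. (cmod (u r))\<^sup>2) = 0" by (simp only: of_real_eq_0_iff)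
  then have u: "u r = 0" if "r < m" for r using that by (simp add: sum_nonneg_eq_0_iff)
  let ?X = "append_row n m a b"
  define w where "w = vec (Suc n) (\<lambda>i. if i < n then v $ i else 0)"
  have GX: "gram ?X \<in> carrier_mat (Suc n) (Suc n)" by (rule gram_carrier[OF append_row_carrier])
  have Xr: "?X $$ (j,r) = a $$ (j,r)" if "j < n" "r < m" for j r
    using that by (simp add: append_row_def)
  have "gram ?X *\<^sub>v w = 0\<^sub>v (Suc n)"
  proof (rule eq_vecI)
    fix i assume "i < dim_vec (0\<^sub>v (Suc n) :: complex vec)"
    then have i: "i < Suc n" by simp
    have "(gram ?X *\<^sub>v w) $ i = (\<Sum>j<Suc n. gram ?X $$ (i,j) * w $ j)"
      using i GX by (auto simp: scalar_prod_def atLeast0LessThan w_def)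
    also have "\<dots> = (\<Sum>j<n. gram ?X $$ (i,j) * v $ j)" by (simp add: w_def)
    also have "\<dots> = (\<Sum>j<n. \<Sum>r<m. ?X $$ (i,r) * cnj (a $$ (j,r)) * v $ j)"
      by (intro sum.cong refl) (use i in \<open>simp add: gram_index[OF append_row_carrier] sum_distrib_right Xr\<close>)
    also have "\<dots> = (\<Sum>r<m. ?X $$ (i,r) * u r)"
      by (subst sum.swap) (simp add: u_def sum_distrib_left mult.assoc)
    also have "\<dots> = 0" by (simp add: u)
    finally show "(gram ?X *\<^sub>v w) $ i = 0\<^sub>v (Suc n) $ i" using i by simp
  qed (use GX in auto)
  moreover have "w \<noteq> 0\<^sub>v (Suc n)"
  proof
    assume w0: "w = 0\<^sub>v (Suc n)"
    have "v = 0\<^sub>v n"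
    proof (rule eq_vecI)
      fix i assume "i < dim_vec (0\<^sub>v n :: complex vec)"
      then have i: "i < n" by simp
      have "w $ i = 0" using w0 i by simp
      then show "v $ i = 0\<^sub>v n $ i" using i by (simp add: w_def)
    qed (use v in auto)
    then show False using v by simp
  qed
  ultimately show ?thesis
    unfolding det_0_iff_vec_prod_zero_field[OF GX] by (intro exI[of _ w]) (auto simp: w_def)
qed

lemma sum_diag_mult_commute:
  assumes "A \<in> carrier_mat n m" "B \<in> carrier_mat m n"
  shows "(\<Sum>i<n. (A * B) $$ (i,i)) = (\<Sum>r<m. (B * A) $$ (r,r) :: complex)"
proof -
  have "(\<Sum>i<n. (A * B) $$ (i,i)) = (\<Sum>i<n. \<Sum>r<m. A $$ (i,r) * B $$ (r,i))"
    by (intro sum.cong refl index_mult_sum[OF assms]) auto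
  also have "\<dots> = (\<Sum>r<m. \<Sum>i<n. B $$ (r,i) * A $$ (i,r))"
    by (subst sum.swap) (simp add: mult.commute)
  also have "\<dots> = (\<Sum>r<m. (B * A) $$ (r,r))"
    by (intro sum.cong refl index_mult_sum[OF assms(2,1), symmetric]) auto
  finally show ?thesis .
qed

text \<open>
  The matrix \<open>C a = a\<^sup>* (a a\<^sup>*)\<^sup>-\<^sup>1 a\<close> is the orthogonal projection onto
  the row space of \<open>a\<close>. It is Hermitian and idempotent, so it has eigenvalues 0 and 1, and its trace,
  which is the number of eigenvalues 1, equals the trace \<open>n\<close> of the identity matrix
  \<open>a C\<close>.
\<close>

lemma row_space_projection:
  assumes a: "a \<in> carrier_mat n m" and nz: "Determinant.det (gram a) \<noteq> 0"
  obtains C U p where "C \<in> carrier_mat m n" "U \<in> carrier_mat m m" "mat_adjoint U * U = 1\<^sub>m m" "U * mat_adjoint U = 1\<^sub>m m"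
    "C * a = U * diag_of m p * mat_adjoint U"
    "\<And>i. i < m \<Longrightarrow> p i = 0 \<or> p i = 1" "(\<Sum>i<m. p i) = of_nat n"
    "(C * a) * mat_adjoint a = mat_adjoint a"
proof -
  have a': "mat_adjoint a \<in> carrier_mat m n" using a by simp
  have G: "gram a \<in> carrier_mat n n" using a by simp
  have Gh: "mat_adjoint (gram a) = gram a" by (rule gram_hermitian[OF a])
  obtain Gi where Gi: "Gi \<in> carrier_mat n n" "Gi * gram a = 1\<^sub>m n" "gram a * Gi = 1\<^sub>m n"
    using det_non_zero_imp_unit[OF G nz, of "()"] by (auto simp: Units_def ring_mat_simps)
  have Gi': "mat_adjoint Gi \<in> carrier_mat n n" using Gi by simp
  have "mat_adjoint Gi * gram a = mat_adjoint (gram a * Gi)"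
    using Gi(1) G by (simp add: mat_adjoint_mult[of _ n n _ n] Gh)
  also have "\<dots> = 1\<^sub>m n" unfolding Gi(3) by (rule eq_matI) (auto simp: mat_adjoint_eq)
  finally have "mat_adjoint Gi * gram a * Gi = Gi" using Gi by simp
  then have Gih: "mat_adjoint Gi = Gi"
    using Gi(1,3) Gi' G by (simp add: assoc_mult_mat[of _ n n _ n _ n])
  define C where "C = mat_adjoint a * Gi"
  have C: "C \<in> carrier_mat m n" unfolding C_def using a' Gi by simp
  define P where "P = C * a"
  have P: "P \<in> carrier_mat m m" unfolding P_def using C a by simp
  have Ph: "mat_adjoint P = P"
    using a a' Gi(1) unfolding P_def C_def
    by (simp add: mat_adjoint_mult[of _ m n _ m] mat_adjoint_mult[of _ m n _ n] mult_carrier_mat[of _ m n _ n] Gih assoc_mult_mat[of _ m n _ n _ m]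
        mat_adjoint_mult[of _ n n _ m] mult_carrier_mat[of _ n n _ m])
  have Paadj: "P * mat_adjoint a = mat_adjoint a"
  proof -
    have "P * mat_adjoint a = mat_adjoint a * (Gi * gram a)"
      using a a' Gi(1) unfolding P_def C_def gram_def
      by (simp add: assoc_mult_mat[of _ m n _ n _ m] assoc_mult_mat[of _ m n _ m _ n] assoc_mult_mat[of _ m n _ n _ n]
          assoc_mult_mat[of _ n n _ m _ n] mult_carrier_mat[of _ n n _ m] mult_carrier_mat[of _ n m _ n] mult_carrier_mat[of _ m n _ n])
    then show ?thesis unfolding Gi(2) right_mult_one_mat[OF a'] .
  qed
  have PP: "P * P = P"
  proof -
    have "P * P = (P * mat_adjoint a) * (Gi * a)"
      using a a' Gi(1) P unfolding P_def[of] C_def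
      by (simp add: assoc_mult_mat[of _ m n _ n _ m] assoc_mult_mat[of _ m m _ n _ m] mult_carrier_mat[of _ m n _ m]
         mult_carrier_mat[of _ n n _ m] mult_carrier_mat[of _ m n _ n])
    also have "\<dots> = P" unfolding Paadj using a a' Gi(1) unfolding P_def C_def
      by (simp add: assoc_mult_mat[of _ m n _ n _ m])
    finally show ?thesis .
  qed
  obtain U p where U: "U \<in> carrier_mat m m" "mat_adjoint U * U = 1\<^sub>m m" "U * mat_adjoint U = 1\<^sub>m m"
    and Pd: "P = U * diag_of m p * mat_adjoint U"
    using hermitian_unitarily_diagonalizableE[OF P Ph] by blast
  have U': "mat_adjoint U \<in> carrier_mat m m" using U by simp
  have D: "diag_of m p = mat_adjoint U * P * U"
    by (rule unitary_conjugation[OF U(1,2) _ Pd, symmetric]) simp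
  have "diag_of m p * diag_of m p = mat_adjoint U * (P * (U * mat_adjoint U) * P) * U"
    unfolding D using P U(1) U' by (simp add: assoc_mult_mat[of _ m m _ m _ m] mult_carrier_mat[of _ m m _ m])
  also have "\<dots> = diag_of m p" unfolding U(3) using P PP D by simp
  finally have "diag_of m (\<lambda>i. p i * p i) = diag_of m p" by (simp add: diag_of_mult)
  moreover have "diag_of m f $$ (i,i) = f i" if "i < m" for f :: "nat \<Rightarrow> complex" and i
    using that by (simp add: diag_of_def)
  ultimately have "p i * p i = p i" if "i < m" for i using that by metis
  then have p01: "p i = 0 \<or> p i = 1" if "i < m" for i using that by force
  have "(\<Sum>i<m. p i) = (\<Sum>i<m. diag_of m p $$ (i,i))" by (simp add: diag_of_def)
  also have "\<dots> = (\<Sum>i<m. ((mat_adjoint U * P) * U) $$ (i,i))" by (simp add: D)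
  also have "\<dots> = (\<Sum>i<m. (U * (mat_adjoint U * P)) $$ (i,i))"
    by (rule sum_diag_mult_commute) (use U U' P in \<open>auto intro!: mult_carrier_mat[of _ m m _ m]\<close>)
  also have "U * (mat_adjoint U * P) = P"
    using U U' P by (simp add: assoc_mult_mat[of _ m m _ m _ m, symmetric])
  also have "(\<Sum>i<m. P $$ (i,i)) = (\<Sum>i<n. (a * C) $$ (i,i))"
    unfolding P_def by (rule sum_diag_mult_commute[OF C a])
  also have "a * C = 1\<^sub>m n"
    unfolding C_def using a a' Gi by (simp add: assoc_mult_mat[of _ n m _ n _ n, symmetric] flip: gram_def)
  also have "(\<Sum>i<n. (1\<^sub>m n :: complex mat) $$ (i,i)) = of_nat n" by simp
  finally show ?thesis
    using that[OF C U] Pd p01 Paadj unfolding P_def by blast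
qed

text \<open>
  "Base times height": a new row \<open>b\<close> multiplies the squared volume by the squared length of the
  component of \<open>b\<close> orthogonal to the rows of \<open>a\<close>. In the coordinates given by a unitary
  \<open>U\<close> that diagonalizes the projection onto the row space, this component consists of the
  \<open>m - n\<close> coordinates in \<open>J\<close>.
\<close>

lemma det_gram_append_row:
  assumes a: "a \<in> carrier_mat n m" and nz: "Determinant.det (gram a) \<noteq> 0"
  obtains U J where "U \<in> carrier_mat m m" "mat_adjoint U * U = 1\<^sub>m m" "U * mat_adjoint U = 1\<^sub>m m"
    "J \<subseteq> {..<m}" "card J + n = m"
    "\<And>b. Determinant.det (gram (append_row n m a b)) =
       Determinant.det (gram a) * of_real (\<Sum>i\<in>J. (cmod (\<Sum>r<m. b r * U $$ (r,i)))\<^sup>2)"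
proof -
  obtain C U p where C: "C \<in> carrier_mat m n" and U: "U \<in> carrier_mat m m" "mat_adjoint U * U = 1\<^sub>m m" "U * mat_adjoint U = 1\<^sub>m m"
    and P: "C * a = U * diag_of m p * mat_adjoint U"
    and p: "\<And>i. i < m \<Longrightarrow> p i = 0 \<or> p i = 1" "(\<Sum>i<m. p i) = of_nat n"
    and Pa: "(C * a) * mat_adjoint a = mat_adjoint a"
    by (rule row_space_projection[OF a nz]) blast
  have a': "mat_adjoint a \<in> carrier_mat m n" and U': "mat_adjoint U \<in> carrier_mat m m" using a U by auto
  have G: "gram a \<in> carrier_mat n n" using a by simp
  have Pc: "C * a \<in> carrier_mat m m" using C a by simp
  define J where "J = {i\<in>{..<m}. p i = 0}"
  have "(\<Sum>i<m. p i) = (\<Sum>i<m. if i \<in> {..<m} - J then 1 else 0)"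
    using p by (intro sum.cong) (auto simp: J_def)
  also have "\<dots> = of_nat (card ({..<m} - J))"
    by (subst sum.inter_restrict[symmetric]) (auto intro!: arg_cong[of _ _ card])
  finally have "card ({..<m} - J) = n" using p(2) by (simp only: of_nat_eq_iff)
  moreover have J: "J \<subseteq> {..<m}" by (auto simp: J_def)
  ultimately have cJ: "card J + n = m" by (simp add: card_Diff_subset finite_subset[OF J] card_mono[OF _ J, simplified]) (use card_mono[OF _ J] in auto)
  have "Determinant.det (gram (append_row n m a b)) =
       Determinant.det (gram a) * of_real (\<Sum>i\<in>J. (cmod (\<Sum>r<m. b r * U $$ (r,i)))\<^sup>2)" for b
  proof -
    define B where "B = mat 1 m (\<lambda>(_,r). b r)"
    have B: "B \<in> carrier_mat 1 m" by (simp add: B_def)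
    \<comment> \<open>The orthogonal component of the row \<open>b\<close>.\<close>
    define h where "h = B - B * (C * a)"
    have BP: "B * (C * a) \<in> carrier_mat 1 m" using B Pc by (rule mult_carrier_mat)
    have h: "h \<in> carrier_mat 1 m" unfolding h_def by (rule minus_carrier_mat[OF BP])
    have h_orth: "h * mat_adjoint a = 0\<^sub>m 1 n"
    proof -
      have "h * mat_adjoint a = B * mat_adjoint a - B * (C * a) * mat_adjoint a"
        unfolding h_def by (rule minus_mult_distrib_mat[OF B BP a'])
      also have "B * (C * a) * mat_adjoint a = B * mat_adjoint a"
        using assoc_mult_mat[OF B Pc a'] Pa by simp
      finally show ?thesis using B a' by (simp add: minus_r_inv_mat[of _ 1 n] mult_carrier_mat[of _ 1 m _ n])
    qed
    have hU: "h * U = B * U - B * U * diag_of m p"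
    proof -
      have "h * U = B * U - B * (C * a) * U"
        unfolding h_def by (rule minus_mult_distrib_mat[OF B BP U(1)])
      also have "B * (C * a) * U = B * U * diag_of m p * (mat_adjoint U * U)"
        unfolding P using B U(1) U' diag_of_carrier[of m p]
        by (simp add: assoc_mult_mat[of _ 1 m _ m _ m] assoc_mult_mat[of _ m m _ m _ m] mult_carrier_mat[of _ m m _ m])
      also have "\<dots> = B * U * diag_of m p"
        unfolding U(2) by (rule right_mult_one_mat[of _ 1]) (intro mult_carrier_mat[of _ 1 m _ m] B U(1) diag_of_carrier)
      finally show ?thesis .
    qed
    have BUi: "(B * U) $$ (0,i) = (\<Sum>r<m. b r * U $$ (r,i))" if "i < m" for i
      using that index_mult_sum[OF B U(1), of 0 i] by (simp add: B_def)
    have hUi: "(h * U) $$ (0,i) = (if i \<in> J then (\<Sum>r<m. b r * U $$ (r,i)) else 0)" if "i < m" for i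
    proof -
      have BU: "B * U \<in> carrier_mat 1 m" using B U by simp
      have "(B * U * diag_of m p) $$ (0,i) = (\<Sum>l<m. (B * U) $$ (0,l) * diag_of m p $$ (l,i))"
        by (rule index_mult_sum[OF BU _ _ that]) auto
      also have "\<dots> = (\<Sum>l<m. if l = i then (B * U) $$ (0,i) * p i else 0)"
        using that by (intro sum.cong) (auto simp: diag_of_def)
      also have "\<dots> = (B * U) $$ (0,i) * p i" using that by simp
      finally have "(B * U * diag_of m p) $$ (0,i) = (B * U) $$ (0,i) * p i" .
      then have "(h * U) $$ (0,i) = (B * U) $$ (0,i) - (B * U) $$ (0,i) * p i"
        unfolding hU using that B U by (subst index_minus_mat) (auto simp: diag_of_def)
      then show ?thesis using that p(1)[OF that] BUi[OF that] by (auto simp: J_def)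
    qed
    have normh: "gram h $$ (0,0) = of_real (\<Sum>i\<in>J. (cmod (\<Sum>r<m. b r * U $$ (r,i)))\<^sup>2)"
    proof -
      have "gram U = 1\<^sub>m m" using U(3) by (simp add: gram_def)
      then have "gram h = gram (h * U)"
        using gram_mult[OF h U(1)] h by (simp add: gram_def)
      moreover have "gram (h * U) $$ (0,0) = (\<Sum>i<m. (h * U) $$ (0,i) * cnj ((h * U) $$ (0,i)))"
        by (rule gram_index[of _ 1 m]) (use h U in auto)
      moreover have "\<dots> = (\<Sum>i<m. if i \<in> J then of_real ((cmod (\<Sum>r<m. b r * U $$ (r,i)))\<^sup>2) else 0)"
        by (intro sum.cong refl) (simp add: hUi complex_norm_square del: of_real_power)
      moreover have "\<dots> = (\<Sum>i\<in>{..<m} \<inter> J. of_real ((cmod (\<Sum>r<m. b r * U $$ (r,i)))\<^sup>2))"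
        by (rule sum.inter_restrict[symmetric]) simp
      moreover have "{..<m} \<inter> J = J" using J by auto
      ultimately show ?thesis by simp
    qed
    define BC where "BC = B * C"
    have BC: "BC \<in> carrier_mat 1 n" using B C by (simp add: BC_def)
    \<comment> \<open>Subtracting from the last row its projection onto the other rows is multiplication by a unipotent matrix.\<close>
    define L where "L = mat (Suc n) (Suc n) (\<lambda>(i,j). if i = j then 1 else if i = n then - BC $$ (0,j) else 0)"
    have L: "L \<in> carrier_mat (Suc n) (Suc n)" by (simp add: L_def)
    have "Determinant.det L = prod_list (diag_mat L)"
      by (rule det_lower_triangular[OF _ L]) (auto simp: L_def)
    then have detL: "Determinant.det L = 1" by (simp add: prod_list_diag_prod L_def)
    define Y where "Y = append_row n m a (\<lambda>r. h $$ (0,r))"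
    have Y: "Y \<in> carrier_mat (Suc n) m" by (simp add: Y_def)
    have LX: "L * append_row n m a b = Y"
    proof (rule eq_matI)
      fix i r assume "i < dim_row Y" "r < dim_col Y"
      then have ir: "i < Suc n" "r < m" using Y by auto
      have "(L * append_row n m a b) $$ (i,r) = (\<Sum>j<Suc n. L $$ (i,j) * append_row n m a b $$ (j,r))"
        by (rule index_mult_sum[OF L append_row_carrier ir])
      also have "\<dots> = (\<Sum>j<n. L $$ (i,j) * a $$ (j,r)) + L $$ (i,n) * b r"
        using ir by (simp add: append_row_def)
      also have "\<dots> = Y $$ (i,r)"
      proof (cases "i = n")
        case True
        have "h $$ (0,r) = b r - (B * (C * a)) $$ (0,r)"
          unfolding h_def using ir B Pc by (subst index_minus_mat) (auto simp: B_def)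
        also have "B * (C * a) = BC * a" using assoc_mult_mat[OF B C a] by (simp add: BC_def)
        also have "(BC * a) $$ (0,r) = (\<Sum>j<n. BC $$ (0,j) * a $$ (j,r))"
          by (rule index_mult_sum[OF BC a _ ir(2)]) simp
        finally show ?thesis using True ir by (simp add: L_def Y_def append_row_def sum_negf)
      next
        case False
        then have "(\<Sum>j<n. L $$ (i,j) * a $$ (j,r)) = (\<Sum>j<n. if j = i then a $$ (j,r) else 0)"
          using ir by (intro sum.cong) (auto simp: L_def)
        then show ?thesis using False ir by (simp add: L_def Y_def append_row_def)
      qed
      finally show "(L * append_row n m a b) $$ (i,r) = Y $$ (i,r)" .
    qed (use L Y in \<open>auto simp: append_row_def\<close>)
    have ha: "(\<Sum>r<m. h $$ (0,r) * cnj (a $$ (j,r))) = 0" if "j < n" for j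
    proof -
      have "(h * mat_adjoint a) $$ (0,j) = (\<Sum>r<m. h $$ (0,r) * mat_adjoint a $$ (r,j))"
        by (rule index_mult_sum[OF h a' _ that]) simp
      then show ?thesis using h_orth that by (simp add: mat_adjoint_index[OF a])
    qed
    have ha': "(\<Sum>r<m. a $$ (j,r) * cnj (h $$ (0,r))) = 0" if "j < n" for j
    proof -
      have "(\<Sum>r<m. a $$ (j,r) * cnj (h $$ (0,r))) = cnj (\<Sum>r<m. h $$ (0,r) * cnj (a $$ (j,r)))"
        by (simp add: mult.commute)
      then show ?thesis using ha[OF that] by simp
    qed
    have "gram Y = four_block_mat (gram a) (0\<^sub>m n 1) (0\<^sub>m 1 n) (mat 1 1 (\<lambda>_. gram h $$ (0,0)))" (is "_ = ?R")
    proof (rule eq_matI)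
      fix i j assume "i < dim_row ?R" "j < dim_col ?R"
      then have ij: "i < Suc n" "j < Suc n" using G by auto
      have "gram Y $$ (i,j) = (\<Sum>r<m. Y $$ (i,r) * cnj (Y $$ (j,r)))" by (rule gram_index[OF Y ij])
      also have "\<dots> = ?R $$ (i,j)"
        using ij G ha ha' gram_index[OF a, of i j] gram_index[OF h, of 0 0]
        by (cases "i < n"; cases "j < n") (auto simp: Y_def append_row_def less_Suc_eq)
      finally show "gram Y $$ (i,j) = ?R $$ (i,j)" .
    qed (use G gram_carrier[OF Y] in auto)
    then have "Determinant.det (gram Y) = Determinant.det (gram a) * Determinant.det (mat 1 1 (\<lambda>_. gram h $$ (0,0)))"
      using det_four_block_mat_upper_right_zero[OF G refl, of "0\<^sub>m 1 n" 1 "mat 1 1 (\<lambda>_. gram h $$ (0,0))"] by simp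
    also have "Determinant.det (mat 1 1 (\<lambda>_. gram h $$ (0,0))) = gram h $$ (0,0)" by (simp add: det_def sign_def)
    finally have "Determinant.det (gram Y) = Determinant.det (gram a) * gram h $$ (0,0)" .
    moreover have "Determinant.det (gram Y) = Determinant.det (gram (append_row n m a b))"
      using det_gram_mult[OF L append_row_carrier, of m a b] by (simp add: LX detL)
    ultimately show ?thesis using normh by simp
  qed
  then show ?thesis using that[OF U J cJ] by blast
qed

section \<open>Negative powers of the Gram determinant\<close>

lemma nn_integral_Gamma_exp:
  assumes "0 < (s::real)" "0 < q"
  shows "(\<integral>\<^sup>+t. ennreal (indicator {0..} t * t powr (s - 1) * exp (- (t * q))) \<partial>lborel) = ennreal (Gamma s * q powr (- s))"
proof -
  let ?f = "\<lambda>t. ennreal (indicator {0..} t * t powr (s - 1) / exp t)"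
  let ?g = "\<lambda>t. ennreal (indicator {0..} t * t powr (s - 1) * exp (- (t * q)))"
  have "ennreal \<bar>q\<bar> * (\<integral>\<^sup>+t. ?f (q * t + 0) \<partial>lborel) = (\<integral>\<^sup>+t. ?f t \<partial>lborel)"
    by (rule nn_integral_real_affine_scaled) (use assms in auto)
  also have "(\<integral>\<^sup>+t. ?f (q * t + 0) \<partial>lborel) = (\<integral>\<^sup>+t. ennreal (q powr (s - 1)) * ?g t \<partial>lborel)"
    using assms by (intro nn_integral_cong)
      (auto simp: indicator_def zero_le_mult_iff powr_mult exp_minus divide_inverse ennreal_mult'[symmetric] mult_ac)
  also have "\<dots> = ennreal (q powr (s - 1)) * (\<integral>\<^sup>+t. ?g t \<partial>lborel)" by (rule nn_integral_cmult) measurable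
  finally have eq: "ennreal q * (ennreal (q powr (s - 1)) * (\<integral>\<^sup>+t. ?g t \<partial>lborel)) = ennreal (Gamma s)"
    using assms by (simp add: Gamma_conv_nn_integral_real)
  have "ennreal (q powr (- s)) * ennreal q * ennreal (q powr (s - 1)) = ennreal (q powr (- s) * (q powr 1 * q powr (s - 1)))"
    using assms by (simp add: ennreal_mult[symmetric] mult.assoc)
  also have "\<dots> = 1" using assms unfolding powr_add[symmetric] by simp
  finally have "(\<integral>\<^sup>+t. ?g t \<partial>lborel) = ennreal (q powr (- s)) * (ennreal q * (ennreal (q powr (s - 1)) * (\<integral>\<^sup>+t. ?g t \<partial>lborel)))"
    by (simp only: mult.assoc[symmetric] mult_1)
  also have "\<dots> = ennreal (Gamma s * q powr (- s))"
    unfolding eq using assms by (simp add: ennreal_mult[symmetric] mult.commute)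
  finally show ?thesis .
qed

lemma cvec_entry_borel: "i < n \<Longrightarrow> (\<lambda>z. z i) \<in> borel_measurable (cvec_space n)"
  using measurable_component_singleton[of i "{..<n}" "\<lambda>_. lborel :: complex measure"] by simp

lemma sum_norm_sq_borel: "J \<subseteq> {..<n} \<Longrightarrow> (\<lambda>z. \<Sum>i\<in>J. (cmod (z i))\<^sup>2) \<in> borel_measurable (cvec_space n)"
  by (intro borel_measurable_sum borel_measurable_power measurable_compose[OF _ borel_measurable_norm] cvec_entry_borel) auto

lemma AE_cvec_nonzero:
  assumes "i < n"
  shows "AE z in cvec_space n. z i \<noteq> 0"
proof -
  interpret product_sigma_finite "\<lambda>_::nat. lborel :: complex measure" by unfold_locales
  let ?E = "PiE {..<n} (\<lambda>j. if j = i then {0::complex} else UNIV)"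
  have "emeasure (cvec_space n) ?E = (\<Prod>j<n. emeasure lborel (if j = i then {0::complex} else UNIV))"
    by (rule emeasure_PiM) auto
  also have "\<dots> = 0" using assms by (intro prod_zero bexI[of _ i]) auto
  finally have "?E \<in> null_sets (cvec_space n)" by (auto intro!: null_setsI sets_PiM_I_finite)
  then show ?thesis
    by (rule AE_I') (auto simp: space_PiM PiE_iff extensional_def)
qed

text \<open>
  The sum of \<open>k = card J\<close> squared moduli is a Gamma variable with shape \<open>k\<close>, and its
  moment of order \<open>-s\<close> is \<open>Gamma (k - s) / Gamma k\<close>. The proof avoids polar
  coordinates: inserting
  \[ \Gamma(s)\, q^{-s} = \int_0^\infty t^{s-1} e^{-tq}\, dt \]
  makes the integral over \<open>b\<close> a product of Gaussian integrals, equal to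
  \<open>pi ^ m * (1 + t) powr (- k)\<close>. The same formula for this power of \<open>1 + t\<close>
  evaluates the remaining beta integral.
\<close>

lemma nn_integral_gauss_subset_norm_powr:
  assumes J: "J \<subseteq> {..<m}" and s: "0 < s" "s < real (card J)"
  shows "(\<integral>\<^sup>+b. ennreal ((\<Sum>i\<in>J. (cmod (b i))\<^sup>2) powr (- s) * exp (- (\<Sum>i<m. (cmod (b i))\<^sup>2))) \<partial>cvec_space m)
       = ennreal (pi ^ m * (Gamma (real (card J) - s) / Gamma (real (card J))))" (is "?L = _")
proof -
  define k where "k = real (card J)"
  define q where "q b = (\<Sum>i\<in>J. (cmod (b i))\<^sup>2)" for b :: "nat \<Rightarrow> complex"
  define e where "e b = (\<Sum>i<m. (cmod (b i))\<^sup>2)" for b :: "nat \<Rightarrow> complex"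
  define w where "w a t = indicator {0..} t * t powr (a - 1)" for a t :: real
  have w0: "0 \<le> w a t" for a t by (simp add: w_def)
  have [measurable]: "w a \<in> borel_measurable borel" for a unfolding w_def by measurable
  have k: "k > 0" "s < k" using s by (auto simp: k_def)
  have G: "Gamma s > 0" "Gamma k > 0" "Gamma (k - s) > 0" using s k by (auto intro!: Gamma_real_pos)
  have [measurable]: "q \<in> borel_measurable (cvec_space m)" unfolding q_def using J by (intro sum_norm_sq_borel)
  have [measurable]: "e \<in> borel_measurable (cvec_space m)" unfolding e_def by (intro sum_norm_sq_borel) simp
  have "J \<noteq> {}" using s by auto
  then obtain i0 where i0: "i0 \<in> J" by auto
  have fJ: "finite J" using J finite_subset by blast
  \<comment> \<open>The formula for \<open>q powr (- s)\<close> needs \<open>q > 0\<close>.\<close>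
  have AEq: "AE b in cvec_space m. q b > 0"
  proof -
    have "AE b in cvec_space m. b i0 \<noteq> 0" using i0 J by (intro AE_cvec_nonzero) auto
    then show ?thesis
    proof eventually_elim
      case (elim b)
      have "0 < (cmod (b i0))\<^sup>2" using elim by simp
      also have "\<dots> \<le> q b" unfolding q_def by (rule member_le_sum[OF i0]) (use fJ in auto)
      finally show ?case .
    qed
  qed
  have inner: "(\<integral>\<^sup>+b. ennreal (exp (- (t * q b + e b))) \<partial>cvec_space m) = ennreal (pi ^ m * (1 + t) powr (- k))" if t: "0 \<le> t" for t
  proof -
    interpret product_sigma_finite "\<lambda>_::nat. lborel :: complex measure" by unfold_locales
    let ?l = "\<lambda>i. if i \<in> J then 1 + t else 1"
    have "t * q b + e b = (\<Sum>i<m. ?l i * (cmod (b i))\<^sup>2)" for b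
    proof -
      have "q b = (\<Sum>i<m. if i \<in> J then (cmod (b i))\<^sup>2 else 0)"
        unfolding q_def using J by (subst sum.inter_restrict[symmetric]) (auto simp: Int_absorb1)
      then have "t * q b + e b = (\<Sum>i<m. t * (if i \<in> J then (cmod (b i))\<^sup>2 else 0) + (cmod (b i))\<^sup>2)"
        by (simp only: e_def sum_distrib_left sum.distrib)
      also have "\<dots> = (\<Sum>i<m. ?l i * (cmod (b i))\<^sup>2)"
        by (intro sum.cong refl) (auto simp: algebra_simps)
      finally show ?thesis .
    qed
    then have "(\<integral>\<^sup>+b. ennreal (exp (- (t * q b + e b))) \<partial>cvec_space m)
      = (\<integral>\<^sup>+b. (\<Prod>i<m. ennreal (exp (- ?l i * (cmod (b i))\<^sup>2))) \<partial>cvec_space m)"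
      by (simp add: exp_sum sum_negf[symmetric] prod_ennreal)
    also have "\<dots> = (\<Prod>i<m. \<integral>\<^sup>+z. ennreal (exp (- ?l i * (cmod z)\<^sup>2)) \<partial>lborel)"
      by (rule product_nn_integral_prod) auto
    also have "\<dots> = (\<Prod>i<m. ennreal (pi / ?l i))"
      using t by (intro prod.cong nn_integral_complex_gaussian) auto
    also have "\<dots> = ennreal (\<Prod>i<m. pi / ?l i)" using t by (intro prod_ennreal) auto
    also have "(\<Prod>i<m. pi / ?l i) = pi ^ m / (\<Prod>i<m. ?l i)" by (simp add: prod_dividef)
    also have "(\<Prod>i<m. ?l i) = (1 + t) ^ card J"
      using J by (subst prod.inter_restrict[symmetric]) (auto simp: Int_absorb1)
    also have "pi ^ m / (1 + t) ^ card J = pi ^ m * (1 + t) powr (- k)"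
      using t by (simp add: k_def powr_minus powr_realpow divide_inverse)
    finally show ?thesis .
  qed
  have "ennreal (Gamma s) * ?L = (\<integral>\<^sup>+b. ennreal (Gamma s) * ennreal (q b powr (- s) * exp (- e b)) \<partial>cvec_space m)"
    unfolding q_def[symmetric] e_def[symmetric] by (rule nn_integral_cmult[symmetric]) measurable
  also have "\<dots> = (\<integral>\<^sup>+b. \<integral>\<^sup>+t. ennreal (w s t) * ennreal (exp (- (t * q b + e b))) \<partial>lborel \<partial>cvec_space m)"
  proof (rule nn_integral_cong_AE, use AEq in eventually_elim)
    case (elim b)
    have "(\<integral>\<^sup>+t. ennreal (w s t) * ennreal (exp (- (t * q b + e b))) \<partial>lborel)
      = (\<integral>\<^sup>+t. ennreal (exp (- e b)) * ennreal (indicator {0..} t * t powr (s - 1) * exp (- (t * q b))) \<partial>lborel)"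
      by (intro nn_integral_cong) (simp add: w_def ennreal_mult[symmetric] exp_add[symmetric] exp_diff exp_minus divide_inverse mult_ac)
    also have "\<dots> = ennreal (exp (- e b)) * ennreal (Gamma s * q b powr (- s))"
      by (subst nn_integral_cmult) (use nn_integral_Gamma_exp[OF s(1) elim] in \<open>simp_all\<close>)
    finally show ?case using G by (simp add: ennreal_mult[symmetric] mult_ac)
  qed
  also have "\<dots> = (\<integral>\<^sup>+t. \<integral>\<^sup>+b. ennreal (w s t) * ennreal (exp (- (t * q b + e b))) \<partial>cvec_space m \<partial>lborel)"
  proof (rule pair_sigma_finite.Fubini')
    show "pair_sigma_finite lborel (cvec_space m)"
      using lborel.sigma_finite_measure_axioms sigma_finite_cvec_space by (simp add: pair_sigma_finite_def)
  qed measurable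
  also have "\<dots> = (\<integral>\<^sup>+t. ennreal (pi ^ m) * ennreal (w s t * (1 + t) powr (- k)) \<partial>lborel)"
  proof (rule nn_integral_cong)
    fix t :: real
    have "(\<integral>\<^sup>+b. ennreal (w s t) * ennreal (exp (- (t * q b + e b))) \<partial>cvec_space m)
      = ennreal (w s t) * (\<integral>\<^sup>+b. ennreal (exp (- (t * q b + e b))) \<partial>cvec_space m)"
      by (rule nn_integral_cmult) measurable
    also have "\<dots> = ennreal (pi ^ m) * ennreal (w s t * (1 + t) powr (- k))"
    proof (cases "0 \<le> t")
      case True
      then show ?thesis unfolding inner[OF True] using w0[of s t] by (simp add: ennreal_mult[symmetric] mult_ac)
    qed (simp add: w_def)
    finally show "(\<integral>\<^sup>+b. ennreal (w s t) * ennreal (exp (- (t * q b + e b))) \<partial>cvec_space m)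
      = ennreal (pi ^ m) * ennreal (w s t * (1 + t) powr (- k))" .
  qed
  also have "\<dots> = ennreal (pi ^ m) * (\<integral>\<^sup>+t. ennreal (w s t * (1 + t) powr (- k)) \<partial>lborel)"
    by (rule nn_integral_cmult) measurable
  finally have 1: "ennreal (Gamma s) * ?L = ennreal (pi ^ m) * (\<integral>\<^sup>+t. ennreal (w s t * (1 + t) powr (- k)) \<partial>lborel)" .
  have "ennreal (Gamma k) * (\<integral>\<^sup>+t. ennreal (w s t * (1 + t) powr (- k)) \<partial>lborel)
      = (\<integral>\<^sup>+t. ennreal (Gamma k) * ennreal (w s t * (1 + t) powr (- k)) \<partial>lborel)"
    by (rule nn_integral_cmult[symmetric]) measurable
  also have "\<dots> = (\<integral>\<^sup>+t. \<integral>\<^sup>+u. ennreal (w s t * w k u * exp (- (u * (1 + t)))) \<partial>lborel \<partial>lborel)"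
  proof (rule nn_integral_cong)
    fix t :: real
    show "ennreal (Gamma k) * ennreal (w s t * (1 + t) powr (- k))
      = (\<integral>\<^sup>+u. ennreal (w s t * w k u * exp (- (u * (1 + t)))) \<partial>lborel)"
    proof (cases "0 \<le> t")
      case True
      have "(\<integral>\<^sup>+u. ennreal (w s t * w k u * exp (- (u * (1 + t)))) \<partial>lborel)
        = (\<integral>\<^sup>+u. ennreal (w s t) * ennreal (indicator {0..} u * u powr (k - 1) * exp (- (u * (1 + t)))) \<partial>lborel)"
        using w0[of s t] by (intro nn_integral_cong) (simp add: w_def ennreal_mult[symmetric] mult_ac)
      also have "\<dots> = ennreal (w s t) * ennreal (Gamma k * (1 + t) powr (- k))"
        by (subst nn_integral_cmult) (use nn_integral_Gamma_exp[OF k(1), of "1 + t"] True in simp_all)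
      finally show ?thesis using w0[of s t] G by (simp add: ennreal_mult[symmetric] mult_ac)
    qed (simp add: w_def)
  qed
  also have "\<dots> = (\<integral>\<^sup>+u. \<integral>\<^sup>+t. ennreal (w s t * w k u * exp (- (u * (1 + t)))) \<partial>lborel \<partial>lborel)"
    by (rule lborel_pair.Fubini') measurable
  also have "\<dots> = (\<integral>\<^sup>+u. ennreal (Gamma s) * ennreal (indicator {0..} u * u powr ((k - s) - 1) * exp (- (u * 1))) \<partial>lborel)"
  proof (rule nn_integral_cong)
    fix u :: real
    show "(\<integral>\<^sup>+t. ennreal (w s t * w k u * exp (- (u * (1 + t)))) \<partial>lborel)
       = ennreal (Gamma s) * ennreal (indicator {0..} u * u powr ((k - s) - 1) * exp (- (u * 1)))"
    proof (cases "0 < u")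
      case True
      have "(\<integral>\<^sup>+t. ennreal (w s t * w k u * exp (- (u * (1 + t)))) \<partial>lborel)
        = (\<integral>\<^sup>+t. ennreal (w k u * exp (- u)) * ennreal (indicator {0..} t * t powr (s - 1) * exp (- (t * u))) \<partial>lborel)"
        using w0[of k u] by (intro nn_integral_cong) (simp add: w_def ennreal_mult[symmetric] exp_diff exp_minus ring_distribs divide_inverse mult_ac)
      also have "\<dots> = ennreal (w k u * exp (- u)) * ennreal (Gamma s * u powr (- s))"
        by (subst nn_integral_cmult) (use nn_integral_Gamma_exp[OF s(1) True] in simp_all)
      also have "\<dots> = ennreal (Gamma s * (u powr (k - 1) * u powr (- s) * exp (- u)))"
        using True w0[of k u] G by (simp add: ennreal_mult[symmetric] w_def mult_ac)
      also have "u powr (k - 1) * u powr (- s) = u powr ((k - s) - 1)"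
        unfolding powr_add[symmetric] by (rule arg_cong[of _ _ "\<lambda>x. u powr x"]) simp
      finally show ?thesis using True G by (simp add: ennreal_mult)
    next
      case False
      then have "u = 0 \<or> u < 0" by auto
      then show ?thesis by (auto simp: w_def)
    qed
  qed
  also have "\<dots> = ennreal (Gamma s) * ennreal (Gamma (k - s))"
    using nn_integral_Gamma_exp[of "k - s" 1] k by (subst nn_integral_cmult) simp_all
  finally have 2: "ennreal (Gamma k) * (\<integral>\<^sup>+t. ennreal (w s t * (1 + t) powr (- k)) \<partial>lborel) = ennreal (Gamma s) * ennreal (Gamma (k - s))" .
  have "ennreal (Gamma k * Gamma s) * ?L = ennreal (Gamma k) * (ennreal (Gamma s) * ?L)"
    using G by (simp add: ennreal_mult mult.assoc)
  also have "\<dots> = ennreal (pi ^ m) * (ennreal (Gamma k) * (\<integral>\<^sup>+t. ennreal (w s t * (1 + t) powr (- k)) \<partial>lborel))"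
    unfolding 1 by (simp only: mult_ac)
  also have "\<dots> = ennreal (pi ^ m * Gamma s * Gamma (k - s))"
    unfolding 2 using G by (simp add: ennreal_mult mult.assoc)
  finally have 3: "ennreal (Gamma k * Gamma s) * ?L = ennreal (pi ^ m * Gamma s * Gamma (k - s))" .
  have "ennreal (1 / (Gamma k * Gamma s)) * ennreal (Gamma k * Gamma s) = 1"
    using G by (subst ennreal_mult[symmetric]) auto
  then have "?L = ennreal (1 / (Gamma k * Gamma s)) * (ennreal (Gamma k * Gamma s) * ?L)"
    by (simp only: mult.assoc[symmetric] mult_1)
  also have "\<dots> = ennreal (pi ^ m * (Gamma (k - s) / Gamma k))"
    unfolding 3 using G by (subst ennreal_mult[symmetric]) (auto simp: field_simps)
  finally show ?thesis by (simp add: k_def)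
qed

lemma unitary_row_norm:
  assumes U: "U \<in> carrier_mat m m" "U * mat_adjoint U = 1\<^sub>m m"
  shows "(\<Sum>i<m. (cmod (\<Sum>r<m. b r * U $$ (r,i)))\<^sup>2) = (\<Sum>r<m. (cmod (b r))\<^sup>2)"
proof -
  define B where "B = mat 1 m (\<lambda>(_,r). b r)"
  have B: "B \<in> carrier_mat 1 m" by (simp add: B_def)
  have BU: "B * U \<in> carrier_mat 1 m" by (rule mult_carrier_mat[OF B U(1)])
  have BUi: "(B * U) $$ (0,i) = (\<Sum>r<m. b r * U $$ (r,i))" if "i < m" for i
    using that index_mult_sum[OF B U(1), of 0 i] by (simp add: B_def)
  have "gram (B * U) = gram B"
    using gram_mult[OF B U(1)] U(2) right_mult_one_mat[OF B] by (simp add: gram_def)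
  then have "gram (B * U) $$ (0,0) = gram B $$ (0,0)" by simp
  moreover have "gram (B * U) $$ (0,0) = (\<Sum>i<m. (B * U) $$ (0,i) * cnj ((B * U) $$ (0,i)))"
    by (rule gram_index[OF BU]) auto
  moreover have "\<dots> = of_real (\<Sum>i<m. (cmod (\<Sum>r<m. b r * U $$ (r,i)))\<^sup>2)"
    unfolding of_real_sum complex_norm_square using BUi by (intro sum.cong refl) (simp only: lessThan_iff)
  moreover have "gram B $$ (0,0) = (\<Sum>i<m. B $$ (0,i) * cnj (B $$ (0,i)))"
    by (rule gram_index[OF B]) auto
  moreover have "\<dots> = of_real (\<Sum>r<m. (cmod (b r))\<^sup>2)"
    unfolding of_real_sum complex_norm_square by (intro sum.cong refl) (simp add: B_def)
  ultimately show ?thesis by (simp only: of_real_eq_iff)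
qed

text \<open>
  Given the first \<open>n\<close> rows, rotate the new row by the unitary matrix from
  \<open>det_gram_append_row\<close>. The Gaussian weight is invariant, and the Gram determinant is multiplied by
  the sum of \<open>m - n\<close> squared moduli. If the first \<open>n\<close> rows are linearly dependent, both
  Gram determinants vanish and so do both sides.
\<close>

lemma gauss_integral_gram_det_powr_Suc:
  assumes nm: "n < m" and s: "0 < s" "s < real m - real n"
  shows "gauss_integral (Suc n) m (\<lambda>Z. gram_det (Suc n) m Z powr (- s))
       = gauss_integral n m (\<lambda>Z. gram_det n m Z powr (- s)) *
         ennreal (pi ^ m * (Gamma (real m - real n - s) / Gamma (real m - real n)))"
proof -
  let ?c = "ennreal (pi ^ m * (Gamma (real m - real n - s) / Gamma (real m - real n)))"
  let ?F = "\<lambda>Z. ennreal (gram_det (Suc n) m Z powr (- s) * exp (- (\<Sum>k<Suc n. row_energy m Z k)))"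
  let ?h = "\<lambda>A. ennreal (gram_det n m A powr (- s) * exp (- (\<Sum>k<n. row_energy m A k)))"
  have re: "(\<Sum>k<Suc n. row_energy m (add_row n m A b) k) = (\<Sum>k<n. row_energy m A k) + (\<Sum>r<m. (cmod (b r))\<^sup>2)" for A b
    by (simp add: row_energy_def add_row_def)
  have "gauss_integral (Suc n) m (\<lambda>Z. gram_det (Suc n) m Z powr (- s))
      = (\<integral>\<^sup>+A. \<integral>\<^sup>+b. ?F (add_row n m A b) \<partial>cvec_space m \<partial>cmat_space n m)"
    unfolding gauss_integral_def by (rule nn_integral_add_row) measurable
  also have "\<dots> = (\<integral>\<^sup>+A. ?h A * ?c \<partial>cmat_space n m)"
  proof (rule nn_integral_cong)
    fix A :: "nat \<Rightarrow> nat \<Rightarrow> complex"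
    let ?a = "to_mat n m A"
    have a: "?a \<in> carrier_mat n m" by simp
    show "(\<integral>\<^sup>+b. ?F (add_row n m A b) \<partial>cvec_space m) = ?h A * ?c"
    proof (cases "Determinant.det (gram ?a) = 0")
      case True
      then have "gram_det (Suc n) m (add_row n m A b) = 0" for b
        unfolding gram_det_def to_mat_add_row by (simp add: det_gram_append_row_singular[OF a])
      moreover have "gram_det n m A = 0" using True by (simp add: gram_det_def)
      ultimately show ?thesis by simp
    next
      case False
      obtain U J where U: "U \<in> carrier_mat m m" "mat_adjoint U * U = 1\<^sub>m m" "U * mat_adjoint U = 1\<^sub>m m"
        and J: "J \<subseteq> {..<m}" "card J + n = m"
        and det: "\<And>b. Determinant.det (gram (append_row n m ?a b)) =
           Determinant.det (gram ?a) * of_real (\<Sum>i\<in>J. (cmod (\<Sum>r<m. b r * U $$ (r,i)))\<^sup>2)"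
        by (rule det_gram_append_row[OF a False]) blast
      have cJ: "real (card J) = real m - real n" using J(2) by (metis add_diff_cancel_right' of_nat_add)
      \<comment> \<open>The row vector \<open>b U\<close> is the column vector \<open>U\<^sup>T b\<close>.\<close>
      let ?V = "transpose_mat U"
      have V: "?V \<in> carrier_mat m m" using U by simp
      have detV: "(cmod (Determinant.det ?V))\<^sup>2 = 1"
        using unitary_det_norm[OF U(1,3)] det_transpose[OF U(1)] by simp
      have Vb: "affine_map m ?V (\<lambda>_. 0) b i = (\<Sum>r<m. b r * U $$ (r,i))" if "i < m" for i b
        using that U(1) by (simp add: affine_map_def mult.commute)
      let ?k = "\<lambda>b. ennreal ((\<Sum>i\<in>J. (cmod (b i))\<^sup>2) powr (- s) * exp (- (\<Sum>i<m. (cmod (b i))\<^sup>2)))"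
      have k: "?k \<in> borel_measurable (cvec_space m)"
      proof -
        have [measurable]: "(\<lambda>b. \<Sum>i\<in>J. (cmod (b i))\<^sup>2) \<in> borel_measurable (cvec_space m)"
          "(\<lambda>b. \<Sum>i<m. (cmod (b i))\<^sup>2) \<in> borel_measurable (cvec_space m)"
          by (rule sum_norm_sq_borel, use J in simp)+
        show ?thesis by measurable
      qed
      have aff: "affine_map m ?V (\<lambda>_. 0) \<in> measurable (cvec_space m) (cvec_space m)" by measurable
      have kaff: "(\<lambda>b. ?k (affine_map m ?V (\<lambda>_. 0) b)) \<in> borel_measurable (cvec_space m)"
        by (rule measurable_compose[OF aff k])
      have gd: "gram_det (Suc n) m (add_row n m A b) = gram_det n m A * (\<Sum>i\<in>J. (cmod (affine_map m ?V (\<lambda>_. 0) b i))\<^sup>2)" for b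
      proof -
        have "(\<Sum>i\<in>J. (cmod (affine_map m ?V (\<lambda>_. 0) b i))\<^sup>2) = (\<Sum>i\<in>J. (cmod (\<Sum>r<m. b r * U $$ (r,i)))\<^sup>2)"
          using J(1) by (intro sum.cong refl) (auto simp: Vb)
        then show ?thesis unfolding gram_det_def to_mat_add_row det by simp
      qed
      have eb: "(\<Sum>r<m. (cmod (b r))\<^sup>2) = (\<Sum>i<m. (cmod (affine_map m ?V (\<lambda>_. 0) b i))\<^sup>2)" for b
        using unitary_row_norm[OF U(1,3), of b] by (simp add: Vb)
      have "?F (add_row n m A b) = ?h A * ?k (affine_map m ?V (\<lambda>_. 0) b)" for b
      proof -
        let ?q = "\<Sum>i\<in>J. (cmod (affine_map m ?V (\<lambda>_. 0) b i))\<^sup>2"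
        let ?e = "\<Sum>i<m. (cmod (affine_map m ?V (\<lambda>_. 0) b i))\<^sup>2" and ?E = "\<Sum>k<n. row_energy m A k"
        have "(gram_det n m A * ?q) powr (- s) = gram_det n m A powr (- s) * ?q powr (- s)"
          by (rule powr_mult)
        moreover have "exp (- (?E + ?e)) = exp (- ?E) * exp (- ?e)"
          by (simp only: exp_add[symmetric] minus_add_distrib)
        ultimately have "(gram_det n m A * ?q) powr (- s) * exp (- (?E + ?e))
          = (gram_det n m A powr (- s) * exp (- ?E)) * (?q powr (- s) * exp (- ?e))"
          by (simp only: mult_ac)
        then show ?thesis unfolding gd re eb[of b] by (simp only: ennreal_mult powr_ge_zero exp_ge_zero mult_nonneg_nonneg)
      qed
      then have "(\<integral>\<^sup>+b. ?F (add_row n m A b) \<partial>cvec_space m) = (\<integral>\<^sup>+b. ?h A * ?k (affine_map m ?V (\<lambda>_. 0) b) \<partial>cvec_space m)"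
        by (simp only:)
      also have "\<dots> = ?h A * (\<integral>\<^sup>+b. ?k (affine_map m ?V (\<lambda>_. 0) b) \<partial>cvec_space m)"
        by (rule nn_integral_cmult[OF kaff])
      also have "(\<integral>\<^sup>+b. ?k (affine_map m ?V (\<lambda>_. 0) b) \<partial>cvec_space m) = (\<integral>\<^sup>+b. ?k b \<partial>cvec_space m)"
      proof -
        have "Determinant.det ?V \<noteq> 0" using detV by auto
        from nn_integral_affine_map[OF V this k, of "\<lambda>_. 0"] show ?thesis
          unfolding detV by (simp only: ennreal_1 mult_1)
      qed
      also have "\<dots> = ?c"
        using nn_integral_gauss_subset_norm_powr[OF J(1) s(1)] s(2) cJ by simp
      finally show ?thesis .
    qed
  qed
  also have "\<dots> = gauss_integral n m (\<lambda>Z. gram_det n m Z powr (- s)) * ?c"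
    unfolding gauss_integral_def by (rule nn_integral_multc) measurable
  finally show ?thesis .
qed

lemma gauss_integral_no_rows: "gauss_integral 0 m (\<lambda>Z. gram_det 0 m Z powr (- s)) = 1"
proof -
  interpret L: product_sigma_finite "\<lambda>_::nat. lborel :: complex measure" by unfold_locales
  interpret C: sigma_finite_measure "cvec_space 0" by (rule sigma_finite_cvec_space)
  interpret P: product_sigma_finite "\<lambda>_::nat. cvec_space 0" by unfold_locales
  have "gram_det 0 m Z = 1" for Z
    unfolding gram_det_def by (subst det_dim_zero) (rule gram_carrier[OF to_mat_carrier], simp)
  then have "gauss_integral 0 m (\<lambda>Z. gram_det 0 m Z powr (- s)) = (\<integral>\<^sup>+Z. (\<Prod>r<m. 1) \<partial>cmat_space 0 m)"
    by (simp add: gauss_integral_def)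
  also have "\<dots> = (\<Prod>r<m. \<integral>\<^sup>+z. 1 \<partial>cvec_space 0)" by (rule P.product_nn_integral_prod) auto
  also have "(\<integral>\<^sup>+z. 1 \<partial>cvec_space 0) = 1" unfolding lessThan_0 by (subst L.nn_integral_empty) auto
  finally show ?thesis by simp
qed

text \<open>
  The Mellin transform of the determinant of a complex Wishart matrix: the determinant is distributed like a
  product of independent Gamma variables with shapes \<open>m, m - 1, \<dots>, m - n + 1\<close>.
\<close>

lemma gauss_integral_gram_det_powr:
  assumes s: "0 < s" "s < real m - real n + 1" and nm: "n \<le> m"
  shows "gauss_integral n m (\<lambda>Z. gram_det n m Z powr (- s))
       = ennreal (\<Prod>i<n. pi ^ m * (Gamma (real m - real i - s) / Gamma (real m - real i)))"
  using s nm
proof (induction n)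
  case 0
  then show ?case by (simp add: gauss_integral_no_rows)
next
  case (Suc n)
  have pos: "0 \<le> pi ^ m * (Gamma (real m - real i - s) / Gamma (real m - real i))" if "i < Suc n" for i
  proof -
    have "Gamma (real m - real i - s) > 0" "Gamma (real m - real i) > 0"
      using that Suc.prems by (auto intro!: Gamma_real_pos)
    then show ?thesis by simp
  qed
  have "gauss_integral (Suc n) m (\<lambda>Z. gram_det (Suc n) m Z powr (- s))
     = gauss_integral n m (\<lambda>Z. gram_det n m Z powr (- s)) * ennreal (pi ^ m * (Gamma (real m - real n - s) / Gamma (real m - real n)))"
    by (rule gauss_integral_gram_det_powr_Suc) (use Suc.prems in auto)
  also have "gauss_integral n m (\<lambda>Z. gram_det n m Z powr (- s))
    = ennreal (\<Prod>i<n. pi ^ m * (Gamma (real m - real i - s) / Gamma (real m - real i)))"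
    by (rule Suc.IH) (use Suc.prems in auto)
  finally have eq: "gauss_integral (Suc n) m (\<lambda>Z. gram_det (Suc n) m Z powr (- s))
    = ennreal (\<Prod>i<n. pi ^ m * (Gamma (real m - real i - s) / Gamma (real m - real i)))
      * ennreal (pi ^ m * (Gamma (real m - real n - s) / Gamma (real m - real n)))" .
  have "0 \<le> (\<Prod>i<n. pi ^ m * (Gamma (real m - real i - s) / Gamma (real m - real i)))"
    using pos by (intro prod_nonneg ballI) simp
  then show ?case unfolding eq prod.lessThan_Suc by (rule ennreal_mult[symmetric]) (rule pos, simp)
qed

section \<open>Moments of the weighted energy\<close>

definition weighted_energy :: "nat \<Rightarrow> nat \<Rightarrow> (nat \<Rightarrow> real) \<Rightarrow> (nat \<Rightarrow> nat \<Rightarrow> complex) \<Rightarrow> real" where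
  "weighted_energy n m y Z = (\<Sum>i<n. y i * row_energy m Z i)"

lemma gauss_integral_sum:
  assumes H: "\<And>i. i < n \<Longrightarrow> H i \<in> borel_measurable (cmat_space n m)" "\<And>i Z. i < n \<Longrightarrow> 0 \<le> H i Z"
    and a: "\<And>i. i < n \<Longrightarrow> 0 \<le> a i" and c: "\<And>i. i < n \<Longrightarrow> 0 \<le> c i"
    and K: "\<And>i. i < n \<Longrightarrow> gauss_integral n m (H i) = ennreal (c i) * K0"
  shows "gauss_integral n m (\<lambda>Z. \<Sum>i<n. a i * H i Z) = ennreal (\<Sum>i<n. a i * c i) * K0"
proof -
  let ?e = "\<lambda>Z. exp (- (\<Sum>k<n. row_energy m Z k))"
  have [measurable]: "?e \<in> borel_measurable (cmat_space n m)" by measurable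
  have "gauss_integral n m (\<lambda>Z. \<Sum>i<n. a i * H i Z) = (\<integral>\<^sup>+Z. (\<Sum>i<n. ennreal (a i) * ennreal (H i Z * ?e Z)) \<partial>cmat_space n m)"
    unfolding gauss_integral_def
  proof (rule nn_integral_cong)
    fix Z
    have "(\<Sum>i<n. a i * H i Z) * ?e Z = (\<Sum>i<n. a i * (H i Z * ?e Z))" by (simp add: sum_distrib_right mult.assoc)
    also have "ennreal \<dots> = (\<Sum>i<n. ennreal (a i * (H i Z * ?e Z)))"
      using H a by (intro sum_ennreal[symmetric]) auto
    also have "\<dots> = (\<Sum>i<n. ennreal (a i) * ennreal (H i Z * ?e Z))"
      using H a by (intro sum.cong ennreal_mult) auto
    finally show "ennreal ((\<Sum>i<n. a i * H i Z) * ?e Z) = (\<Sum>i<n. ennreal (a i) * ennreal (H i Z * ?e Z))" .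
  qed
  also have "\<dots> = (\<Sum>i<n. \<integral>\<^sup>+Z. ennreal (a i) * ennreal (H i Z * ?e Z) \<partial>cmat_space n m)"
    using H by (intro nn_integral_sum) auto
  also have "\<dots> = (\<Sum>i<n. ennreal (a i) * gauss_integral n m (H i))"
    unfolding gauss_integral_def using H by (intro sum.cong nn_integral_cmult) auto
  also have "\<dots> = (\<Sum>i<n. ennreal (a i * c i) * K0)"
    using a c by (intro sum.cong) (auto simp: K ennreal_mult mult.assoc)
  also have "\<dots> = ennreal (\<Sum>i<n. a i * c i) * K0"
    unfolding sum_distrib_right[symmetric] using a c by (subst sum_ennreal) auto
  finally show ?thesis .
qed

text \<open>
  The weight \<open>gram_det powr (- s)\<close> has degree \<open>-2 * s\<close> in every row, so under it
  each row energy has mean \<open>\<nu> = m - s\<close>. Multiplying the weight by the energy of row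
  \<open>j\<close> raises the degree in row \<open>j\<close> by 2 and leaves the other rows alone. Mixed moments of
  the row energies up to order three follow, and they are those of independent Gamma variables with shape
  \<open>\<nu>\<close>. The moments of \<open>\<Sum> y\<^sub>i \<rho>\<^sub>i\<close> are therefore polynomials
  in the power sums of \<open>y\<close>, with the cumulants
  \<open>(k-1)! \<nu> \<Sum> y\<^sub>i\<^sup>k\<close>.
\<close>

locale gram_det_weight =
  fixes n m :: nat and s :: real
  assumes s_less: "s < real m" and s_pos: "0 < s"
begin

abbreviation "D Z \<equiv> gram_det n m Z powr (- s)"
abbreviation "\<rho> i Z \<equiv> row_energy m Z i"
definition "\<nu> = real m - s"
abbreviation "K0 \<equiv> gauss_integral n m D"

lemma nu_pos: "\<nu> > 0" using s_less by (simp add: \<nu>_def)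

lemma meas [measurable]: "D \<in> borel_measurable (cmat_space n m)" "i < n \<Longrightarrow> \<rho> i \<in> borel_measurable (cmat_space n m)"
  by measurable

lemma D_scale: "0 < c \<Longrightarrow> i < n \<Longrightarrow> D (columnwise n m (row_scaling n i c) Z) = c powr (2 * - s) * D Z"
proof -
  assume c: "0 < c" and i: "i < n"
  have "(c\<^sup>2) powr (- s) = c powr (2 * - s)" using c by (simp add: powr_powr flip: powr_numeral)
  then show ?thesis unfolding gram_det_row_scaling[OF i] powr_mult by simp
qed

lemma scale_exponent: "0 < c \<Longrightarrow> c powr (2 * (x + of_bool P)) = c powr (2 * x) * (if P then c\<^sup>2 else 1)" for c x :: real
  by (cases P) (simp_all add: ring_distribs powr_add)

lemma row_energy_moment1: assumes i: "i < n" shows "gauss_integral n m (\<lambda>Z. D Z * \<rho> i Z) = ennreal \<nu> * K0"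
proof -
  have "gauss_integral n m (\<lambda>Z. D Z * \<rho> i Z) = ennreal (real m + - s) * K0"
    by (rule gauss_integral_mult_row_energy[OF i]) (use i s_less in \<open>auto simp: D_scale gram_det_eq_0[OF i]\<close>)
  then show ?thesis by (simp add: \<nu>_def)
qed

lemma row_energy_moment2:
  assumes i: "i < n" and j: "j < n"
  shows "gauss_integral n m (\<lambda>Z. D Z * \<rho> j Z * \<rho> i Z) = ennreal ((\<nu> + of_bool (i = j)) * \<nu>) * K0"
proof -
  have "gauss_integral n m (\<lambda>Z. (D Z * \<rho> j Z) * \<rho> i Z) = ennreal (real m + (- s + of_bool (i = j))) * gauss_integral n m (\<lambda>Z. D Z * \<rho> j Z)"
  proof (rule gauss_integral_mult_row_energy[OF i])
    show "D (columnwise n m (row_scaling n i c) Z) * \<rho> j (columnwise n m (row_scaling n i c) Z)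
        = c powr (2 * (- s + of_bool (i = j))) * (D Z * \<rho> j Z)" if "0 < c" for c Z
      unfolding D_scale[OF that i] row_energy_row_scaling[OF j] scale_exponent[OF that]
      by (cases "i = j") auto
  qed (use i j s_less in \<open>auto simp: gram_det_eq_0[OF i] row_energy_nonneg\<close>)
  moreover have "real m + (- s + of_bool (i = j)) = \<nu> + of_bool (i = j)" by (simp add: \<nu>_def)
  moreover have "ennreal (\<nu> + of_bool (i = j)) * (ennreal \<nu> * K0) = ennreal ((\<nu> + of_bool (i = j)) * \<nu>) * K0"
    using nu_pos by (simp add: ennreal_mult mult.assoc)
  ultimately show ?thesis by (simp only: row_energy_moment1[OF j])
qed

lemma row_energy_moment3:
  assumes i: "i < n" and j: "j < n" and k: "k < n"
  shows "gauss_integral n m (\<lambda>Z. D Z * \<rho> k Z * \<rho> j Z * \<rho> i Z)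
    = ennreal ((\<nu> + of_bool (i = j) + of_bool (i = k)) * ((\<nu> + of_bool (j = k)) * \<nu>)) * K0"
proof -
  have "gauss_integral n m (\<lambda>Z. (D Z * \<rho> k Z * \<rho> j Z) * \<rho> i Z)
     = ennreal (real m + (- s + of_bool (i = j) + of_bool (i = k))) * gauss_integral n m (\<lambda>Z. D Z * \<rho> k Z * \<rho> j Z)"
  proof (rule gauss_integral_mult_row_energy[OF i])
    show "D (columnwise n m (row_scaling n i c) Z) * \<rho> k (columnwise n m (row_scaling n i c) Z) * \<rho> j (columnwise n m (row_scaling n i c) Z)
        = c powr (2 * (- s + of_bool (i = j) + of_bool (i = k))) * (D Z * \<rho> k Z * \<rho> j Z)" if "0 < c" for c Z
      unfolding D_scale[OF that i] row_energy_row_scaling[OF j] row_energy_row_scaling[OF k] scale_exponent[OF that]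
      by (cases "i = j"; cases "i = k") auto
  qed (use i j k s_less in \<open>auto simp: gram_det_eq_0[OF i] row_energy_nonneg\<close>)
  moreover have "real m + (- s + of_bool (i = j) + of_bool (i = k)) = \<nu> + of_bool (i = j) + of_bool (i = k)" by (simp add: \<nu>_def)
  moreover have "ennreal (\<nu> + of_bool (i = j) + of_bool (i = k)) * (ennreal ((\<nu> + of_bool (j = k)) * \<nu>) * K0)
     = ennreal ((\<nu> + of_bool (i = j) + of_bool (i = k)) * ((\<nu> + of_bool (j = k)) * \<nu>)) * K0"
    using nu_pos by (simp add: ennreal_mult mult.assoc)
  ultimately show ?thesis by (simp only: row_energy_moment2[OF j k])
qed

lemma weighted_energy_moment1:
  assumes y: "\<And>i. i < n \<Longrightarrow> 0 \<le> y i"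
  shows "gauss_integral n m (\<lambda>Z. D Z * weighted_energy n m y Z) = ennreal (\<nu> * (\<Sum>i<n. y i)) * K0"
proof -
  have "gauss_integral n m (\<lambda>Z. \<Sum>i<n. y i * (D Z * \<rho> i Z)) = ennreal (\<Sum>i<n. y i * \<nu>) * K0"
    using y nu_pos by (intro gauss_integral_sum) (auto simp: row_energy_nonneg row_energy_moment1)
  moreover have "(\<Sum>i<n. y i * (D Z * \<rho> i Z)) = D Z * weighted_energy n m y Z" for Z
    by (simp add: weighted_energy_def sum_distrib_left mult_ac)
  moreover have "(\<Sum>i<n. y i * \<nu>) = \<nu> * (\<Sum>i<n. y i)" by (simp add: sum_distrib_left mult.commute)
  ultimately show ?thesis by (simp only:)
qed

lemma sum_mult_of_bool: "i < n \<Longrightarrow> (\<Sum>j<n. f j * of_bool (i = j)) = f i" for f :: "nat \<Rightarrow> real"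
  by (simp add: of_bool_def if_distrib[of "\<lambda>x. _ * x"] cong: if_cong)

lemma weighted_energy_moment2:
  assumes y: "\<And>i. i < n \<Longrightarrow> 0 \<le> y i"
  shows "gauss_integral n m (\<lambda>Z. D Z * weighted_energy n m y Z ^ 2)
     = ennreal (\<nu>\<^sup>2 * (\<Sum>i<n. y i)\<^sup>2 + \<nu> * (\<Sum>i<n. y i ^ 2)) * K0"
proof -
  let ?s = "\<Sum>i<n. y i"
  have s0: "0 \<le> ?s" using y by (intro sum_nonneg) auto
  have in1: "(\<Sum>j<n. y j * ((\<nu> + of_bool (i = j)) * \<nu>)) = \<nu> * (\<nu> * ?s + y i)" if "i < n" for i
  proof -
    have "(\<Sum>j<n. y j * ((\<nu> + of_bool (i = j)) * \<nu>)) = (\<Sum>j<n. \<nu> * \<nu> * y j + \<nu> * (y j * of_bool (i = j)))"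
      by (intro sum.cong) (auto simp: algebra_simps)
    then show ?thesis
      unfolding sum.distrib sum_distrib_left[symmetric] sum_mult_of_bool[OF that] by (simp add: algebra_simps)
  qed
  have "gauss_integral n m (\<lambda>Z. \<Sum>j<n. y j * (D Z * \<rho> j Z * \<rho> i Z)) = ennreal (\<nu> * (\<nu> * ?s + y i)) * K0" if "i < n" for i
    unfolding in1[OF that, symmetric]
    using y nu_pos that by (intro gauss_integral_sum) (auto simp: row_energy_nonneg row_energy_moment2)
  then have "gauss_integral n m (\<lambda>Z. \<Sum>i<n. y i * (\<Sum>j<n. y j * (D Z * \<rho> j Z * \<rho> i Z))) = ennreal (\<Sum>i<n. y i * (\<nu> * (\<nu> * ?s + y i))) * K0"
    using y nu_pos s0 by (intro gauss_integral_sum) (auto intro!: sum_nonneg simp: row_energy_nonneg)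
  moreover have "(\<Sum>i<n. y i * (\<Sum>j<n. y j * (D Z * \<rho> j Z * \<rho> i Z))) = D Z * weighted_energy n m y Z ^ 2" for Z
    by (simp add: weighted_energy_def power2_eq_square sum_distrib_left sum_distrib_right mult_ac)
  moreover have "(\<Sum>i<n. y i * (\<nu> * (\<nu> * ?s + y i))) = \<nu>\<^sup>2 * ?s\<^sup>2 + \<nu> * (\<Sum>i<n. y i ^ 2)"
  proof -
    have "(\<Sum>i<n. y i * (\<nu> * (\<nu> * ?s + y i))) = (\<Sum>i<n. (\<nu>\<^sup>2 * ?s) * y i + \<nu> * y i ^ 2)"
      by (intro sum.cong) (auto simp: algebra_simps power2_eq_square)
    then show ?thesis by (simp add: sum.distrib sum_distrib_left[symmetric] power2_eq_square)
  qed
  ultimately show ?thesis by (simp only:)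
qed

lemma weighted_energy_moment3:
  assumes y: "\<And>i. i < n \<Longrightarrow> 0 \<le> y i"
  shows "gauss_integral n m (\<lambda>Z. D Z * weighted_energy n m y Z ^ 3)
     = ennreal (\<nu>^3 * (\<Sum>i<n. y i)^3 + 3 * \<nu>\<^sup>2 * (\<Sum>i<n. y i) * (\<Sum>i<n. y i ^ 2) + 2 * \<nu> * (\<Sum>i<n. y i ^ 3)) * K0"
proof -
  let ?s = "\<Sum>i<n. y i" and ?t = "\<Sum>i<n. y i ^ 2"
  have s0: "0 \<le> ?s" "0 \<le> ?t" using y by (auto intro!: sum_nonneg)
  \<comment> \<open>The triple sum is evaluated from the inside, one index at a time.\<close>
  have in1: "(\<Sum>k<n. y k * ((\<nu> + of_bool (i = j) + of_bool (i = k)) * ((\<nu> + of_bool (j = k)) * \<nu>)))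
      = \<nu> * (\<nu> + of_bool (i = j)) * (\<nu> * ?s + y j + y i)" if "i < n" "j < n" for i j
  proof -
    have "(\<Sum>k<n. y k * ((\<nu> + of_bool (i = j) + of_bool (i = k)) * ((\<nu> + of_bool (j = k)) * \<nu>)))
       = (\<Sum>k<n. \<nu> * (\<nu> + of_bool (i = j)) * \<nu> * y k + \<nu> * (\<nu> + of_bool (i = j)) * (y k * of_bool (j = k))
           + \<nu> * (\<nu> + of_bool (i = j)) * (y k * of_bool (i = k)))"
      by (intro sum.cong) (auto simp: algebra_simps)
    also have "\<dots> = \<nu> * (\<nu> + of_bool (i = j)) * \<nu> * ?s + \<nu> * (\<nu> + of_bool (i = j)) * y j + \<nu> * (\<nu> + of_bool (i = j)) * y i"
      unfolding sum.distrib sum_distrib_left[symmetric] sum_mult_of_bool[OF that(1)] sum_mult_of_bool[OF that(2)] ..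
    finally show ?thesis by (simp add: algebra_simps)
  qed
  have in2: "(\<Sum>j<n. y j * (\<nu> * (\<nu> + of_bool (i = j)) * (\<nu> * ?s + y j + y i)))
      = \<nu> * (\<nu> * (\<nu> * ?s\<^sup>2 + ?t + y i * ?s) + y i * (\<nu> * ?s + 2 * y i))" if "i < n" for i
  proof -
    have "(\<Sum>j<n. y j * (\<nu> * (\<nu> + of_bool (i = j)) * (\<nu> * ?s + y j + y i)))
      = (\<Sum>j<n. \<nu>\<^sup>2 * (\<nu> * ?s + y i) * y j + \<nu>\<^sup>2 * y j ^ 2 + \<nu> * ((y j * (\<nu> * ?s + 2 * y i)) * of_bool (i = j)))"
      by (intro sum.cong) (auto simp: algebra_simps power2_eq_square)
    also have "\<dots> = \<nu>\<^sup>2 * (\<nu> * ?s + y i) * ?s + \<nu>\<^sup>2 * ?t + \<nu> * (y i * (\<nu> * ?s + 2 * y i))"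
      unfolding sum.distrib sum_distrib_left[symmetric] sum_mult_of_bool[OF that] ..
    finally show ?thesis by (simp add: algebra_simps power2_eq_square)
  qed
  have in3: "(\<Sum>i<n. y i * (\<nu> * (\<nu> * (\<nu> * ?s\<^sup>2 + ?t + y i * ?s) + y i * (\<nu> * ?s + 2 * y i))))
     = \<nu>^3 * ?s^3 + 3 * \<nu>\<^sup>2 * ?s * ?t + 2 * \<nu> * (\<Sum>i<n. y i ^ 3)"
  proof -
    have "(\<Sum>i<n. y i * (\<nu> * (\<nu> * (\<nu> * ?s\<^sup>2 + ?t + y i * ?s) + y i * (\<nu> * ?s + 2 * y i))))
      = (\<Sum>i<n. \<nu>\<^sup>2 * (\<nu> * ?s\<^sup>2 + ?t) * y i + 2 * \<nu>\<^sup>2 * ?s * y i ^ 2 + 2 * \<nu> * y i ^ 3)"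
      by (intro sum.cong) (auto simp: algebra_simps power2_eq_square power3_eq_cube)
    also have "\<dots> = \<nu>\<^sup>2 * (\<nu> * ?s\<^sup>2 + ?t) * ?s + 2 * \<nu>\<^sup>2 * ?s * ?t + 2 * \<nu> * (\<Sum>i<n. y i ^ 3)"
      by (simp add: sum.distrib sum_distrib_left[symmetric])
    finally show ?thesis by (simp add: algebra_simps power2_eq_square power3_eq_cube)
  qed
  have pos1: "0 \<le> \<nu> * (\<nu> + of_bool (i = j)) * (\<nu> * ?s + y j + y i)" if "i < n" "j < n" for i j
    using y that nu_pos s0 by (intro mult_nonneg_nonneg add_nonneg_nonneg) auto
  have pos2: "0 \<le> \<nu> * (\<nu> * (\<nu> * ?s\<^sup>2 + ?t + y i * ?s) + y i * (\<nu> * ?s + 2 * y i))" if "i < n" for i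
    using y that nu_pos s0 by (intro mult_nonneg_nonneg add_nonneg_nonneg) auto
  have pos0: "0 \<le> (\<nu> + of_bool (i = j) + of_bool (i = k)) * ((\<nu> + of_bool (j = k)) * \<nu>)" for i j k :: nat
    using nu_pos by (intro mult_nonneg_nonneg add_nonneg_nonneg) auto
  have "gauss_integral n m (\<lambda>Z. \<Sum>k<n. y k * (D Z * \<rho> k Z * \<rho> j Z * \<rho> i Z)) = ennreal (\<nu> * (\<nu> + of_bool (i = j)) * (\<nu> * ?s + y j + y i)) * K0"
    if ij: "i < n" "j < n" for i j
    unfolding in1[OF ij, symmetric]
    using y ij pos0 by (intro gauss_integral_sum row_energy_moment3) (auto simp: row_energy_nonneg)
  then have "gauss_integral n m (\<lambda>Z. \<Sum>j<n. y j * (\<Sum>k<n. y k * (D Z * \<rho> k Z * \<rho> j Z * \<rho> i Z)))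
     = ennreal (\<nu> * (\<nu> * (\<nu> * ?s\<^sup>2 + ?t + y i * ?s) + y i * (\<nu> * ?s + 2 * y i))) * K0" if i: "i < n" for i
    unfolding in2[OF i, symmetric]
    using y i pos1 by (intro gauss_integral_sum) (auto intro!: sum_nonneg simp: row_energy_nonneg)
  then have "gauss_integral n m (\<lambda>Z. \<Sum>i<n. y i * (\<Sum>j<n. y j * (\<Sum>k<n. y k * (D Z * \<rho> k Z * \<rho> j Z * \<rho> i Z))))
     = ennreal (\<nu>^3 * ?s^3 + 3 * \<nu>\<^sup>2 * ?s * ?t + 2 * \<nu> * (\<Sum>i<n. y i ^ 3)) * K0"
    unfolding in3[symmetric]
    using y pos2 by (intro gauss_integral_sum) (auto intro!: sum_nonneg mult_nonneg_nonneg simp: row_energy_nonneg)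
  moreover have "(\<Sum>i<n. y i * (\<Sum>j<n. y j * (\<Sum>k<n. y k * (D Z * \<rho> k Z * \<rho> j Z * \<rho> i Z)))) = D Z * weighted_energy n m y Z ^ 3" for Z
    by (simp add: weighted_energy_def power3_eq_cube sum_distrib_left sum_distrib_right mult_ac)
  ultimately show ?thesis by (simp only:)
qed

end

section \<open>Moments of the normalized trace\<close>

lemma nn_integral_PiM_density:
  fixes N :: "'b measure" and g :: "'b \<Rightarrow> ennreal"
  assumes N: "sigma_finite_measure N" and g[measurable]: "g \<in> borel_measurable N"
    and sf: "sigma_finite_measure (density N g)"
    and f: "f \<in> borel_measurable (PiM {..<m} (\<lambda>_. N))"
  shows "(\<integral>\<^sup>+x. f x \<partial>PiM {..<m::nat} (\<lambda>_. density N g)) = (\<integral>\<^sup>+x. f x * (\<Prod>r<m. g (x r)) \<partial>PiM {..<m} (\<lambda>_. N))"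
  using f
proof (induction m arbitrary: f)
  case 0
  interpret N: sigma_finite_measure N by (rule N)
  interpret D: sigma_finite_measure "density N g" by (rule sf)
  interpret P: product_sigma_finite "\<lambda>_::nat. N" by unfold_locales
  interpret Q: product_sigma_finite "\<lambda>_::nat. density N g" by unfold_locales
  show ?case unfolding lessThan_0
    by (subst P.nn_integral_empty, simp, subst Q.nn_integral_empty) simp_all
next
  case (Suc m)
  let ?P = "\<lambda>k. PiM {..<k::nat} (\<lambda>_. N)" and ?Q = "\<lambda>k. PiM {..<k::nat} (\<lambda>_. density N g)"
  interpret N: sigma_finite_measure N by (rule N)
  note f = Suc.prems
  have sets: "sets (?Q k) = sets (?P k)" for k by (rule sets_PiM_cong) auto
  have f': "f \<in> borel_measurable (?Q (Suc m))" using f measurable_cong_sets[OF sets refl] by blast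
  have comp: "(\<lambda>x. g (x r)) \<in> borel_measurable (?P k)" if "r < k" for r k
    by (rule measurable_compose[OF measurable_component_singleton[of r "{..<k}" "\<lambda>_. N"] g]) (use that in simp)
  have gp: "(\<lambda>x. \<Prod>r<k. g (x r)) \<in> borel_measurable (?P k)" for k
    by (intro borel_measurable_prod_ennreal comp) simp
  have fu: "(\<lambda>p. f ((fst p)(m := snd p))) \<in> borel_measurable (?P m \<Otimes>\<^sub>M N)"
    by (rule measurable_compose[OF measurable_fun_upd_Suc f]) simp_all
  have h: "(\<lambda>X. \<integral>\<^sup>+u. g u * f (X(m := u)) \<partial>N) \<in> borel_measurable (?P m)"
  proof (rule N.borel_measurable_nn_integral)
    show "(\<lambda>(X, u). g u * f (X(m := u))) \<in> borel_measurable (?P m \<Otimes>\<^sub>M N)"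
      unfolding case_prod_beta by (intro borel_measurable_times_ennreal fu measurable_compose[OF measurable_snd g])
  qed
  have fX: "(\<lambda>u. f (X(m := u))) \<in> borel_measurable N" if "X \<in> space (?P m)" for X
    by (rule measurable_compose[OF measurable_fun_upd_Suc f]) (use that in auto)
  have sp: "space (?Q m) = space (?P m)" using sets_eq_imp_space_eq[OF sets] .
  have "(\<integral>\<^sup>+x. f x \<partial>?Q (Suc m)) = (\<integral>\<^sup>+X. \<integral>\<^sup>+u. f (X(m := u)) \<partial>density N g \<partial>?Q m)"
    by (rule nn_integral_PiM_Suc[OF sf f'])
  also have "\<dots> = (\<integral>\<^sup>+X. \<integral>\<^sup>+u. g u * f (X(m := u)) \<partial>N \<partial>?Q m)"
    by (intro nn_integral_cong nn_integral_density fX g) (simp add: sp)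
  also have "\<dots> = (\<integral>\<^sup>+X. (\<integral>\<^sup>+u. g u * f (X(m := u)) \<partial>N) * (\<Prod>r<m. g (X r)) \<partial>?P m)"
    by (rule Suc.IH[OF h])
  also have "\<dots> = (\<integral>\<^sup>+X. \<integral>\<^sup>+u. f (X(m := u)) * (\<Prod>r<Suc m. g ((X(m := u)) r)) \<partial>N \<partial>?P m)"
  proof (rule nn_integral_cong)
    fix X assume X: "X \<in> space (?P m)"
    have "(\<integral>\<^sup>+u. g u * f (X(m := u)) \<partial>N) * (\<Prod>r<m. g (X r)) = (\<integral>\<^sup>+u. g u * f (X(m := u)) * (\<Prod>r<m. g (X r)) \<partial>N)"
      by (rule nn_integral_multc[symmetric]) (intro borel_measurable_times_ennreal fX[OF X] g)
    also have "\<dots> = (\<integral>\<^sup>+u. f (X(m := u)) * (\<Prod>r<Suc m. g ((X(m := u)) r)) \<partial>N)"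
      by (intro nn_integral_cong) (simp add: mult_ac)
    finally show "(\<integral>\<^sup>+u. g u * f (X(m := u)) \<partial>N) * (\<Prod>r<m. g (X r)) = (\<integral>\<^sup>+u. f (X(m := u)) * (\<Prod>r<Suc m. g ((X(m := u)) r)) \<partial>N)" .
  qed
  also have "\<dots> = (\<integral>\<^sup>+x. f x * (\<Prod>r<Suc m. g (x r)) \<partial>?P (Suc m))"
    by (rule nn_integral_PiM_Suc[OF N, symmetric]) (intro borel_measurable_times_ennreal f gp)
  finally show ?case .
qed

lemma scalar_prod_mat_adjoint:
  fixes A :: "complex mat"
  assumes A: "A \<in> carrier_mat n n" and x: "x \<in> carrier_vec n" and v: "v \<in> carrier_vec n"
  shows "x \<bullet>c (A *\<^sub>v v) = (mat_adjoint A *\<^sub>v x) \<bullet>c v"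
proof -
  have "x \<bullet>c (A *\<^sub>v v) = (\<Sum>i<n. x $ i * cnj (\<Sum>j<n. A $$ (i,j) * v $ j))"
    using A x v by (simp add: scalar_prod_def atLeast0LessThan)
  also have "\<dots> = (\<Sum>i<n. \<Sum>j<n. cnj (A $$ (i,j)) * x $ i * cnj (v $ j))"
    by (simp add: sum_distrib_left mult_ac)
  also have "\<dots> = (\<Sum>j<n. (\<Sum>i<n. mat_adjoint A $$ (j,i) * x $ i) * cnj (v $ j))"
    by (subst sum.swap) (auto simp: sum_distrib_right mat_adjoint_index[OF A] intro!: sum.cong)
  also have "\<dots> = (mat_adjoint A *\<^sub>v x) \<bullet>c v"
    using A x v by (simp add: scalar_prod_def atLeast0LessThan)
  finally show ?thesis .
qed

lemma vec_affine_map: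
  assumes "A \<in> carrier_mat n n"
  shows "vec n (affine_map n A (\<lambda>_. 0) z) = A *\<^sub>v vec n z"
  by (rule eq_vecI) (use assms in \<open>auto simp: affine_map_def scalar_prod_def atLeast0LessThan\<close>)

text \<open>
  With \<open>S = A A\<^sup>*\<close> the quadratic form \<open>x\<^sup>* S\<^sup>-\<^sup>1 x\<close> becomes
  \<open>\<bar>z\<bar>\<^sup>2\<close> for \<open>x = A z\<close>.
\<close>

lemma complex_gaussian_density_affine_map:
  assumes A: "A \<in> carrier_mat n n" and det: "Determinant.det A \<noteq> 0"
  shows "complex_gaussian_density n (gram A) (affine_map n A (\<lambda>_. 0) z)
    = exp (- (\<Sum>i<n. (cmod (z i))\<^sup>2)) / (pi ^ n * (cmod (Determinant.det A))\<^sup>2)"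
proof -
  have A': "mat_adjoint A \<in> carrier_mat n n" using A by simp
  have S: "gram A \<in> carrier_mat n n" using A by simp
  have detS: "Determinant.det (gram A) = of_real ((cmod (Determinant.det A))\<^sup>2)"
  proof -
    have "Determinant.det (gram A) = Determinant.det A * cnj (Determinant.det A)"
      unfolding gram_def by (simp add: det_mult[OF A A'] det_mat_adjoint[OF A])
    then show ?thesis by (simp only: complex_norm_square)
  qed
  then have "Determinant.det (gram A) \<noteq> 0" using det by simp
  then have U: "gram A \<in> Units (ring_mat TYPE(complex) n ())" by (rule det_non_zero_imp_unit[OF S])
  then have "mat_inverse (gram A) \<noteq> None" using mat_inverse(1)[OF S, of "()"] by blast
  then obtain B where Bi: "mat_inverse (gram A) = Some B" by auto
  then have B: "gram A * B = 1\<^sub>m n" "B \<in> carrier_mat n n" using mat_inverse(2)[OF S Bi] by auto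
  have "A * (mat_adjoint A * B) = 1\<^sub>m n"
    using B(1) assoc_mult_mat[OF A A' B(2)] by (simp add: gram_def)
  from mat_mult_left_right_inverse[OF A mult_carrier_mat[OF A' B(2)] this]
  have AB: "mat_adjoint A * B * A = 1\<^sub>m n" .
  let ?v = "vec n z"
  have v: "?v \<in> carrier_vec n" by simp
  have Av: "A *\<^sub>v ?v \<in> carrier_vec n" by (rule mult_mat_vec_carrier[OF A v])
  have "(B *\<^sub>v (A *\<^sub>v ?v)) \<bullet>c (A *\<^sub>v ?v) = (mat_adjoint A *\<^sub>v (B *\<^sub>v (A *\<^sub>v ?v))) \<bullet>c ?v"
    by (rule scalar_prod_mat_adjoint[OF A mult_mat_vec_carrier[OF B(2) Av] v])
  also have "mat_adjoint A *\<^sub>v (B *\<^sub>v (A *\<^sub>v ?v)) = (mat_adjoint A * B * A) *\<^sub>v ?v"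
    by (simp only: assoc_mult_mat_vec[OF A' B(2) Av] assoc_mult_mat_vec[OF mult_carrier_mat[OF A' B(2)] A v])
  also have "\<dots> = ?v" unfolding AB by (rule one_mult_mat_vec[OF v])
  also have "?v \<bullet>c ?v = of_real (\<Sum>i<n. (cmod (z i))\<^sup>2)"
    unfolding of_real_sum complex_norm_square by (simp add: scalar_prod_def atLeast0LessThan)
  finally show ?thesis
    unfolding complex_gaussian_density_def Bi vec_affine_map[OF A] detS by (simp only: option.sel Re_complex_of_real)
qed

text \<open>
  A matrix with independent columns of covariance \<open>A A\<^sup>*\<close> is distributed like
  \<open>A Z\<close>, where the entries of \<open>Z\<close> are independent standard Gaussian variables. The
  Jacobian \<open>\<bar>det A\<bar> ^ (2 * m)\<close> of the substitution cancels the determinants in the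
  \<open>m\<close> densities.
\<close>

lemma nn_integral_iid_gaussian_columns:
  assumes M: "prob_space M" and X: "iid_gaussian_columns M n m (gram A) X"
    and A: "A \<in> carrier_mat n n" "Determinant.det A \<noteq> 0" and m: "0 < m"
    and F[measurable]: "(\<lambda>Z. F (to_mat n m Z)) \<in> borel_measurable (cmat_space n m)" and F0: "\<And>B. 0 \<le> F B"
  shows "(\<lambda>\<omega>. F (X \<omega>)) \<in> borel_measurable M"
    and "(\<integral>\<^sup>+\<omega>. ennreal (F (X \<omega>)) \<partial>M) = ennreal (1 / pi ^ (n * m)) * gauss_integral n m (\<lambda>Z. F (A * to_mat n m Z))"
proof -
  interpret prob_space M by fact
  let ?col = "random_column n X"
  let ?g = "\<lambda>z. ennreal (complex_gaussian_density n (gram A) z)"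
  define a where "a = (cmod (Determinant.det A))\<^sup>2"
  have a: "a > 0" using A(2) by (simp add: a_def)
  have carr: "X \<omega> \<in> carrier_mat n m" if "\<omega> \<in> space M" for \<omega>
    using X that by (auto simp: iid_gaussian_columns_def)
  have ind: "indep_vars (\<lambda>_. cvec_space n) ?col {..<m}" using X by (auto simp: iid_gaussian_columns_def)
  have dis: "distributed M (cvec_space n) (?col r) ?g" if "r < m" for r
    using X that by (auto simp: iid_gaussian_columns_def complex_gaussian_def)
  have rv: "?col r \<in> measurable M (cvec_space n)" if "r < m" for r using dis[OF that] by (rule distributed_measurable)
  have g: "?g \<in> borel_measurable (cvec_space n)" using dis[OF m] by (rule distributed_borel_measurable)
  have dd: "distr M (cvec_space n) (?col r) = density (cvec_space n) ?g" if "r < m" for r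
    using dis[OF that] by (rule distributed_distr_eq_density)
  \<comment> \<open>The density is a probability density because it is the law of a column, of which there is at least one.\<close>
  have sf: "sigma_finite_measure (density (cvec_space n) ?g)"
  proof -
    have "prob_space (density (cvec_space n) ?g)" unfolding dd[OF m, symmetric] by (rule prob_space_distr[OF rv[OF m]])
    then show ?thesis by (simp add: prob_space_imp_sigma_finite)
  qed
  define Y where "Y \<omega> = (\<lambda>r\<in>{..<m}. ?col r \<omega>)" for \<omega>
  have Y: "Y \<in> measurable M (cmat_space n m)" unfolding Y_def by (rule measurable_restrict) (simp add: rv)
  have XY: "X \<omega> = to_mat n m (Y \<omega>)" if "\<omega> \<in> space M" for \<omega>
    by (rule eq_matI) (use carr[OF that] in \<open>auto simp: to_mat_def Y_def random_column_def\<close>)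
  have "(\<lambda>\<omega>. F (to_mat n m (Y \<omega>))) \<in> borel_measurable M" by (rule measurable_compose[OF Y F])
  then show "(\<lambda>\<omega>. F (X \<omega>)) \<in> borel_measurable M"
    by (subst measurable_cong[of M _ "\<lambda>\<omega>. F (to_mat n m (Y \<omega>))"]) (simp_all add: XY)
  have distrY: "distr M (cmat_space n m) Y = PiM {..<m} (\<lambda>_. density (cvec_space n) ?g)"
  proof -
    have "distr M (cmat_space n m) Y = PiM {..<m} (\<lambda>r. distr M (cvec_space n) (?col r))"
      unfolding Y_def using indep_vars_iff_distr_eq_PiM'[of "{..<m}" ?col "\<lambda>_. cvec_space n"] ind rv m by auto
    also have "\<dots> = PiM {..<m} (\<lambda>_. density (cvec_space n) ?g)"
      by (rule PiM_cong) (auto simp: dd)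
    finally show ?thesis .
  qed
  have [measurable]: "(\<lambda>Z. ennreal (F (to_mat n m Z))) \<in> borel_measurable (cmat_space n m)" by measurable
  have gp: "(\<lambda>Z. \<Prod>r<m. ?g (Z r)) \<in> borel_measurable (cmat_space n m)"
    by (intro borel_measurable_prod_ennreal measurable_compose[OF measurable_component_singleton[of _ "{..<m}" "\<lambda>_. cvec_space n"] g])
  have prod: "(\<Prod>r<m. ?g (columnwise n m A Z r)) = ennreal (1 / a ^ m * (1 / pi ^ (n * m)) * exp (- (\<Sum>k<n. row_energy m Z k)))" for Z
  proof -
    have "(\<Prod>r<m. ?g (columnwise n m A Z r)) = (\<Prod>r<m. ennreal (exp (- (\<Sum>i<n. (cmod (Z r i))\<^sup>2)) / (pi ^ n * a)))"
      by (intro prod.cong refl) (simp add: columnwise_def complex_gaussian_density_affine_map[OF A] a_def)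
    also have "\<dots> = ennreal (\<Prod>r<m. exp (- (\<Sum>i<n. (cmod (Z r i))\<^sup>2)) / (pi ^ n * a))"
      using a by (intro prod_ennreal) auto
    also have "(\<Prod>r<m. exp (- (\<Sum>i<n. (cmod (Z r i))\<^sup>2)) / (pi ^ n * a)) = exp (- (\<Sum>r<m. \<Sum>i<n. (cmod (Z r i))\<^sup>2)) / (pi ^ n * a) ^ m"
      by (simp add: prod_dividef exp_sum[symmetric] sum_negf)
    also have "(\<Sum>r<m. \<Sum>i<n. (cmod (Z r i))\<^sup>2) = (\<Sum>k<n. row_energy m Z k)"
      unfolding row_energy_def by (rule sum.swap)
    also have "(pi ^ n * a) ^ m = a ^ m * pi ^ (n * m)" by (simp add: power_mult_distrib power_mult)
    finally show ?thesis by simp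
  qed
  have "(\<integral>\<^sup>+\<omega>. ennreal (F (X \<omega>)) \<partial>M) = (\<integral>\<^sup>+\<omega>. ennreal (F (to_mat n m (Y \<omega>))) \<partial>M)"
    by (intro nn_integral_cong) (simp add: XY)
  also have "\<dots> = (\<integral>\<^sup>+Z. ennreal (F (to_mat n m Z)) \<partial>distr M (cmat_space n m) Y)"
    by (rule nn_integral_distr[symmetric, OF Y]) measurable
  also have "\<dots> = (\<integral>\<^sup>+Z. ennreal (F (to_mat n m Z)) * (\<Prod>r<m. ?g (Z r)) \<partial>cmat_space n m)"
    unfolding distrY by (rule nn_integral_PiM_density[OF sigma_finite_cvec_space g sf]) measurable
  also have "\<dots> = ennreal (a ^ m) * (\<integral>\<^sup>+Z. ennreal (F (to_mat n m (columnwise n m A Z))) * (\<Prod>r<m. ?g (columnwise n m A Z r)) \<partial>cmat_space n m)"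
    unfolding a_def by (rule nn_integral_columnwise[OF A, symmetric]) (intro borel_measurable_times_ennreal gp, measurable)
  also have "\<dots> = ennreal (a ^ m) * (\<integral>\<^sup>+Z. ennreal (1 / a ^ m * (1 / pi ^ (n * m))) * ennreal (F (A * to_mat n m Z) * exp (- (\<Sum>k<n. row_energy m Z k))) \<partial>cmat_space n m)"
    unfolding to_mat_columnwise[OF A(1)] prod using F0 a
    by (intro arg_cong[of _ _ "\<lambda>x. ennreal (a ^ m) * x"] nn_integral_cong) (simp add: ennreal_mult[symmetric] mult_ac)
  also have "\<dots> = ennreal (a ^ m) * (ennreal (1 / a ^ m * (1 / pi ^ (n * m))) * gauss_integral n m (\<lambda>Z. F (A * to_mat n m Z)))"
  proof -
    have FA: "(\<lambda>Z. F (A * to_mat n m Z)) \<in> borel_measurable (cmat_space n m)"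
      using measurable_compose[OF measurable_columnwise[of n m A] F] unfolding to_mat_columnwise[OF A(1)] .
    have "(\<lambda>Z. ennreal (F (A * to_mat n m Z) * exp (- (\<Sum>k<n. row_energy m Z k)))) \<in> borel_measurable (cmat_space n m)"
      using FA by measurable
    then show ?thesis unfolding gauss_integral_def by (subst nn_integral_cmult) auto
  qed
  also have "\<dots> = (ennreal (a ^ m) * ennreal (1 / a ^ m * (1 / pi ^ (n * m)))) * gauss_integral n m (\<lambda>Z. F (A * to_mat n m Z))"
    by (simp only: mult.assoc)
  also have "ennreal (a ^ m) * ennreal (1 / a ^ m * (1 / pi ^ (n * m))) = ennreal (1 / pi ^ (n * m))"
    using a by (subst ennreal_mult[symmetric]) auto
  finally show "(\<integral>\<^sup>+\<omega>. ennreal (F (X \<omega>)) \<partial>M) = ennreal (1 / pi ^ (n * m)) * gauss_integral n m (\<lambda>Z. F (A * to_mat n m Z))" .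
qed

text \<open>
  Take \<open>A = U D\<close> with the unitary \<open>U\<close> and the diagonal matrix \<open>D\<close> of the
  square roots of the eigenvalues, not the Hermitian square root: then \<open>A\<^sup>* A\<close> is diagonal. The
  eigenvalues are at least \<open>N0\<close>, since in the eigenbasis \<open>S\<close> is a Gram matrix plus
  \<open>N0\<close> times the identity.
\<close>

lemma covariance_square_root:
  assumes H: "H \<in> carrier_mat n k" and N0: "0 < N0"
    and S: "S = gram H + complex_of_real N0 \<cdot>\<^sub>m 1\<^sub>m n" and y: "eigenvalue_list n S y"
  obtains A where "A \<in> carrier_mat n n" "gram A = S" "mat_adjoint A * A = diag_of n (\<lambda>i. of_real (y i))" "\<And>i. i < n \<Longrightarrow> 0 < y i"
proof -
  have G: "gram H \<in> carrier_mat n n" using H by simp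
  have Sc: "S \<in> carrier_mat n n" unfolding S using G by simp
  have Sh: "mat_adjoint S = S"
  proof (rule eq_matI)
    fix i j assume "i < dim_row S" "j < dim_col S"
    then have ij: "i < n" "j < n" using Sc by auto
    have "cnj (gram H $$ (j,i)) = gram H $$ (i,j)"
      using mat_adjoint_index[OF G ij] gram_hermitian[OF H] by simp
    then show "mat_adjoint S $$ (i,j) = S $$ (i,j)"
      using ij G Sc by (simp add: mat_adjoint_index[OF Sc]) (simp add: S)
  qed (use Sc in auto)
  have cp: "char_poly S = (\<Prod>i<n. [:- complex_of_real (y i), 1:])" using y by (simp add: eigenvalue_list_def)
  obtain U where U: "U \<in> carrier_mat n n" "mat_adjoint U * U = 1\<^sub>m n" and SU: "S = U * diag_of n (\<lambda>i. of_real (y i)) * mat_adjoint U"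
    using hermitian_unitarily_diagonalizable[OF Sc Sh cp] by blast
  let ?D = "diag_of n (\<lambda>i. complex_of_real (y i))"
  have U': "mat_adjoint U \<in> carrier_mat n n" using U by simp
  have D: "?D = mat_adjoint U * S * U" by (rule unitary_conjugation[OF U _ SU, symmetric]) simp
  have c1: "complex_of_real N0 \<cdot>\<^sub>m 1\<^sub>m n \<in> carrier_mat n n" by simp
  have "mat_adjoint U * S * U = mat_adjoint U * gram H * U + mat_adjoint U * (complex_of_real N0 \<cdot>\<^sub>m 1\<^sub>m n) * U"
    unfolding S mult_add_distrib_mat[OF U' G c1]
    by (rule add_mult_distrib_mat[OF mult_carrier_mat[OF U' G] mult_carrier_mat[OF U' c1] U(1)])
  also have "mat_adjoint U * gram H * U = gram (mat_adjoint U * H)"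
    using gram_mult[OF U' H] by simp
  also have "mat_adjoint U * (complex_of_real N0 \<cdot>\<^sub>m 1\<^sub>m n) * U = complex_of_real N0 \<cdot>\<^sub>m 1\<^sub>m n"
    using U U' by (simp add: mult_smult_distrib[of _ n n _ n] mult_smult_assoc_mat[of _ n n _ n])
  finally have D': "?D = gram (mat_adjoint U * H) + complex_of_real N0 \<cdot>\<^sub>m 1\<^sub>m n" using D by simp
  have y0: "0 < y i" if i: "i < n" for i
  proof -
    have c: "mat_adjoint U * H \<in> carrier_mat n k" by (rule mult_carrier_mat[OF U' H])
    have "complex_of_real (y i) = ?D $$ (i,i)" using i by (simp add: diag_of_def)
    also have "\<dots> = gram (mat_adjoint U * H) $$ (i,i) + of_real N0"
      unfolding D' using i gram_carrier[OF c] by simp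
    also have "gram (mat_adjoint U * H) $$ (i,i) = of_real (\<Sum>r<k. (cmod ((mat_adjoint U * H) $$ (i,r)))\<^sup>2)"
      by (rule gram_diag_index[OF c i])
    finally have "complex_of_real (y i) = complex_of_real ((\<Sum>r<k. (cmod ((mat_adjoint U * H) $$ (i,r)))\<^sup>2) + N0)" by simp
    then have "y i = (\<Sum>r<k. (cmod ((mat_adjoint U * H) $$ (i,r)))\<^sup>2) + N0" by (simp only: of_real_eq_iff)
    then show ?thesis using N0 by (smt (verit) sum_nonneg zero_le_power2)
  qed
  let ?R = "diag_of n (\<lambda>i. complex_of_real (sqrt (y i)))"
  have Rc: "?R \<in> carrier_mat n n" by simp
  have R': "mat_adjoint ?R = ?R" by (simp add: mat_adjoint_diag_of)
  have RR: "?R * ?R = ?D"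
    unfolding diag_of_mult using y0 by (auto simp: diag_of_def abs_of_pos simp flip: of_real_mult intro!: eq_matI)
  define A where "A = U * ?R"
  have A: "A \<in> carrier_mat n n" unfolding A_def by (rule mult_carrier_mat[OF U(1) Rc])
  have Aadj: "mat_adjoint A = ?R * mat_adjoint U" unfolding A_def mat_adjoint_mult[OF U(1) Rc] R' ..
  have "gram A = U * (?R * ?R) * mat_adjoint U"
    unfolding gram_def Aadj unfolding A_def using U(1) U' Rc
    by (simp add: assoc_mult_mat[of _ n n _ n _ n] mult_carrier_mat[of _ n n _ n] del: diag_of_mult)
  then have "gram A = S" unfolding RR SU[symmetric] .
  moreover have "mat_adjoint A * A = ?R * (mat_adjoint U * U) * ?R"
    unfolding Aadj unfolding A_def using U(1) U' Rc
    by (simp add: assoc_mult_mat[of _ n n _ n _ n] mult_carrier_mat[of _ n n _ n])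
  then have "mat_adjoint A * A = ?D" unfolding U(2) using RR Rc by simp
  ultimately show ?thesis using that[OF A _ _ y0] by blast
qed

lemma powr_power_nat:
  fixes x u :: real
  shows "0 < p \<Longrightarrow> (x powr u) ^ p = x powr (u * real p)"
proof (induction p)
  case (Suc p)
  then show ?case by (cases "p = 0") (simp_all add: powr_add[symmetric] ring_distribs)
qed simp

text \<open>
  The determinant of \<open>(A Z)(A Z)\<^sup>*\<close> is \<open>\<Prod> y\<^sub>i\<close> times the Gram
  determinant of \<open>Z\<close>, and its trace is the trace of \<open>Z Z\<^sup>* (A\<^sup>* A)\<close>, in
  which \<open>A\<^sup>* A\<close> is diagonal: only the energies of the rows of \<open>Z\<close> remain.
\<close>

lemma W1_mult_square_root:
  assumes A: "A \<in> carrier_mat n n" and AA: "mat_adjoint A * A = diag_of n (\<lambda>i. of_real (y i))"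
    and y: "\<And>i. i < n \<Longrightarrow> 0 < y i" and n: "0 < n"
  shows "Determinant.det A \<noteq> 0"
    and "0 < p \<Longrightarrow> W1 n (A * to_mat n m Z) ^ p
      = (Psi1 n y / real n) ^ p * (gram_det n m Z powr (- (real p / real n)) * weighted_energy n m y Z ^ p)"
proof -
  let ?B = "to_mat n m Z"
  have A': "mat_adjoint A \<in> carrier_mat n n" using A by simp
  have B: "?B \<in> carrier_mat n m" by simp
  have gB: "gram ?B \<in> carrier_mat n n" by (rule gram_carrier[OF B])
  have P: "(\<Prod>i<n. y i) > 0" using y by (intro prod_pos) auto
  have "cnj (Determinant.det A) * Determinant.det A = of_real (\<Prod>i<n. y i)"
    using det_mult[OF A' A] unfolding AA det_diag_of by (simp add: det_mat_adjoint[OF A])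
  then have "complex_of_real ((cmod (Determinant.det A))\<^sup>2) = of_real (\<Prod>i<n. y i)"
    by (simp only: complex_norm_square mult.commute)
  then have detA: "(cmod (Determinant.det A))\<^sup>2 = (\<Prod>i<n. y i)" by (simp only: of_real_eq_iff)
  then show "Determinant.det A \<noteq> 0" using P by (metis norm_zero zero_power2 less_irrefl)
  assume p: "0 < p"
  let ?g = "gram_det n m Z"
  have g0: "0 \<le> ?g" by (rule gram_det_nonneg)
  have det: "Re (Determinant.det (gram (A * ?B))) = (\<Prod>i<n. y i) * ?g"
  proof -
    have "Re (of_real x * z) = x * Re z" for x z by simp
    then show ?thesis unfolding det_gram_mult[OF A B] detA gram_det_def .
  qed
  have tr: "Re (\<Sum>i<n. gram (A * ?B) $$ (i,i)) = weighted_energy n m y Z"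
  proof -
    have "(\<Sum>i<n. gram (A * ?B) $$ (i,i)) = (\<Sum>i<n. (A * (gram ?B * mat_adjoint A)) $$ (i,i))"
      unfolding gram_mult[OF A B] by (simp only: assoc_mult_mat[OF A gB A'])
    also have "\<dots> = (\<Sum>i<n. (gram ?B * mat_adjoint A * A) $$ (i,i))"
      by (rule sum_diag_mult_commute[OF A mult_carrier_mat[OF gB A']])
    also have "gram ?B * mat_adjoint A * A = gram ?B * diag_of n (\<lambda>i. of_real (y i))"
      unfolding AA[symmetric] by (rule assoc_mult_mat[OF gB A' A])
    also have "(\<Sum>i<n. (gram ?B * diag_of n (\<lambda>i. of_real (y i))) $$ (i,i)) = (\<Sum>i<n. of_real (y i * row_energy m Z i))"
    proof (rule sum.cong)
      fix i assume "i \<in> {..<n}"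
      then have i: "i < n" by simp
      have "(gram ?B * diag_of n (\<lambda>i. of_real (y i))) $$ (i,i) = (\<Sum>l<n. gram ?B $$ (i,l) * diag_of n (\<lambda>i. of_real (y i)) $$ (l,i))"
        by (rule index_mult_sum[OF gB _ i i]) simp
      also have "\<dots> = (\<Sum>l<n. if l = i then gram ?B $$ (i,i) * of_real (y i) else 0)"
        using i by (intro sum.cong) (auto simp: diag_of_def)
      also have "\<dots> = gram ?B $$ (i,i) * of_real (y i)" using i by simp
      also have "gram ?B $$ (i,i) = of_real (row_energy m Z i)" by (rule gram_to_mat_diag[OF i])
      finally show "(gram ?B * diag_of n (\<lambda>i. of_real (y i))) $$ (i,i) = of_real (y i * row_energy m Z i)" by simp
    qed simp
    finally show ?thesis by (simp add: weighted_energy_def)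
  qed
  have Psi: "Psi1 n y ^ p = (\<Prod>i<n. y i) powr (- (real p / real n))"
  proof -
    have "Psi1 n y = (\<Prod>i<n. y i) powr (- 1 / real n)"
      unfolding Psi1_def using y by (intro prod_powr_distrib[symmetric])
    then show ?thesis by (simp add: powr_power_nat[OF p])
  qed
  have "(((\<Prod>i<n. y i) * ?g) powr (1 / real n)) ^ p = ((\<Prod>i<n. y i) * ?g) powr (real p / real n)"
    by (simp add: powr_power_nat[OF p])
  also have "\<dots> = (\<Prod>i<n. y i) powr (real p / real n) * ?g powr (real p / real n)" by (rule powr_mult)
  finally have pw: "(((\<Prod>i<n. y i) * ?g) powr (1 / real n)) ^ p = (\<Prod>i<n. y i) powr (real p / real n) * ?g powr (real p / real n)" .
  have "W1 n (A * ?B) ^ p = (1 / real n * weighted_energy n m y Z) ^ p / (((\<Prod>i<n. y i) * ?g) powr (1 / real n)) ^ p"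
    unfolding W1_def det tr by (rule power_divide)
  also have "\<dots> = (Psi1 n y / real n) ^ p * (?g powr (- (real p / real n)) * weighted_energy n m y Z ^ p)"
    unfolding pw power_divide power_mult_distrib Psi powr_minus by (simp add: divide_inverse mult_ac)
  finally show "W1 n (A * to_mat n m Z) ^ p
      = (Psi1 n y / real n) ^ p * (gram_det n m Z powr (- (real p / real n)) * weighted_energy n m y Z ^ p)" .
qed

lemma measurable_W1: "(\<lambda>Z. W1 n (to_mat n m Z)) \<in> borel_measurable (cmat_space n m)"
proof -
  have "W1 n (to_mat n m Z) = (1 / real n * (\<Sum>i<n. row_energy m Z i)) / gram_det n m Z powr (1 / real n)" for Z
    by (simp add: W1_def gram_det_def Re_sum gram_to_mat_diag)
  then show ?thesis by simp
qed

lemma W1_nonneg: "A \<in> carrier_mat n m \<Longrightarrow> 0 \<le> W1 n A"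
  by (simp add: W1_def Re_sum gram_diag_index sum_nonneg del: of_real_sum)

text \<open>
  The moment is a product of three factors: a power of \<open>Psi1\<close>, the negative moment of the Gram
  determinant, and the moment \<open>e\<close> of the weighted energy under the weight
  \<open>gram_det powr (- p / n)\<close>. The facts about \<open>e\<close> may use that the
  \<open>y i\<close> are positive, which is a consequence of the other hypotheses.
\<close>

lemma moment_W1:
  assumes M: "prob_space M" and X: "iid_gaussian_columns M n m S X"
    and H: "H \<in> carrier_mat n k" and N0: "0 < N0"
    and S: "S = gram H + complex_of_real N0 \<cdot>\<^sub>m 1\<^sub>m n" and y: "eigenvalue_list n S y"
    and n: "0 < n" "n \<le> m" and p: "0 < p" "real p / real n < real m - real n + 1"
    and e: "(\<And>i. i < n \<Longrightarrow> 0 < y i) \<Longrightarrow>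
      gauss_integral n m (\<lambda>Z. gram_det n m Z powr (- (real p / real n)) * weighted_energy n m y Z ^ p)
      = ennreal e * gauss_integral n m (\<lambda>Z. gram_det n m Z powr (- (real p / real n)))" "(\<And>i. i < n \<Longrightarrow> 0 < y i) \<Longrightarrow> 0 \<le> e"
  shows "moment M (\<lambda>\<omega>. W1 n (X \<omega>)) p
     = (Psi1 n y / real n) ^ p * (\<Prod>i<n. Gamma (real m - real i - real p / real n) / Gamma (real m - real i)) * e"
proof -
  obtain A where A: "A \<in> carrier_mat n n" "gram A = S" "mat_adjoint A * A = diag_of n (\<lambda>i. of_real (y i))" and y0: "\<And>i. i < n \<Longrightarrow> 0 < y i"
    by (rule covariance_square_root[OF H N0 S y]) blast
  let ?s = "real p / real n"
  let ?D = "\<lambda>Z. gram_det n m Z powr (- ?s)" and ?T = "\<lambda>Z. weighted_energy n m y Z"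
  \<comment> \<open>The maximum with 0 gives a function that is nonnegative on matrices of every format.\<close>
  let ?F = "\<lambda>B. max 0 (W1 n B) ^ p"
  have det: "Determinant.det A \<noteq> 0" by (rule W1_mult_square_root(1)[OF A(1,3) y0 n(1)])
  have X': "iid_gaussian_columns M n m (gram A) X" using X A(2) by simp
  have Fm: "(\<lambda>Z. ?F (to_mat n m Z)) \<in> borel_measurable (cmat_space n m)" using measurable_W1 by measurable
  have m: "0 < m" using n by simp
  have F0: "0 \<le> ?F B" for B by simp
  note T = nn_integral_iid_gaussian_columns[OF M X' A(1) det m Fm F0]
  have carr: "X \<omega> \<in> carrier_mat n m" if "\<omega> \<in> space M" for \<omega>
    using X that by (auto simp: iid_gaussian_columns_def)
  have FX: "?F (X \<omega>) = W1 n (X \<omega>) ^ p" if "\<omega> \<in> space M" for \<omega> using W1_nonneg[OF carr[OF that]] by simp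
  have FA: "?F (A * to_mat n m Z) = (Psi1 n y / real n) ^ p * (?D Z * ?T Z ^ p)" for Z
    using W1_nonneg[OF mult_carrier_mat[OF A(1) to_mat_carrier], of m Z] W1_mult_square_root(2)[OF A(1,3) y0 n(1) p(1), of m Z] by simp
  have Psi0: "0 \<le> Psi1 n y" unfolding Psi1_def by (intro prod_nonneg) auto
  have T0: "0 \<le> ?T Z" for Z unfolding weighted_energy_def using y0 by (intro sum_nonneg mult_nonneg_nonneg row_energy_nonneg) (auto intro: less_imp_le)
  have Tm: "?T \<in> borel_measurable (cmat_space n m)"
    unfolding weighted_energy_def by (intro borel_measurable_sum borel_measurable_times borel_measurable_const measurable_row_energy) auto
  define Q where "Q = (\<Prod>i<n. Gamma (real m - real i - ?s) / Gamma (real m - real i))"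
  have Q0: "0 \<le> Q" unfolding Q_def
  proof (intro prod_nonneg ballI)
    fix i assume "i \<in> {..<n}"
    then have "Gamma (real m - real i - ?s) > 0" "Gamma (real m - real i) > 0"
      using p(2) n by (auto intro!: Gamma_real_pos)
    then show "0 \<le> Gamma (real m - real i - ?s) / Gamma (real m - real i)" by simp
  qed
  have s0: "0 < ?s" using p n by simp
  have "(\<Prod>i<n. pi ^ m * (Gamma (real m - real i - ?s) / Gamma (real m - real i))) = pi ^ (n * m) * Q"
    unfolding Q_def prod.distrib by (simp add: power_mult[symmetric] mult.commute)
  then have K0: "gauss_integral n m ?D = ennreal (pi ^ (n * m) * Q)"
    using gauss_integral_gram_det_powr[OF s0 p(2) n(2)] by simp
  have "(\<integral>\<^sup>+\<omega>. ennreal (W1 n (X \<omega>) ^ p) \<partial>M) = (\<integral>\<^sup>+\<omega>. ennreal (?F (X \<omega>)) \<partial>M)"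
    by (intro nn_integral_cong) (simp only: FX)
  also have "\<dots> = ennreal (1 / pi ^ (n * m)) * gauss_integral n m (\<lambda>Z. ?F (A * to_mat n m Z))" by (rule T(2))
  also have "gauss_integral n m (\<lambda>Z. ?F (A * to_mat n m Z)) = ennreal ((Psi1 n y / real n) ^ p) * gauss_integral n m (\<lambda>Z. ?D Z * ?T Z ^ p)"
  proof -
    have "(\<lambda>Z. ennreal (?D Z * ?T Z ^ p * exp (- (\<Sum>k<n. row_energy m Z k)))) \<in> borel_measurable (cmat_space n m)"
      using Tm by measurable
    then show ?thesis unfolding gauss_integral_def FA using Psi0 T0
      by (subst nn_integral_cmult[symmetric]) (auto intro!: nn_integral_cong simp: ennreal_mult[symmetric] mult.assoc)
  qed
  also have "gauss_integral n m (\<lambda>Z. ?D Z * ?T Z ^ p) = ennreal e * ennreal (pi ^ (n * m) * Q)"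
    using e(1)[OF y0] K0 by simp
  finally have nn: "(\<integral>\<^sup>+\<omega>. ennreal (W1 n (X \<omega>) ^ p) \<partial>M)
     = ennreal (1 / pi ^ (n * m)) * (ennreal ((Psi1 n y / real n) ^ p) * (ennreal e * ennreal (pi ^ (n * m) * Q)))" .
  have "\<dots> = ennreal ((Psi1 n y / real n) ^ p * Q * e)"
    using Psi0 e(2)[OF y0] Q0 by (simp add: ennreal_mult[symmetric] mult_ac)
  then have nn: "(\<integral>\<^sup>+\<omega>. ennreal (W1 n (X \<omega>) ^ p) \<partial>M) = ennreal ((Psi1 n y / real n) ^ p * Q * e)" using nn by simp
  have meas: "(\<lambda>\<omega>. W1 n (X \<omega>) ^ p) \<in> borel_measurable M"
    using T(1) by (subst measurable_cong[of M _ "\<lambda>\<omega>. ?F (X \<omega>)"]) (simp_all only: FX)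
  have "moment M (\<lambda>\<omega>. W1 n (X \<omega>)) p = enn2real (\<integral>\<^sup>+\<omega>. ennreal (W1 n (X \<omega>) ^ p) \<partial>M)"
    unfolding moment_def using W1_nonneg[OF carr]
    by (intro integral_eq_nn_integral meas AE_I2) auto
  also have "\<dots> = (Psi1 n y / real n) ^ p * Q * e"
    unfolding nn using Psi0 e(2)[OF y0] Q0 by simp
  finally show ?thesis unfolding Q_def .
qed

section \<open>Sums of polygamma functions\<close>

lemma inverse_4_le_telescope:
  fixes y :: real
  assumes "1 < y"
  shows "inverse (y ^ 4) \<le> (1 / (y - 1) ^ 3 - 1 / y ^ 3) / 3"
proof -
  have "3 * (y - 1) ^ 3 \<le> y * (3 * y\<^sup>2 - 3 * y + 1)"
  proof -
    have "y * (3 * y\<^sup>2 - 3 * y + 1) - 3 * (y - 1) ^ 3 = 6 * (y - 2 / 3)\<^sup>2 + 1 / 3"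
      by (simp add: power2_eq_square power3_eq_cube algebra_simps)
    moreover have "0 \<le> 6 * (y - 2 / 3)\<^sup>2 + 1 / 3" by simp
    ultimately show ?thesis by linarith
  qed
  then have "3 * (y - 1) ^ 3 / (y ^ 4 * (y - 1) ^ 3) \<le> y * (3 * y\<^sup>2 - 3 * y + 1) / (y ^ 4 * (y - 1) ^ 3)"
    using assms by (intro divide_right_mono) auto
  moreover have "3 * (y - 1) ^ 3 / (y ^ 4 * (y - 1) ^ 3) = 3 * inverse (y ^ 4)"
    using assms by (simp add: field_simps)
  moreover have "y * (3 * y\<^sup>2 - 3 * y + 1) / (y ^ 4 * (y - 1) ^ 3) = 1 / (y - 1) ^ 3 - 1 / y ^ 3"
  proof -
    have "y * (3 * y\<^sup>2 - 3 * y + 1) / (y ^ 4 * (y - 1) ^ 3) = (3 * y\<^sup>2 - 3 * y + 1) / (y ^ 3 * (y - 1) ^ 3)"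
      using assms by (simp add: power4_eq_xxxx power3_eq_cube)
    also have "\<dots> = (y ^ 3 - (y - 1) ^ 3) / (y ^ 3 * (y - 1) ^ 3)"
      by (rule arg_cong[of _ _ "\<lambda>t. t / (y ^ 3 * (y - 1) ^ 3)"]) (simp add: power2_eq_square power3_eq_cube algebra_simps)
    also have "\<dots> = 1 / (y - 1) ^ 3 - 1 / y ^ 3"
      using assms by (simp add: diff_divide_distrib)
    finally show ?thesis .
  qed
  ultimately show ?thesis by simp
qed

lemma Polygamma_3_le:
  fixes x :: real
  assumes "1 < x"
  shows "Polygamma 3 x \<le> 2 / (x - 1) ^ 3" "(\<lambda>k. inverse ((x + of_nat k) ^ 4)) sums (Polygamma 3 x / 6)"
proof -
  have "(\<lambda>k. inverse ((x + of_nat k) ^ Suc 3)) sums ((-1) ^ Suc 3 * Polygamma 3 x / fact 3)"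
    using assms by (intro Polygamma_LIMSEQ) auto
  then show s: "(\<lambda>k. inverse ((x + of_nat k) ^ 4)) sums (Polygamma 3 x / 6)"
    by (simp add: eval_nat_numeral)
  let ?g = "\<lambda>k. 1 / (x + of_nat k - 1) ^ 3"
  have "?g \<longlonglongrightarrow> 0" by real_asymp
  then have "(\<lambda>k. ?g k - ?g (Suc k)) sums (?g 0 - 0)" by (rule telescope_sums')
  from sums_divide[OF this, of 3] have tele: "(\<lambda>k. (?g k - ?g (Suc k)) / 3) sums (?g 0 / 3)" by simp
  have "Polygamma 3 x / 6 \<le> ?g 0 / 3"
  proof (rule sums_le[OF _ s tele])
    fix k
    have "inverse ((x + of_nat k) ^ 4) \<le> (1 / (x + of_nat k - 1) ^ 3 - 1 / (x + of_nat k) ^ 3) / 3"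
      using assms by (intro inverse_4_le_telescope) auto
    then show "inverse ((x + of_nat k) ^ 4) \<le> (?g k - ?g (Suc k)) / 3" by simp
  qed
  then show "Polygamma 3 x \<le> 2 / (x - 1) ^ 3" by simp
qed

text \<open>
  Both functions are sums over \<open>k\<close>: with \<open>y = x + k\<close>, the trigamma function is the
  sum of \<open>1 / y\<^sup>2\<close>, and \<open>ln x - ln (x - 1)\<close> is, by telescoping, the sum of
  \<open>- ln (1 - 1 / y\<^sup>2)\<close>. The terms differ by \<open>O(1 / y\<^sup>4)\<close>.
\<close>

lemma Polygamma_1_approx:
  fixes x :: real
  assumes x: "2 \<le> x"
  shows "\<bar>Polygamma 1 x - (ln x - ln (x - 1))\<bar> \<le> 2 / (3 * (x - 1) ^ 3)"
proof -
  let ?g = "\<lambda>k. ln (x + of_nat k) - ln (x + of_nat k - 1)"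
  have s1: "(\<lambda>k. inverse ((x + of_nat k) ^ 2)) sums Polygamma 1 x"
    using Polygamma_LIMSEQ[of x 1] x by (simp add: eval_nat_numeral)
  have "?g \<longlonglongrightarrow> 0" by real_asymp
  then have "(\<lambda>k. ?g k - ?g (Suc k)) sums (?g 0 - 0)" by (rule telescope_sums')
  from sums_diff[OF s1 this]
  have s: "(\<lambda>k. inverse ((x + of_nat k) ^ 2) - (?g k - ?g (Suc k))) sums (Polygamma 1 x - (ln x - ln (x - 1)))" by simp
  have s4: "(\<lambda>k. 2 * inverse ((x + of_nat k) ^ 4)) sums (2 * (Polygamma 3 x / 6))"
    using x by (intro sums_mult Polygamma_3_le) auto
  have trm: "\<bar>inverse ((x + of_nat k) ^ 2) - (?g k - ?g (Suc k))\<bar> \<le> 2 * inverse ((x + of_nat k) ^ 4)" for k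
  proof -
    define y where "y = x + of_nat k"
    have y: "2 \<le> y" using x by (simp add: y_def)
    define v where "v = inverse (y ^ 2)"
    have "2 ^ 2 \<le> y ^ 2" using y by (intro power_mono) auto
    then have v: "0 < v" "v \<le> 1 / 2" using y by (auto simp: v_def field_simps)
    have "?g k - ?g (Suc k) = - ln (1 - v)"
    proof -
      have "1 - v = (y - 1) * (y + 1) / (y * y)" using y by (simp add: v_def field_simps power2_eq_square)
      then have "ln (1 - v) = ln (y - 1) + ln (y + 1) - (ln y + ln y)" using y by (simp add: ln_div ln_mult)
      then show ?thesis by (simp add: y_def algebra_simps)
    qed
    moreover have "\<bar>ln (1 + (- v)) - (- v)\<bar> \<le> 2 * (- v)\<^sup>2"
      using v by (intro abs_ln_one_plus_x_minus_x_bound_nonpos) auto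
    moreover have "v\<^sup>2 = inverse (y ^ 4)" by (simp add: v_def power_inverse flip: power_mult)
    ultimately show ?thesis by (simp add: y_def[symmetric] v_def[symmetric] add.commute)
  qed
  have "Polygamma 1 x - (ln x - ln (x - 1)) \<le> 2 * (Polygamma 3 x / 6)"
    by (rule sums_le[OF _ s s4]) (use trm in \<open>simp only: abs_le_iff\<close>)
  moreover have "- (2 * (Polygamma 3 x / 6)) \<le> Polygamma 1 x - (ln x - ln (x - 1))"
    by (rule sums_le[OF _ sums_minus[OF s4] s]) (use trm in \<open>simp only: abs_le_iff minus_le_iff\<close>)
  moreover have "2 * (Polygamma 3 x / 6) \<le> 2 / (3 * (x - 1) ^ 3)"
    using Polygamma_3_le(1)[of x] x by simp
  ultimately show ?thesis by (simp only: abs_le_iff) linarith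
qed

text \<open>
  As for the trigamma function: the second difference \<open>2 / (y * (y\<^sup>2 - 1))\<close> of
  \<open>1 / y\<close> replaces \<open>2 / y\<^sup>3\<close>.
\<close>

lemma Polygamma_2_approx:
  fixes x :: real
  assumes x: "2 \<le> x"
  shows "\<bar>Polygamma 2 x - (1 / x - 1 / (x - 1))\<bar> \<le> 4 / (3 * (x - 1) ^ 4)"
proof -
  let ?g = "\<lambda>k. 1 / (x + of_nat k - 1) - 1 / (x + of_nat k)"
  have "(\<lambda>k. inverse ((x + of_nat k) ^ Suc 2)) sums ((-1) ^ Suc 2 * Polygamma 2 x / fact 2)"
    using x by (intro Polygamma_LIMSEQ) auto
  then have "(\<lambda>k. inverse ((x + of_nat k) ^ 3)) sums (- Polygamma 2 x / 2)"
    by (simp add: eval_nat_numeral)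
  then have s1: "(\<lambda>k. 2 * inverse ((x + of_nat k) ^ 3)) sums (- Polygamma 2 x)"
    using sums_mult[of _ "- Polygamma 2 x / 2" 2] by simp
  have "?g \<longlonglongrightarrow> 0" by real_asymp
  then have "(\<lambda>k. ?g k - ?g (Suc k)) sums (?g 0 - 0)" by (rule telescope_sums')
  from sums_diff[OF this s1]
  have s: "(\<lambda>k. (?g k - ?g (Suc k)) - 2 * inverse ((x + of_nat k) ^ 3)) sums (Polygamma 2 x - (1 / x - 1 / (x - 1)))"
    by (simp add: algebra_simps)
  have s4: "(\<lambda>k. 4 / x * inverse ((x + of_nat k) ^ 4)) sums (4 / x * (Polygamma 3 x / 6))"
    using x by (intro sums_mult Polygamma_3_le) auto
  have trm: "0 \<le> (?g k - ?g (Suc k)) - 2 * inverse ((x + of_nat k) ^ 3)"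
    "(?g k - ?g (Suc k)) - 2 * inverse ((x + of_nat k) ^ 3) \<le> 4 / x * inverse ((x + of_nat k) ^ 4)" for k
  proof -
    define y where "y = x + of_nat k"
    have y: "2 \<le> y" "x \<le> y" using x by (auto simp: y_def)
    have y2: "4 \<le> y\<^sup>2" using power_mono[of 2 y 2] y by simp
    have "(y - 1) * (y + 1) = y\<^sup>2 - 1" by (simp add: algebra_simps power2_eq_square)
    then have nz: "y - 1 \<noteq> 0" "y + 1 \<noteq> 0" "y \<noteq> 0" "y\<^sup>2 - 1 \<noteq> 0" using y y2 by auto
    have "?g k - ?g (Suc k) = (1 / (y - 1) - 1 / y) - (1 / y - 1 / (y + 1))"
      by (simp add: y_def algebra_simps)
    also have "1 / (y - 1) - 1 / y = (y + 1) / (y * ((y - 1) * (y + 1)))" using nz by (simp add: divide_simps)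
    also have "1 / y - 1 / (y + 1) = (y - 1) / (y * ((y - 1) * (y + 1)))" using nz by (simp add: divide_simps)
    also have "(y + 1) / (y * ((y - 1) * (y + 1))) - (y - 1) / (y * ((y - 1) * (y + 1))) = 2 / (y * ((y - 1) * (y + 1)))"
      unfolding diff_divide_distrib[symmetric] by simp
    also have "(y - 1) * (y + 1) = y\<^sup>2 - 1" by fact
    finally have g: "?g k - ?g (Suc k) = 2 / (y * (y\<^sup>2 - 1))" .
    have eq: "(?g k - ?g (Suc k)) - 2 * inverse ((x + of_nat k) ^ 3) = 2 / (y ^ 3 * (y\<^sup>2 - 1))"
    proof -
      define w where "w = y\<^sup>2 - 1"
      have w: "w \<noteq> 0" "y\<^sup>2 = w + 1" using nz by (auto simp: w_def)
      have "2 / (y * w) = 2 * y\<^sup>2 / (y ^ 3 * w)"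
        using nz w(1) by (simp add: power2_eq_square power3_eq_cube)
      moreover have "2 * inverse (y ^ 3) = 2 * w / (y ^ 3 * w)"
        using nz w(1) by (simp add: divide_inverse)
      ultimately have "2 / (y * w) - 2 * inverse (y ^ 3) = (2 * y\<^sup>2 - 2 * w) / (y ^ 3 * w)"
        by (simp only: diff_divide_distrib)
      then have "2 / (y * w) - 2 * inverse (y ^ 3) = 2 / (y ^ 3 * w)" by (simp add: w(2))
      then show ?thesis unfolding g unfolding y_def[symmetric] w_def .
    qed
    show "0 \<le> (?g k - ?g (Suc k)) - 2 * inverse ((x + of_nat k) ^ 3)"
      unfolding eq using y y2 by (intro divide_nonneg_nonneg mult_nonneg_nonneg) auto
    have "x * y ^ 4 \<le> y * y ^ 4" using y by (intro mult_right_mono) auto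
    also have "\<dots> = y ^ 3 * y\<^sup>2" by (simp add: eval_nat_numeral)
    also have "\<dots> \<le> y ^ 3 * (2 * (y\<^sup>2 - 1))" using y y2 by (intro mult_left_mono) auto
    finally have "4 / (y ^ 3 * (2 * (y\<^sup>2 - 1))) \<le> 4 / (x * y ^ 4)"
      using x y by (intro divide_left_mono mult_pos_pos) auto
    moreover have "4 / (a * (2 * b)) = 2 / (a * b)" for a b :: real by simp
    moreover have "4 / (x * y ^ 4) = 4 / x * inverse (y ^ 4)" by (simp add: field_simps)
    ultimately have "2 / (y ^ 3 * (y\<^sup>2 - 1)) \<le> 4 / x * inverse (y ^ 4)" by metis
    then show "(?g k - ?g (Suc k)) - 2 * inverse ((x + of_nat k) ^ 3) \<le> 4 / x * inverse ((x + of_nat k) ^ 4)"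
      unfolding eq unfolding y_def[symmetric] .
  qed
  have "Polygamma 2 x - (1 / x - 1 / (x - 1)) \<le> 4 / x * (Polygamma 3 x / 6)"
    by (rule sums_le[OF trm(2) s s4])
  moreover have "0 \<le> Polygamma 2 x - (1 / x - 1 / (x - 1))"
    by (rule sums_le[OF trm(1) sums_zero s])
  moreover have "4 / x * (Polygamma 3 x / 6) \<le> 4 / (x - 1) * (2 / (x - 1) ^ 3 / 6)"
    using x Polygamma_3_le(1)[of x] Polygamma_real_odd_pos[of x 3]
    by (intro mult_mono divide_left_mono divide_right_mono) (auto simp: nonpos_Ints_def less_imp_le)
  moreover have "4 / (x - 1) * (2 / (x - 1) ^ 3 / 6) = 4 / (3 * (x - 1) ^ 4)"
  proof -
    have p: "(x - 1) ^ 4 = (x - 1) * (x - 1) ^ 3" by (rule power_eq_if[of _ 4, simplified])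
    show ?thesis unfolding p by simp
  qed
  ultimately show ?thesis by (simp only: abs_le_iff) linarith
qed

text \<open>
  At integers the digamma function is a harmonic number minus Euler's constant, for which sharp bounds are known.
  The term \<open>1 / 2\<close> cancels between the two ends of the telescoping sum below.
\<close>

lemma Digamma_nat_approx:
  assumes N: "1 \<le> N"
  shows "\<bar>real N * Digamma (real N + 1) - real N * ln (real N) - 1 / 2\<bar> \<le> 1 / real N"
proof -
  have D: "Digamma (real N + 1) = harm N - euler_mascheroni"
    using Digamma_of_nat[of N, where ?'a = real] by (simp add: add.commute)
  have b: "harm N - ln (real N + 1) + 1 / (2 * (real N + 1)) \<le> euler_mascheroni"
    "euler_mascheroni \<le> harm N - ln (real N + 1) + 1 / (2 * real N)"
    using euler_mascheroni_bounds[OF N] by (auto simp: inverse_eq_divide add.commute)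
  have l: "ln (real N + 1) = ln (real N) + ln (1 + 1 / real N)"
  proof -
    have "real N + 1 = real N * (1 + 1 / real N)" using N by (simp add: field_simps)
    moreover have "1 + 1 / real N > 0" by (simp add: add_pos_nonneg)
    ultimately show ?thesis using N ln_mult[of "real N" "1 + 1 / real N"] by simp
  qed
  have u: "ln (1 + 1 / real N) \<le> 1 / real N" using N by (intro ln_add_one_self_le_self) auto
  have lo: "1 / real N - (1 / real N)\<^sup>2 \<le> ln (1 + 1 / real N)"
    using N by (intro ln_one_plus_pos_lower_bound) auto
  have "Digamma (real N + 1) \<le> ln (real N) + 1 / real N - 1 / (2 * (real N + 1))"
    using b l u D by linarith
  then have "real N * Digamma (real N + 1) \<le> real N * (ln (real N) + 1 / real N - 1 / (2 * (real N + 1)))"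
    by (intro mult_left_mono) auto
  also have "\<dots> = real N * ln (real N) + 1 / 2 + 1 / (2 * (real N + 1))"
  proof -
    have "real N * (1 / real N) = 1" "real N * (1 / (2 * (real N + 1))) = 1 / 2 - 1 / (2 * (real N + 1))"
      using N by (auto simp: divide_simps)
    then show ?thesis by (simp add: ring_distribs)
  qed
  also have "1 / (2 * (real N + 1)) \<le> 1 / real N" using N by (intro divide_left_mono) auto
  finally have 1: "real N * Digamma (real N + 1) \<le> real N * ln (real N) + 1 / 2 + 1 / real N" by simp
  have "ln (real N) + (1 / real N - (1 / real N)\<^sup>2) - 1 / (2 * real N) \<le> Digamma (real N + 1)"
    using b l lo D by linarith
  then have "real N * (ln (real N) + (1 / real N - (1 / real N)\<^sup>2) - 1 / (2 * real N)) \<le> real N * Digamma (real N + 1)"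
    by (intro mult_left_mono) auto
  moreover have "real N * (ln (real N) + (1 / real N - (1 / real N)\<^sup>2) - 1 / (2 * real N)) = real N * ln (real N) + 1 / 2 - 1 / real N"
    using N by (simp add: field_simps power2_eq_square)
  ultimately show ?thesis using 1 by (simp only: abs_le_iff) linarith
qed

text \<open>
  Asymptotics of \<open>\<Sum>i<n. ln_Gamma (m - i - h) - ln_Gamma (m - i)\<close> for small
  \<open>h\<close>. Taylor expansion in \<open>h\<close> to third order leaves sums of polygamma functions. Each
  summand is approximately a difference \<open>F x - F (x - 1)\<close>, so the sums telescope to values at
  \<open>m\<close> and \<open>d = m - n\<close>. In the regime of interest \<open>n\<close>, \<open>m\<close>
  and \<open>d\<close> are of the same order, so the errors are of the orders \<open>n powr -1\<close> (digamma),
  \<open>n powr -2\<close> (trigamma) and \<open>n powr -3\<close> (tetragamma).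
\<close>

context
  fixes n m :: nat and d :: real
  assumes d_def: "d = real m - real n" and d2: "2 \<le> d"
begin

lemma argument_ge: "i < n \<Longrightarrow> d + 1 \<le> real m - real i"
  using d_def by simp

lemma sum_telescope_approx:
  assumes "\<And>x. 2 \<le> x \<Longrightarrow> \<bar>f x - (F x - F (x - 1))\<bar> \<le> C / (x - 1) ^ k" "0 \<le> C"
  shows "\<bar>(\<Sum>i<n. f (real m - real i)) - (F (real m) - F d)\<bar> \<le> real n * (C / d ^ k)"
proof -
  have "(\<Sum>i<n. F (real m - real i) - F (real m - real i - 1)) = F (real m) - F d"
    using sum_lessThan_telescope'[of "\<lambda>i. F (real m - real i)" n] by (simp add: d_def algebra_simps)
  then have "\<bar>(\<Sum>i<n. f (real m - real i)) - (F (real m) - F d)\<bar>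
      = \<bar>\<Sum>i<n. f (real m - real i) - (F (real m - real i) - F (real m - real i - 1))\<bar>"
    by (simp add: sum_subtractf)
  also have "\<dots> \<le> (\<Sum>i<n. \<bar>f (real m - real i) - (F (real m - real i) - F (real m - real i - 1))\<bar>)"
    by (rule sum_abs)
  also have "\<dots> \<le> (\<Sum>i<n. C / d ^ k)"
  proof (rule sum_mono)
    fix i assume "i \<in> {..<n}"
    then have x: "d + 1 \<le> real m - real i" using argument_ge by simp
    have "\<bar>f (real m - real i) - (F (real m - real i) - F (real m - real i - 1))\<bar> \<le> C / (real m - real i - 1) ^ k"
      using x d2 by (intro assms) auto
    also have "\<dots> \<le> C / d ^ k"
      using x d2 assms(2) by (intro divide_left_mono power_mono mult_pos_pos zero_less_power) auto
    finally show "\<bar>f (real m - real i) - (F (real m - real i) - F (real m - real i - 1))\<bar> \<le> C / d ^ k" .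
  qed
  finally show ?thesis by simp
qed

lemma sum_Polygamma_1: "\<bar>(\<Sum>i<n. Polygamma 1 (real m - real i)) - (ln (real m) - ln d)\<bar> \<le> real n * ((2 / 3) / d ^ 3)"
  by (rule sum_telescope_approx) (use Polygamma_1_approx in \<open>auto simp: divide_simps\<close>)

lemma sum_Polygamma_2: "\<bar>(\<Sum>i<n. Polygamma 2 (real m - real i)) - (1 / real m - 1 / d)\<bar> \<le> real n * ((4 / 3) / d ^ 4)"
  by (rule sum_telescope_approx[where F = "\<lambda>x. 1 / x"]) (use Polygamma_2_approx in \<open>auto simp: divide_simps\<close>)

text \<open>
  Here the telescoping is exact: \<open>A x = x * Digamma (x + 1) - x\<close> satisfies
  \<open>A x - A (x - 1) = Digamma x\<close>. Only the two end points are estimated.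
\<close>

lemma sum_Digamma: "\<bar>(\<Sum>i<n. Digamma (real m - real i)) - (real m * ln (real m) - d * ln d - real n)\<bar> \<le> 2 / d"
proof -
  define N where "N = m - n"
  have nm: "n \<le> m" using d_def d2 by linarith
  have N: "real N = d" "1 \<le> N" "1 \<le> m" using d_def d2 nm unfolding N_def by (auto simp: of_nat_diff)
  define A where "A x = x * Digamma (x + 1) - x" for x :: real
  have A_diff: "A x - A (x - 1) = Digamma x" if "x > 0" for x
  proof -
    have "x * Digamma (x + 1) = x * Digamma x + 1" using that by (simp add: Digamma_plus1 ring_distribs)
    then show ?thesis by (simp add: A_def algebra_simps)
  qed
  have "(\<Sum>i<n. Digamma (real m - real i)) = (\<Sum>i<n. A (real m - real i) - A (real m - real i - 1))"
  proof (rule sum.cong)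
    fix i assume "i \<in> {..<n}"
    then have x: "real m - real i > 0" using argument_ge[of i] d2 by simp
    show "Digamma (real m - real i) = A (real m - real i) - A (real m - real i - 1)"
      by (rule A_diff[OF x, symmetric])
  qed simp
  also have "\<dots> = A (real m) - A d"
    using sum_lessThan_telescope'[of "\<lambda>i. A (real m - real i)" n] by (simp add: d_def algebra_simps)
  finally have "(\<Sum>i<n. Digamma (real m - real i)) - (real m * ln (real m) - d * ln d - real n)
     = (real m * Digamma (real m + 1) - real m * ln (real m) - 1 / 2) - (d * Digamma (d + 1) - d * ln d - 1 / 2)"
    by (simp add: A_def d_def)
  moreover have "\<bar>real m * Digamma (real m + 1) - real m * ln (real m) - 1 / 2\<bar> \<le> 1 / real m"
    by (rule Digamma_nat_approx[OF N(3)])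
  moreover have "\<bar>d * Digamma (d + 1) - d * ln d - 1 / 2\<bar> \<le> 1 / d"
    using Digamma_nat_approx[OF N(2)] by (simp add: N(1))
  moreover have "1 / real m \<le> 1 / d" using d_def d2 by (intro divide_left_mono) auto
  ultimately show ?thesis by linarith
qed

lemma ln_Gamma_Taylor:
  fixes x h :: real
  assumes x: "d + 1 \<le> x" and h: "0 < h" "h \<le> 1"
  shows "\<bar>ln_Gamma (x - h) - ln_Gamma x - (- h * Digamma x + h\<^sup>2 / 2 * Polygamma 1 x - h ^ 3 / 6 * Polygamma 2 x)\<bar> \<le> h ^ 4 * (2 / (3 * d ^ 3))"
proof -
  define diff :: "nat \<Rightarrow> real \<Rightarrow> real" where "diff k = (case k of 0 \<Rightarrow> ln_Gamma | Suc k \<Rightarrow> Polygamma k)" for k :: nat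
  have "\<exists>t. x - h < t \<and> t < x \<and>
     ln_Gamma (x - h) = (\<Sum>k<(4::nat). (diff k x / fact k) * ((x - h) - x) ^ k) + (diff 4 t / fact 4) * ((x - h) - x) ^ 4"
  proof (rule Taylor_down[where b = x and f = ln_Gamma and diff = diff])
    show "\<forall>(k::nat) t. k < 4 \<and> x - h \<le> t \<and> t \<le> x \<longrightarrow> DERIV (diff k) t :> diff (Suc k) t"
    proof (intro allI impI)
      fix k :: nat and t :: real assume "k < 4 \<and> x - h \<le> t \<and> t \<le> x"
      then have "t > 0" using x h d2 by linarith
      then show "DERIV (diff k) t :> diff (Suc k) t"
      proof (cases k)
        case 0
        then show ?thesis using has_field_derivative_ln_Gamma_real[OF \<open>t > 0\<close>] by (simp add: diff_def)
      next
        case (Suc j)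
        have "t \<notin> \<int>\<^sub>\<le>\<^sub>0" using \<open>t > 0\<close> by (auto simp: nonpos_Ints_def)
        then show ?thesis using Suc has_field_derivative_Polygamma[of t j UNIV] by (simp add: diff_def)
      qed
    qed
      show "diff 0 = ln_Gamma" by (simp add: diff_def)
  qed (use h in auto)
  then obtain t where t: "x - h < t" "t < x" and
    eq: "ln_Gamma (x - h) = (\<Sum>k<(4::nat). (diff k x / fact k) * ((x - h) - x) ^ k) + (diff 4 t / fact 4) * ((x - h) - x) ^ 4" by blast
  have "(\<Sum>k<(4::nat). (diff k x / fact k) * ((x - h) - x) ^ k)
      = ln_Gamma x - h * Digamma x + h\<^sup>2 / 2 * Polygamma 1 x - h ^ 3 / 6 * Polygamma 2 x"
  proof -
    have four: "(\<Sum>k<(4::nat). f k) = f 0 + f 1 + f 2 + f 3" for f :: "nat \<Rightarrow> real"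
      by (simp add: eval_nat_numeral)
    have d: "diff 0 x = ln_Gamma x" "diff 1 x = Digamma x" "diff 2 x = Polygamma 1 x" "diff 3 x = Polygamma 2 x"
      by (simp_all add: diff_def eval_nat_numeral)
    have f3: "fact 3 = (6 :: real)" by (simp add: fact_numeral)
    show ?thesis unfolding four d f3 by (simp add: mult.commute)
  qed
  moreover have "diff 4 t = Polygamma 3 t" by (simp add: diff_def eval_nat_numeral)
  moreover have "((x - h) - x) ^ 4 = h ^ 4" by (simp add: eval_nat_numeral)
  ultimately have e: "ln_Gamma (x - h) - ln_Gamma x - (- h * Digamma x + h\<^sup>2 / 2 * Polygamma 1 x - h ^ 3 / 6 * Polygamma 2 x)
     = Polygamma 3 t / 24 * h ^ 4" using eq by (simp add: fact_numeral)
  have td: "d < t" using t x h by linarith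
  then have pos: "Polygamma 3 t > 0" using d2 by (intro Polygamma_real_odd_pos) (auto elim!: nonpos_Ints_cases)
  \<comment> \<open>From \<open>t > d\<close> and \<open>d \<ge> 2\<close> it follows that \<open>t - 1 \<ge> d / 2\<close>.\<close>
  have "Polygamma 3 t \<le> 2 / (t - 1) ^ 3" using td d2 by (intro Polygamma_3_le) auto
  also have "\<dots> \<le> 2 / (d / 2) ^ 3" using td d2 by (intro divide_left_mono power_mono mult_pos_pos zero_less_power) auto
  also have "\<dots> = 16 / d ^ 3" by (simp add: power_divide)
  finally have "Polygamma 3 t / 24 * h ^ 4 \<le> (16 / d ^ 3) / 24 * h ^ 4" using h by (intro mult_right_mono divide_right_mono) auto
  also have "\<dots> = h ^ 4 * (2 / (3 * d ^ 3))" by simp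
  finally show ?thesis unfolding e using pos h by simp
qed

lemma sum_ln_Gamma_Taylor:
  assumes h: "0 < h" "h \<le> 1"
  shows "\<bar>(\<Sum>i<n. ln_Gamma (real m - real i - h) - ln_Gamma (real m - real i))
     - (- h * (\<Sum>i<n. Digamma (real m - real i)) + h\<^sup>2 / 2 * (\<Sum>i<n. Polygamma 1 (real m - real i))
        - h ^ 3 / 6 * (\<Sum>i<n. Polygamma 2 (real m - real i)))\<bar> \<le> real n * (h ^ 4 * (2 / (3 * d ^ 3)))"
proof -
  let ?R = "\<lambda>x. ln_Gamma (x - h) - ln_Gamma x - (- h * Digamma x + h\<^sup>2 / 2 * Polygamma 1 x - h ^ 3 / 6 * Polygamma 2 x)"
  have "(\<Sum>i<n. ln_Gamma (real m - real i - h) - ln_Gamma (real m - real i))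
     - (- h * (\<Sum>i<n. Digamma (real m - real i)) + h\<^sup>2 / 2 * (\<Sum>i<n. Polygamma 1 (real m - real i))
        - h ^ 3 / 6 * (\<Sum>i<n. Polygamma 2 (real m - real i))) = (\<Sum>i<n. ?R (real m - real i))" (is "?lhs = _")
    by (simp add: sum.distrib sum_subtractf sum_distrib_left sum_negf)
  then have "\<bar>?lhs\<bar> = \<bar>\<Sum>i<n. ?R (real m - real i)\<bar>" by (rule arg_cong)
  also have "\<dots> \<le> (\<Sum>i<n. \<bar>?R (real m - real i)\<bar>)" by (rule sum_abs)
  also have "\<dots> \<le> (\<Sum>i<n. h ^ 4 * (2 / (3 * d ^ 3)))"
  proof (rule sum_mono)
    fix i assume "i \<in> {..<n}"
    then have "d + 1 \<le> real m - real i" using argument_ge by simp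
    then show "\<bar>?R (real m - real i)\<bar> \<le> h ^ 4 * (2 / (3 * d ^ 3))" by (rule ln_Gamma_Taylor[OF _ h])
  qed
  finally show ?thesis by simp
qed

end

section \<open>Truncated expansions and cumulants\<close>

lemma bounded_mult: "f \<in> O(\<lambda>_. 1) \<Longrightarrow> g \<in> O(\<lambda>_. 1) \<Longrightarrow> (\<lambda>j. f j * g j) \<in> O(\<lambda>_::nat. 1::real)"
  using landau_o.big.mult[of f sequentially "\<lambda>_. 1" g "\<lambda>_. 1"] by simp

lemma bounded_power: "f \<in> O(\<lambda>_. 1) \<Longrightarrow> (\<lambda>j. f j ^ k) \<in> O(\<lambda>_::nat. 1::real)"
  by (induction k) (auto intro: bounded_mult)

lemmas bounded_intros = bounded_mult bounded_power sum_in_bigo(1)[of _ _ "\<lambda>_. 1"] sum_in_bigo(2)[of _ _ "\<lambda>_. 1"] bigo_const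

lemma bigo_bounded_mult: "f \<in> O(\<lambda>_. 1) \<Longrightarrow> g \<in> O(h) \<Longrightarrow> (\<lambda>j. f j * g j) \<in> O(h :: nat \<Rightarrow> real)"
  using landau_o.big.mult[of f sequentially "\<lambda>_. 1" g h] by simp

lemma exp_Taylor_bigo:
  fixes u e :: "nat \<Rightarrow> real"
  assumes u: "u \<in> O(e)" and e: "e \<in> O(\<lambda>_. 1)"
  shows "(\<lambda>j. exp (u j) - (\<Sum>k<n. u j ^ k / fact k)) \<in> O(\<lambda>j. e j ^ n)"
proof -
  have "u \<in> O(\<lambda>_. 1)" using landau_o.big.trans[OF u e] .
  then obtain B where B: "eventually (\<lambda>j. \<bar>u j\<bar> \<le> B) sequentially" by (elim landau_o.bigE) auto
  have "(\<lambda>j. exp (u j) - (\<Sum>k<n. u j ^ k / fact k)) \<in> O(\<lambda>j. u j ^ n)"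
  proof (rule bigoI, use B in eventually_elim)
    case (elim j)
    obtain t where t: "\<bar>t\<bar> \<le> \<bar>u j\<bar>" "exp (u j) = (\<Sum>k<n. u j ^ k / fact k) + exp t / fact n * u j ^ n"
      using Maclaurin_exp_le[of "u j" n] by blast
    have "exp t \<le> exp B" using t elim by simp
    moreover have "exp t / fact n \<le> exp t / 1" by (intro divide_left_mono) auto
    ultimately have "exp t / fact n \<le> exp B" by (metis div_by_1 order_trans)
    then have "\<bar>exp t / fact n\<bar> \<le> exp B" by simp
    then have "\<bar>exp t / fact n\<bar> * \<bar>u j ^ n\<bar> \<le> exp B * \<bar>u j ^ n\<bar>" by (rule mult_right_mono) simp
    then show "norm (exp (u j) - (\<Sum>k<n. u j ^ k / fact k)) \<le> exp B * norm (u j ^ n)"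
      unfolding t(2) by (simp add: abs_mult)
  qed
  also have "(\<lambda>j. u j ^ n) \<in> O(\<lambda>j. e j ^ n)" using u by (rule landau_o.big_power)
  finally show ?thesis .
qed

text \<open>
  Calculus of expansions \<open>f = a0 + a1 * e + a2 * e\<^sup>2 + O(e\<^sup>3)\<close> along a
  sequence. The coefficients are themselves bounded sequences, since \<open>c\<close> and the \<open>\<Psi>\<close>
  may vary with the index.
\<close>

locale bounded_scale =
  fixes e :: "nat \<Rightarrow> real"
  assumes e_bounded: "e \<in> O(\<lambda>_. 1)"
begin

definition expands :: "(nat \<Rightarrow> real) \<Rightarrow> (nat \<Rightarrow> real) \<Rightarrow> (nat \<Rightarrow> real) \<Rightarrow> (nat \<Rightarrow> real) \<Rightarrow> bool" where
  "expands f a0 a1 a2 \<longleftrightarrow> a0 \<in> O(\<lambda>_. 1) \<and> a1 \<in> O(\<lambda>_. 1) \<and> a2 \<in> O(\<lambda>_. 1) \<and>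
     (\<lambda>j. f j - (a0 j + a1 j * e j + a2 j * e j ^ 2)) \<in> O(\<lambda>j. e j ^ 3)"

lemma e3_bounded: "(\<lambda>j. e j ^ 3) \<in> O(\<lambda>_. 1)" using e_bounded by (rule bounded_power)

lemma e3_bigo: "(\<lambda>j. e j ^ 3) \<in> O(e)" "(\<lambda>j. e j ^ 3) \<in> O(\<lambda>j. e j ^ 2)"
  using bigo_bounded_mult[OF bounded_power[OF e_bounded, of 2], of e e] bigo_bounded_mult[OF e_bounded, of "\<lambda>j. e j ^ 2" "\<lambda>j. e j ^ 2"]
  by (simp_all add: eval_nat_numeral mult_ac)

lemma poly_bounded:
  assumes "a0 \<in> O(\<lambda>_. 1)" "a1 \<in> O(\<lambda>_. 1)" "a2 \<in> O(\<lambda>_. 1)"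
  shows "(\<lambda>j. a0 j + a1 j * e j + a2 j * e j ^ 2) \<in> O(\<lambda>_. 1)"
  by (intro bounded_intros assms e_bounded)

lemma expandsI:
  assumes "a0 \<in> O(\<lambda>_. 1)" "a1 \<in> O(\<lambda>_. 1)" "a2 \<in> O(\<lambda>_. 1)" "r \<in> O(\<lambda>_. 1)"
    and "\<And>j. f j = a0 j + a1 j * e j + a2 j * e j ^ 2 + r j * e j ^ 3"
  shows "expands f a0 a1 a2"
proof -
  have "(\<lambda>j. r j * e j ^ 3) \<in> O(\<lambda>j. e j ^ 3)" by (rule bigo_bounded_mult[OF assms(4)]) simp
  then show ?thesis using assms by (simp add: expands_def)
qed

lemma expands_mult:
  assumes f: "expands f a0 a1 a2" and g: "expands g b0 b1 b2"
  shows "expands (\<lambda>j. f j * g j) (\<lambda>j. a0 j * b0 j) (\<lambda>j. a0 j * b1 j + a1 j * b0 j) (\<lambda>j. a0 j * b2 j + a1 j * b1 j + a2 j * b0 j)"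
proof -
  let ?A = "\<lambda>j. a0 j + a1 j * e j + a2 j * e j ^ 2" and ?B = "\<lambda>j. b0 j + b1 j * e j + b2 j * e j ^ 2"
  have a: "a0 \<in> O(\<lambda>_. 1)" "a1 \<in> O(\<lambda>_. 1)" "a2 \<in> O(\<lambda>_. 1)" and b: "b0 \<in> O(\<lambda>_. 1)" "b1 \<in> O(\<lambda>_. 1)" "b2 \<in> O(\<lambda>_. 1)"
    using f g by (auto simp: expands_def)
  have rf: "(\<lambda>j. f j - ?A j) \<in> O(\<lambda>j. e j ^ 3)" and rg: "(\<lambda>j. g j - ?B j) \<in> O(\<lambda>j. e j ^ 3)"
    using f g by (auto simp: expands_def)
  have A: "?A \<in> O(\<lambda>_. 1)" by (rule poly_bounded[OF a])
  have B: "?B \<in> O(\<lambda>_. 1)" by (rule poly_bounded[OF b])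
  have rf1: "(\<lambda>j. f j - ?A j) \<in> O(\<lambda>_. 1)" using landau_o.big.trans[OF rf e3_bounded] .
  have 1: "(\<lambda>j. (f j - ?A j) * (g j - ?B j)) \<in> O(\<lambda>j. e j ^ 3)" by (rule bigo_bounded_mult[OF rf1 rg])
  have 2: "(\<lambda>j. ?A j * (g j - ?B j)) \<in> O(\<lambda>j. e j ^ 3)" by (rule bigo_bounded_mult[OF A rg])
  have 3: "(\<lambda>j. ?B j * (f j - ?A j)) \<in> O(\<lambda>j. e j ^ 3)" by (rule bigo_bounded_mult[OF B rf])
  have 4: "(\<lambda>j. (a1 j * b2 j + a2 j * b1 j + a2 j * b2 j * e j) * e j ^ 3) \<in> O(\<lambda>j. e j ^ 3)"
    by (rule bigo_bounded_mult) (intro bounded_intros a b e_bounded, simp)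
  have "(\<lambda>j. f j * g j - (a0 j * b0 j + (a0 j * b1 j + a1 j * b0 j) * e j + (a0 j * b2 j + a1 j * b1 j + a2 j * b0 j) * e j ^ 2))
     = (\<lambda>j. ((f j - ?A j) * (g j - ?B j) + ?A j * (g j - ?B j)) + (?B j * (f j - ?A j) + (a1 j * b2 j + a2 j * b1 j + a2 j * b2 j * e j) * e j ^ 3))"
    by (rule ext) (simp add: algebra_simps power2_eq_square power3_eq_cube)
  also have "\<dots> \<in> O(\<lambda>j. e j ^ 3)" by (intro sum_in_bigo 1 2 3 4)
  finally show ?thesis unfolding expands_def by (auto intro!: bounded_intros a b)
qed

lemma expands_add:
  assumes f: "expands f a0 a1 a2" and g: "expands g b0 b1 b2"
  shows "expands (\<lambda>j. f j + g j) (\<lambda>j. a0 j + b0 j) (\<lambda>j. a1 j + b1 j) (\<lambda>j. a2 j + b2 j)"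
proof -
  have "(\<lambda>j. (f j - (a0 j + a1 j * e j + a2 j * e j ^ 2)) + (g j - (b0 j + b1 j * e j + b2 j * e j ^ 2))) \<in> O(\<lambda>j. e j ^ 3)"
    by (rule sum_in_bigo(1)) (use f g in \<open>simp_all add: expands_def\<close>)
  also have "(\<lambda>j. (f j - (a0 j + a1 j * e j + a2 j * e j ^ 2)) + (g j - (b0 j + b1 j * e j + b2 j * e j ^ 2)))
    = (\<lambda>j. f j + g j - ((a0 j + b0 j) + (a1 j + b1 j) * e j + (a2 j + b2 j) * e j ^ 2))"
    by (rule ext) (simp add: algebra_simps)
  finally have h: "(\<lambda>j. f j + g j - ((a0 j + b0 j) + (a1 j + b1 j) * e j + (a2 j + b2 j) * e j ^ 2)) \<in> O(\<lambda>j. e j ^ 3)" .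
  show ?thesis unfolding expands_def
    by (intro conjI h bounded_intros) (use f g in \<open>simp_all add: expands_def\<close>)
qed

lemma expands_const: "expands (\<lambda>_. k) (\<lambda>_. k) (\<lambda>_. 0) (\<lambda>_. 0)"
  by (simp add: expands_def)

lemma expands_exp:
  assumes u: "expands u (\<lambda>_. 0) a1 a2"
  shows "expands (\<lambda>j. exp (u j)) (\<lambda>_. 1) a1 (\<lambda>j. a2 j + a1 j ^ 2 / 2)"
proof -
  have a: "a1 \<in> O(\<lambda>_. 1)" "a2 \<in> O(\<lambda>_. 1)" and ru: "(\<lambda>j. u j - (a1 j * e j + a2 j * e j ^ 2)) \<in> O(\<lambda>j. e j ^ 3)"
    using u by (auto simp: expands_def)
  have "(\<lambda>j. (a1 j + a2 j * e j) * e j) \<in> O(e)"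
    by (rule bigo_bounded_mult) (intro bounded_intros a e_bounded, simp)
  then have "(\<lambda>j. (u j - (a1 j * e j + a2 j * e j ^ 2)) + (a1 j + a2 j * e j) * e j) \<in> O(e)"
    by (intro sum_in_bigo landau_o.big.trans[OF ru e3_bigo(1)])
  then have "u \<in> O(e)" by (simp add: algebra_simps power2_eq_square)
  from exp_Taylor_bigo[OF this e_bounded, of 3]
  have "(\<lambda>j. exp (u j) - (1 + u j + u j * u j * (1 / 2))) \<in> O(\<lambda>j. e j ^ 3)"
    by (simp add: eval_nat_numeral)
  then have rem: "expands (\<lambda>j. exp (u j) - (1 + u j + u j * u j * (1 / 2))) (\<lambda>_. 0) (\<lambda>_. 0) (\<lambda>_. 0)"
    by (simp add: expands_def)
  have "expands (\<lambda>j. (exp (u j) - (1 + u j + u j * u j * (1 / 2))) + ((1 + u j) + u j * u j * (1 / 2)))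
     (\<lambda>j. 0 + ((1 + 0) + 0 * 0 * (1/2))) (\<lambda>j. 0 + ((0 + a1 j) + ((0 * 0) * 0 + (0 * a1 j + a1 j * 0) * (1 / 2))))
     (\<lambda>j. 0 + ((0 + a2 j) + ((0 * 0) * 0 + (0 * a1 j + a1 j * 0) * 0 + (0 * a2 j + a1 j * a1 j + a2 j * 0) * (1/2))))"
    by (intro expands_add rem expands_mult u expands_const)
  then show ?thesis by (simp add: power2_eq_square add.commute)
qed

lemma expands_cong:
  assumes "expands f a0 a1 a2" "\<And>j. a0 j = b0 j" "\<And>j. a1 j = b1 j" "\<And>j. a2 j = b2 j"
  shows "expands f b0 b1 b2"
proof -
  have "a0 = b0" "a1 = b1" "a2 = b2" using assms(2-4) by auto
  then show ?thesis using assms(1) by simp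
qed

text \<open>
  The third cumulant has order \<open>e\<^sup>2\<close>, so the moments must be expanded up to that order and the
  lower orders must be seen to cancel. The common factor \<open>exp (g j) ^ p\<close> is split off from the
  \<open>p\<close>-th moment before the expansion: cumulants are homogeneous, so the factor
  \<open>exp (g j) ^ r\<close> comes out of the \<open>r\<close>-th one, and replacing \<open>g\<close> by
  \<open>g0\<close> then causes only a relative error of order \<open>e\<close>. Here \<open>\<mu> p\<close> is
  the \<open>p\<close>-th moment and \<open>p2\<close>, \<open>p3\<close>, \<open>p4\<close> stand for
  \<open>\<Psi>\<^sub>1 \<Psi>\<^sub>2\<close>, \<open>\<Psi>\<^sub>1\<^sup>2 \<Psi>\<^sub>3\<close>,
  \<open>\<Psi>\<^sub>1\<^sup>3 \<Psi>\<^sub>4\<close>.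
\<close>

context
  fixes c L \<delta> \<gamma> p2 p3 p4 g g0 :: "nat \<Rightarrow> real" and u :: "nat \<Rightarrow> nat \<Rightarrow> real" and \<mu> :: "nat \<Rightarrow> nat \<Rightarrow> real"
  assumes bd: "c \<in> O(\<lambda>_. 1)" "L \<in> O(\<lambda>_. 1)" "\<delta> \<in> O(\<lambda>_. 1)" "\<gamma> \<in> O(\<lambda>_. 1)"
      "p2 \<in> O(\<lambda>_. 1)" "p3 \<in> O(\<lambda>_. 1)" "p4 \<in> O(\<lambda>_. 1)" "g0 \<in> O(\<lambda>_. 1)"
    and g: "(\<lambda>j. g j - g0 j) \<in> O(e)"
    and u: "\<And>p. p \<in> {1,2,3} \<Longrightarrow> expands (u p) (\<lambda>_. 0) (\<lambda>j. real p ^ 2 * (L j / 2)) (\<lambda>j. real p ^ 2 * \<delta> j + real p ^ 3 * \<gamma> j)"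
    and mu1: "eventually (\<lambda>j. \<mu> 1 j = exp (g j) * (exp (u 1 j) * ((1 - c j * e j) * p2 j))) sequentially"
    and mu2: "eventually (\<lambda>j. \<mu> 2 j = exp (g j) ^ 2 * (exp (u 2 j) *
        ((1 - 2 * c j * e j) ^ 2 * p2 j ^ 2 + (1 - 2 * c j * e j) * c j * e j * p3 j))) sequentially"
    and mu3: "eventually (\<lambda>j. \<mu> 3 j = exp (g j) ^ 3 * (exp (u 3 j) *
        ((1 - 3 * c j * e j) ^ 3 * p2 j ^ 3 + 3 * (1 - 3 * c j * e j) ^ 2 * c j * e j * p2 j * p3 j
          + 2 * (1 - 3 * c j * e j) * c j ^ 2 * e j ^ 2 * p4 j))) sequentially"
begin

text \<open>
  The moments without the factors \<open>exp (g j) ^ p\<close>.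
\<close>

definition "reduced_moment1 j = exp (u 1 j) * ((1 - c j * e j) * p2 j)"
definition "reduced_moment2 j = exp (u 2 j) * ((1 - 2 * c j * e j) ^ 2 * p2 j ^ 2 + (1 - 2 * c j * e j) * c j * e j * p3 j)"
definition "reduced_moment3 j = exp (u 3 j) * ((1 - 3 * c j * e j) ^ 3 * p2 j ^ 3 + 3 * (1 - 3 * c j * e j) ^ 2 * c j * e j * p2 j * p3 j
          + 2 * (1 - 3 * c j * e j) * c j ^ 2 * e j ^ 2 * p4 j)"

lemma expands_reduced_moment1: "expands reduced_moment1 p2 (\<lambda>j. (L j / 2 - c j) * p2 j)
   (\<lambda>j. (\<delta> j + \<gamma> j + L j ^ 2 / 8 - L j * c j / 2) * p2 j)"
proof -
  have E: "expands (\<lambda>j. exp (u 1 j)) (\<lambda>_. 1) (\<lambda>j. real 1 ^ 2 * (L j / 2)) (\<lambda>j. real 1 ^ 2 * \<delta> j + real 1 ^ 3 * \<gamma> j + (real 1 ^ 2 * (L j / 2)) ^ 2 / 2)"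
    by (rule expands_exp[OF u]) simp
  have q: "expands (\<lambda>j. (1 - c j * e j) * p2 j) p2 (\<lambda>j. - c j * p2 j) (\<lambda>_. 0)"
    by (rule expandsI[where r = "\<lambda>_. 0"]) (auto intro!: bounded_intros bd simp: algebra_simps)
  show ?thesis unfolding reduced_moment1_def[abs_def]
    by (rule expands_cong[OF expands_mult[OF E q]]) (simp_all add: algebra_simps power2_eq_square)
qed

lemma expands_reduced_moment2: "expands reduced_moment2 (\<lambda>j. p2 j ^ 2) (\<lambda>j. (2 * L j - 4 * c j) * p2 j ^ 2 + c j * p3 j)
   (\<lambda>j. (4 * \<delta> j + 8 * \<gamma> j + 2 * L j ^ 2 - 8 * L j * c j + 4 * c j ^ 2) * p2 j ^ 2 + (2 * L j * c j - 2 * c j ^ 2) * p3 j)"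
proof -
  have E: "expands (\<lambda>j. exp (u 2 j)) (\<lambda>_. 1) (\<lambda>j. real 2 ^ 2 * (L j / 2)) (\<lambda>j. real 2 ^ 2 * \<delta> j + real 2 ^ 3 * \<gamma> j + (real 2 ^ 2 * (L j / 2)) ^ 2 / 2)"
    by (rule expands_exp[OF u]) simp
  have q: "expands (\<lambda>j. (1 - 2 * c j * e j) ^ 2 * p2 j ^ 2 + (1 - 2 * c j * e j) * c j * e j * p3 j)
     (\<lambda>j. p2 j ^ 2) (\<lambda>j. - 4 * c j * p2 j ^ 2 + c j * p3 j) (\<lambda>j. 4 * c j ^ 2 * p2 j ^ 2 - 2 * c j ^ 2 * p3 j)"
    by (rule expandsI[where r = "\<lambda>_. 0"]) (auto intro!: bounded_intros bd simp: algebra_simps power2_eq_square)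
  show ?thesis unfolding reduced_moment2_def[abs_def]
    by (rule expands_cong[OF expands_mult[OF E q]]) (simp_all add: algebra_simps power2_eq_square)
qed

lemma expands_reduced_moment3: "expands reduced_moment3 (\<lambda>j. p2 j ^ 3) (\<lambda>j. (9 / 2 * L j - 9 * c j) * p2 j ^ 3 + 3 * c j * p2 j * p3 j)
   (\<lambda>j. (9 * \<delta> j + 27 * \<gamma> j + 81 / 8 * L j ^ 2 - 81 / 2 * L j * c j + 27 * c j ^ 2) * p2 j ^ 3
      + (27 / 2 * L j * c j - 18 * c j ^ 2) * p2 j * p3 j + 2 * c j ^ 2 * p4 j)"
proof -
  have E: "expands (\<lambda>j. exp (u 3 j)) (\<lambda>_. 1) (\<lambda>j. real 3 ^ 2 * (L j / 2)) (\<lambda>j. real 3 ^ 2 * \<delta> j + real 3 ^ 3 * \<gamma> j + (real 3 ^ 2 * (L j / 2)) ^ 2 / 2)"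
    by (rule expands_exp[OF u]) simp
  have q: "expands (\<lambda>j. (1 - 3 * c j * e j) ^ 3 * p2 j ^ 3 + 3 * (1 - 3 * c j * e j) ^ 2 * c j * e j * p2 j * p3 j
          + 2 * (1 - 3 * c j * e j) * c j ^ 2 * e j ^ 2 * p4 j)
     (\<lambda>j. p2 j ^ 3) (\<lambda>j. - 9 * c j * p2 j ^ 3 + 3 * c j * p2 j * p3 j)
     (\<lambda>j. 27 * c j ^ 2 * p2 j ^ 3 - 18 * c j ^ 2 * p2 j * p3 j + 2 * c j ^ 2 * p4 j)"
    by (rule expandsI[where r = "\<lambda>j. - 27 * c j ^ 3 * p2 j ^ 3 + 27 * c j ^ 3 * p2 j * p3 j - 6 * c j ^ 3 * p4 j"])
       (auto intro!: bounded_intros bd simp: algebra_simps power2_eq_square power3_eq_cube)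
  show ?thesis unfolding reduced_moment3_def[abs_def]
    by (rule expands_cong[OF expands_mult[OF E q]]) (simp_all add: algebra_simps power2_eq_square)
qed

lemma expands_cumulant2: "expands (\<lambda>j. reduced_moment2 j + (- 1) * (reduced_moment1 j * reduced_moment1 j)) (\<lambda>_. 0) (\<lambda>j. (L j - 2 * c j) * p2 j ^ 2 + c j * p3 j)
    (\<lambda>j. (4 * \<delta> j + 8 * \<gamma> j + 2 * L j ^ 2 - 8 * L j * c j + 4 * c j ^ 2) * p2 j ^ 2 + (2 * L j * c j - 2 * c j ^ 2) * p3 j
      - (2 * (\<delta> j + \<gamma> j + L j ^ 2 / 8 - L j * c j / 2) + (L j / 2 - c j) ^ 2) * p2 j ^ 2)"
  by (rule expands_cong[OF expands_add[OF expands_reduced_moment2 expands_mult[OF expands_const expands_mult[OF expands_reduced_moment1 expands_reduced_moment1]]]])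
     (simp_all add: algebra_simps power2_eq_square)

text \<open>
  The coefficients of \<open>e ^ 0\<close> and \<open>e\<close> vanish, and so does the contribution of
  \<open>\<delta>\<close> to the coefficient of \<open>e\<^sup>2\<close>, since
  \<open>9 - 3 * (4 + 1) + 2 * 3 = 0\<close>. This is why boundedness is all that has to be known about
  \<open>\<delta>\<close>.
\<close>

lemma expands_cumulant3:
  "expands (\<lambda>j. reduced_moment3 j + ((- 3) * (reduced_moment2 j * reduced_moment1 j) + 2 * (reduced_moment1 j * (reduced_moment1 j * reduced_moment1 j)))) (\<lambda>_. 0) (\<lambda>_. 0)
    (\<lambda>j. (3 * (L j - 2 * c j) ^ 2 + 6 * \<gamma> j - 3 * c j ^ 2) * p2 j ^ 3 - 3 * c j * (3 * c j - 2 * L j) * p2 j * p3 j + 2 * c j ^ 2 * p4 j)"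
  by (rule expands_cong[OF expands_add[OF expands_reduced_moment3 expands_add[OF
        expands_mult[OF expands_const expands_mult[OF expands_reduced_moment2 expands_reduced_moment1]]
        expands_mult[OF expands_const expands_mult[OF expands_reduced_moment1 expands_mult[OF expands_reduced_moment1 expands_reduced_moment1]]]]]])
     (simp_all add: algebra_simps power2_eq_square power3_eq_cube)

lemma exp_g0_bounded: "(\<lambda>j. exp (g0 j)) \<in> O(\<lambda>_. 1)"
proof -
  from bd(8) obtain B where B: "eventually (\<lambda>j. \<bar>g0 j\<bar> \<le> B) sequentially" by (elim landau_o.bigE) auto
  show ?thesis by (rule bigoI[of _ "exp B"], use B in eventually_elim) (auto simp: abs_le_iff)
qed

lemma exp_g_approx: "(\<lambda>j. exp (g j) - exp (g0 j)) \<in> O(e)"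
proof -
  have "(\<lambda>j. exp (g j - g0 j) - 1) \<in> O(e)"
    using exp_Taylor_bigo[OF g e_bounded, of 1] by simp
  then have "(\<lambda>j. exp (g0 j) * (exp (g j - g0 j) - 1)) \<in> O(e)" by (rule bigo_bounded_mult[OF exp_g0_bounded])
  then show ?thesis by (simp add: algebra_simps exp_add[symmetric])
qed

lemma exp_g_bounded: "(\<lambda>j. exp (g j)) \<in> O(\<lambda>_. 1)"
  using sum_in_bigo(1)[OF landau_o.big.trans[OF exp_g_approx e_bounded] exp_g0_bounded] by simp

lemma exp_g_power_approx: "(\<lambda>j. exp (g j) ^ k - exp (g0 j) ^ k) \<in> O(e)"
proof (induction k)
  case (Suc k)
  have "(\<lambda>j. exp (g j) * (exp (g j) ^ k - exp (g0 j) ^ k) + exp (g0 j) ^ k * (exp (g j) - exp (g0 j))) \<in> O(e)"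
    by (intro sum_in_bigo bigo_bounded_mult Suc.IH exp_g_approx bounded_power exp_g_bounded exp_g0_bounded)
  then show ?case by (simp add: algebra_simps)
qed simp

text \<open>
  The passage from \<open>g\<close> to \<open>g0\<close> in the prefactor: it costs a relative error
  \<open>O(e)\<close> in the leading term \<open>a * e ^ k\<close>, hence an error of order
  \<open>e ^ (k + 1)\<close>.
\<close>

lemma scaled_approx:
  assumes f: "(\<lambda>j. f j - a j * e j ^ k) \<in> O(\<lambda>j. e j ^ Suc k)" and a: "a \<in> O(\<lambda>_. 1)"
    and ev: "eventually (\<lambda>j. \<kappa> j = exp (g j) ^ r * f j) sequentially"
  shows "(\<lambda>j. \<kappa> j - e j ^ k * exp (g0 j) ^ r * a j) \<in> O(\<lambda>j. e j ^ Suc k)"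
proof -
  have "(\<lambda>j. a j * e j ^ k * (exp (g j) ^ r - exp (g0 j) ^ r)) \<in> O(\<lambda>j. e j ^ k * e j)"
    by (intro landau_o.big.mult exp_g_power_approx bigo_bounded_mult a) simp
  then have 1: "(\<lambda>j. a j * e j ^ k * (exp (g j) ^ r - exp (g0 j) ^ r)) \<in> O(\<lambda>j. e j ^ Suc k)" by (simp add: mult.commute)
  have "(\<lambda>j. exp (g j) ^ r * (f j - a j * e j ^ k) + a j * e j ^ k * (exp (g j) ^ r - exp (g0 j) ^ r)) \<in> O(\<lambda>j. e j ^ Suc k)"
    by (intro sum_in_bigo 1 bigo_bounded_mult bounded_power exp_g_bounded f)
  also have "?this \<longleftrightarrow> (\<lambda>j. \<kappa> j - e j ^ k * exp (g0 j) ^ r * a j) \<in> O(\<lambda>j. e j ^ Suc k)"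
    by (rule landau_o.big.in_cong, use ev in eventually_elim) (simp add: algebra_simps)
  finally show ?thesis .
qed

lemma cumulant1_approx: "(\<lambda>j. \<mu> 1 j - exp (g0 j) * p2 j) \<in> O(e)"
proof -
  have b: "(\<lambda>j. (L j / 2 - c j) * p2 j) \<in> O(\<lambda>_. 1)" "(\<lambda>j. (\<delta> j + \<gamma> j + L j ^ 2 / 8 - L j * c j / 2) * p2 j) \<in> O(\<lambda>_. 1)"
    and r: "(\<lambda>j. reduced_moment1 j - (p2 j + (L j / 2 - c j) * p2 j * e j + (\<delta> j + \<gamma> j + L j ^ 2 / 8 - L j * c j / 2) * p2 j * e j ^ 2)) \<in> O(\<lambda>j. e j ^ 3)"
    using expands_reduced_moment1 by (auto simp: expands_def)
  have "(\<lambda>j. ((L j / 2 - c j) * p2 j + (\<delta> j + \<gamma> j + L j ^ 2 / 8 - L j * c j / 2) * p2 j * e j) * e j) \<in> O(e)"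
    by (rule bigo_bounded_mult) (intro sum_in_bigo bounded_mult b e_bounded, simp)
  then have "(\<lambda>j. (reduced_moment1 j - (p2 j + (L j / 2 - c j) * p2 j * e j + (\<delta> j + \<gamma> j + L j ^ 2 / 8 - L j * c j / 2) * p2 j * e j ^ 2))
     + ((L j / 2 - c j) * p2 j + (\<delta> j + \<gamma> j + L j ^ 2 / 8 - L j * c j / 2) * p2 j * e j) * e j) \<in> O(e)"
    by (intro sum_in_bigo landau_o.big.trans[OF r e3_bigo(1)])
  then have "(\<lambda>j. reduced_moment1 j - p2 j * e j ^ 0) \<in> O(\<lambda>j. e j ^ Suc 0)" by (simp add: algebra_simps power2_eq_square)
  from scaled_approx[OF this bd(5), of "\<mu> 1" 1] mu1 show ?thesis by (simp add: reduced_moment1_def)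
qed

lemma cumulant2_approx:
  "(\<lambda>j. (\<mu> 2 j - \<mu> 1 j ^ 2) - e j * exp (g0 j) ^ 2 * ((L j - 2 * c j) * p2 j ^ 2 + c j * p3 j)) \<in> O(\<lambda>j. e j ^ 2)"
proof -
  define a1 where "a1 j = (L j - 2 * c j) * p2 j ^ 2 + c j * p3 j" for j
  obtain a2 where ex: "expands (\<lambda>j. reduced_moment2 j + (- 1) * (reduced_moment1 j * reduced_moment1 j)) (\<lambda>_. 0) a1 a2"
    using expands_cumulant2 unfolding a1_def[abs_def] by blast
  have b: "a1 \<in> O(\<lambda>_. 1)" "a2 \<in> O(\<lambda>_. 1)"
    and r: "(\<lambda>j. reduced_moment2 j + (- 1) * (reduced_moment1 j * reduced_moment1 j) - (0 + a1 j * e j + a2 j * e j ^ 2)) \<in> O(\<lambda>j. e j ^ 3)"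
    using ex by (auto simp: expands_def)
  have "(\<lambda>j. a2 j * e j ^ 2) \<in> O(\<lambda>j. e j ^ 2)" by (rule bigo_bounded_mult[OF b(2)]) simp
  then have "(\<lambda>j. (reduced_moment2 j + (- 1) * (reduced_moment1 j * reduced_moment1 j) - (0 + a1 j * e j + a2 j * e j ^ 2)) + a2 j * e j ^ 2) \<in> O(\<lambda>j. e j ^ 2)"
    by (intro sum_in_bigo landau_o.big.trans[OF r e3_bigo(2)])
  also have "(\<lambda>j. (reduced_moment2 j + (- 1) * (reduced_moment1 j * reduced_moment1 j) - (0 + a1 j * e j + a2 j * e j ^ 2)) + a2 j * e j ^ 2)
     = (\<lambda>j. (reduced_moment2 j - reduced_moment1 j ^ 2) - a1 j * e j ^ 1)"
    by (rule ext) (simp add: power2_eq_square)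
  finally have f: "(\<lambda>j. (reduced_moment2 j - reduced_moment1 j ^ 2) - a1 j * e j ^ 1) \<in> O(\<lambda>j. e j ^ Suc 1)"
    by (simp add: numeral_2_eq_2)
  have "eventually (\<lambda>j. \<mu> 2 j - \<mu> 1 j ^ 2 = exp (g j) ^ 2 * (reduced_moment2 j - reduced_moment1 j ^ 2)) sequentially"
    using mu1 mu2
  proof eventually_elim
    case (elim j)
    then show ?case unfolding reduced_moment1_def[symmetric] reduced_moment2_def[symmetric] by (simp add: algebra_simps power2_eq_square)
  qed
  from scaled_approx[OF f b(1) this] show ?thesis by (simp add: a1_def eval_nat_numeral)
qed

lemma cumulant3_approx:
  "(\<lambda>j. (\<mu> 3 j - 3 * \<mu> 2 j * \<mu> 1 j + 2 * \<mu> 1 j ^ 3) - e j ^ 2 * exp (g0 j) ^ 3 *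
     ((3 * (L j - 2 * c j) ^ 2 + 6 * \<gamma> j - 3 * c j ^ 2) * p2 j ^ 3 - 3 * c j * (3 * c j - 2 * L j) * p2 j * p3 j + 2 * c j ^ 2 * p4 j)) \<in> O(\<lambda>j. e j ^ 3)"
proof -
  define a2 where "a2 j = (3 * (L j - 2 * c j) ^ 2 + 6 * \<gamma> j - 3 * c j ^ 2) * p2 j ^ 3 - 3 * c j * (3 * c j - 2 * L j) * p2 j * p3 j + 2 * c j ^ 2 * p4 j" for j
  have ex: "expands (\<lambda>j. reduced_moment3 j + ((- 3) * (reduced_moment2 j * reduced_moment1 j) + 2 * (reduced_moment1 j * (reduced_moment1 j * reduced_moment1 j)))) (\<lambda>_. 0) (\<lambda>_. 0) a2"
    using expands_cumulant3 unfolding a2_def[abs_def] .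
  have f: "(\<lambda>j. (reduced_moment3 j - 3 * reduced_moment2 j * reduced_moment1 j + 2 * reduced_moment1 j ^ 3) - a2 j * e j ^ 2) \<in> O(\<lambda>j. e j ^ Suc 2)" and b: "a2 \<in> O(\<lambda>_. 1)"
    using ex by (simp_all add: expands_def power3_eq_cube algebra_simps)
  have "eventually (\<lambda>j. \<mu> 3 j - 3 * \<mu> 2 j * \<mu> 1 j + 2 * \<mu> 1 j ^ 3 = exp (g j) ^ 3 * (reduced_moment3 j - 3 * reduced_moment2 j * reduced_moment1 j + 2 * reduced_moment1 j ^ 3)) sequentially"
    using mu1 mu2 mu3
  proof eventually_elim
    case (elim j)
    then show ?case unfolding reduced_moment1_def[symmetric] reduced_moment2_def[symmetric] reduced_moment3_def[symmetric] by (simp add: algebra_simps power2_eq_square power3_eq_cube)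
  qed
  from scaled_approx[OF f b this] show ?thesis by (simp add: a2_def eval_nat_numeral)
qed

end

end

section \<open>Proportional growth of the two dimensions\<close>

text \<open>
  The expansion parameter is \<open>e = 1 / n\<^sup>2\<close>. The product of Gamma quotients in the
  \<open>p\<close>-th moment is \<open>m powr - p\<close> times the exponential of
  \<open>p * g + u p\<close>. The summand \<open>p * g\<close> collects what is linear in \<open>p\<close>:
  its leading part is \<open>p * g0\<close>, and \<open>exp (g0 j)\<close> is the constant
  \<open>exp 1 * (1 - c) powr ((1 - c) / c)\<close> of the theorem. The remainder \<open>u p\<close>
  begins with \<open>p\<^sup>2 * (L / 2) * e\<close>.
\<close>

locale proportional_growth =
  fixes n m :: "nat \<Rightarrow> nat" and c :: "nat \<Rightarrow> real" and a b :: real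
  assumes n_large: "filterlim n at_top sequentially"
    and c_eq: "\<And>j. c j = real (n j) / real (m j)"
    and ab: "0 < a" "b < 1"
    and c_range: "\<And>j. a \<le> c j \<and> c j \<le> b"
begin

definition "d j = real (m j) - real (n j)"
definition "e j = 1 / real (n j) ^ 2"
definition "L j = - ln (1 - c j)"
definition "S0 j = (\<Sum>i<n j. Digamma (real (m j) - real i))"
definition "S1 j = (\<Sum>i<n j. Polygamma 1 (real (m j) - real i))"
definition "S2 j = (\<Sum>i<n j. Polygamma 2 (real (m j) - real i))"
definition "\<gamma> j = c j ^ 2 / (6 * (1 - c j))"
definition "\<delta> j = (S1 j - L j) / 2 * real (n j) ^ 2"
definition "g j = ln (real (m j)) - S0 j / real (n j)"
definition "g0 j = 1 + (1 - c j) / c j * ln (1 - c j)"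
definition "lnG p j = (\<Sum>i<n j. ln_Gamma (real (m j) - real i - real p / real (n j)) - ln_Gamma (real (m j) - real i))"
definition "u p j = lnG p j + real p / real (n j) * S0 j"

lemma c01: "0 < c j" "c j < 1"
  using c_range[of j] ab by auto

lemma n_pos: "0 < n j" and m_pos: "0 < m j" and n_less_m: "n j < m j"
proof -
  show "0 < n j" "0 < m j" using c01(1)[of j] by (auto simp: c_eq intro!: Nat.gr0I)
  then show "n j < m j" using c01(2)[of j] by (simp add: c_eq)
qed

lemma d_pos: "0 < d j" using n_less_m[of j] by (simp add: d_def)

lemma one_minus_c: "1 - c j = d j / real (m j)"
  using m_pos[of j] by (simp add: c_eq d_def field_simps)

text \<open>
  The difference \<open>m - n\<close> grows like \<open>n\<close>, so error bounds in \<open>d\<close> become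
  powers of \<open>e\<close>.
\<close>

lemma d_ge: "(1 - b) * real (n j) \<le> d j"
proof -
  have "(1 - b) * real (n j) \<le> (1 - c j) * real (n j)" using c_range[of j] by (intro mult_right_mono) auto
  also have "\<dots> \<le> (1 - c j) * real (m j)" using n_less_m[of j] c01[of j] by (intro mult_left_mono) auto
  also have "\<dots> = d j" using m_pos[of j] by (simp add: one_minus_c)
  finally show ?thesis .
qed

lemma eventually_large: "eventually (\<lambda>j. 3 \<le> n j \<and> 2 \<le> d j) sequentially"
proof -
  have "eventually (\<lambda>j. max 3 (nat \<lceil>2 / (1 - b)\<rceil>) \<le> n j) sequentially"
    using n_large unfolding filterlim_at_top by blast
  then show ?thesis
  proof eventually_elim
    case (elim j)
    then have "2 / (1 - b) \<le> real (n j)" by linarith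
    then have "2 \<le> (1 - b) * real (n j)" using ab by (simp add: field_simps)
    then show ?case using d_ge[of j] elim by linarith
  qed
qed

lemma L_eq: "L j = ln (real (m j)) - ln (d j)"
  using d_pos[of j] m_pos[of j] by (simp add: L_def one_minus_c ln_div)

lemma e_pos: "0 < e j" using n_pos[of j] by (simp add: e_def)

lemma ln_bound: "0 \<le> L j" "L j \<le> - ln (1 - b)"
  using c_range[of j] c01[of j] ab unfolding L_def by auto

lemma bounded_seqs: "e \<in> O(\<lambda>_. 1)" "c \<in> O(\<lambda>_. 1)" "L \<in> O(\<lambda>_. 1)" "\<gamma> \<in> O(\<lambda>_. 1)" "g0 \<in> O(\<lambda>_. 1)" "\<delta> \<in> O(\<lambda>_. 1)"
proof -
  have "e j \<le> 1" for j using n_pos[of j] by (simp add: e_def)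
  then show "e \<in> O(\<lambda>_. 1)" using e_pos by (intro bigoI[of _ 1] always_eventually) (auto simp: less_imp_le)
  show "c \<in> O(\<lambda>_. 1)" using c01 by (intro bigoI[of _ 1] always_eventually) (auto simp: less_imp_le)
  show "L \<in> O(\<lambda>_. 1)" using ln_bound by (intro bigoI[of _ "- ln (1 - b)"] always_eventually) auto
  have "\<gamma> j \<le> 1 / (6 * (1 - b))" "0 \<le> \<gamma> j" for j
  proof -
    have "c j ^ 2 \<le> 1" using c01[of j] by (intro power_le_one) auto
    then show "\<gamma> j \<le> 1 / (6 * (1 - b))" unfolding \<gamma>_def using c_range[of j] ab by (intro frac_le) auto
    show "0 \<le> \<gamma> j" unfolding \<gamma>_def using c01[of j] by simp
  qed
  then show "\<gamma> \<in> O(\<lambda>_. 1)" by (intro bigoI[of _ "1 / (6 * (1 - b))"] always_eventually) auto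
  show "g0 \<in> O(\<lambda>_. 1)"
  proof (intro bigoI[of _ "1 + 1 / a * - ln (1 - b)"] always_eventually allI)
    fix j
    have "(1 - c j) / c j \<le> 1 / a" using c01[of j] c_range[of j] ab by (intro frac_le) auto
    then have "(1 - c j) / c j * L j \<le> 1 / a * - ln (1 - b)"
      using ln_bound[of j] ab c01[of j] by (intro mult_mono) auto
    moreover have "0 \<le> (1 - c j) / c j * L j" using c01[of j] ln_bound[of j] by simp
    moreover have "g0 j = 1 - (1 - c j) / c j * L j" by (simp add: g0_def L_def)
    ultimately show "norm (g0 j) \<le> (1 + 1 / a * - ln (1 - b)) * norm (1::real)" by simp
  qed
  show "\<delta> \<in> O(\<lambda>_. 1)"
  proof (rule bigoI[of _ "1 / (3 * (1 - b) ^ 3)"], use eventually_large in eventually_elim)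
    case (elim j)
    have N: "0 < real (n j)" using n_pos[of j] by simp
    have "\<bar>S1 j - L j\<bar> \<le> real (n j) * ((2 / 3) / d j ^ 3)"
      using sum_Polygamma_1[OF d_def] elim unfolding S1_def L_eq by blast
    also have "\<dots> \<le> real (n j) * ((2 / 3) / ((1 - b) * real (n j)) ^ 3)"
      using N ab d_pos[of j] d_ge[of j] by (intro mult_left_mono divide_left_mono power_mono mult_pos_pos zero_less_power) auto
    finally have "\<bar>S1 j - L j\<bar> / 2 * real (n j) ^ 2 \<le> real (n j) * ((2 / 3) / ((1 - b) * real (n j)) ^ 3) / 2 * real (n j) ^ 2"
      by (intro mult_right_mono divide_right_mono) auto
    also have "\<dots> = 1 / (3 * (1 - b) ^ 3)"
      using N by (simp add: power_mult_distrib power2_eq_square power3_eq_cube)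
    finally show ?case by (simp add: \<delta>_def abs_mult)
  qed
qed

sublocale bounded_scale e by unfold_locales (rule bounded_seqs)

lemma g_approx: "(\<lambda>j. g j - g0 j) \<in> O(e)"
proof (rule bigoI[of _ "2 / (1 - b)"], use eventually_large in eventually_elim)
  case (elim j)
  have N: "0 < real (n j)" using n_pos[of j] by simp
  let ?T = "real (m j) * ln (real (m j)) - d j * ln (d j) - real (n j)"
  have "(1 - c j) / c j = d j / real (n j)" using one_minus_c[of j] m_pos[of j] by (simp add: c_eq)
  then have "g0 j = 1 - d j / real (n j) * (ln (real (m j)) - ln (d j))"
    using L_eq[of j] by (simp add: g0_def L_def algebra_simps)
  moreover have "ln (real (m j)) - ?T / real (n j) = 1 - d j / real (n j) * (ln (real (m j)) - ln (d j))"
  proof -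
    have "real (m j) = d j + real (n j)" by (simp add: d_def)
    then have "?T = d j * (ln (real (m j)) - ln (d j)) + real (n j) * ln (real (m j)) - real (n j)"
      by (simp add: algebra_simps)
    then show ?thesis using N by (simp add: field_simps)
  qed
  ultimately have "g j - g0 j = - ((S0 j - ?T) / real (n j))"
    by (simp add: g_def diff_divide_distrib)
  then have "\<bar>g j - g0 j\<bar> = \<bar>S0 j - ?T\<bar> / real (n j)" using N by simp
  also have "\<bar>S0 j - ?T\<bar> \<le> 2 / d j" using sum_Digamma[OF d_def] elim unfolding S0_def by blast
  also have "2 / d j \<le> 2 / ((1 - b) * real (n j))"
    using N ab d_pos[of j] d_ge[of j] by (intro divide_left_mono mult_pos_pos) auto
  finally have "\<bar>g j - g0 j\<bar> \<le> 2 / ((1 - b) * real (n j)) / real (n j)" using N by (simp add: divide_right_mono)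
  also have "\<dots> = 2 / (1 - b) * e j" by (simp add: e_def power2_eq_square)
  finally show ?case using e_pos[of j] by simp
qed

text \<open>
  In the Taylor expansion with step \<open>h = p / n\<close>, the trigamma sum contributes
  \<open>h\<^sup>2 / 2 * (L + O(1 / n\<^sup>2))\<close>; the deviation from \<open>L\<close> is
  \<open>\<delta>\<close>, rescaled. The tetragamma sum contributes
  \<open>- h\<^sup>3 / 6 * (1 / m - 1 / d)\<close>, which is
  \<open>p\<^sup>3 * \<gamma> * e\<^sup>2\<close>. The fourth order remainder is
  \<open>O(n * h\<^sup>4 / d\<^sup>3) = O(e\<^sup>3)\<close>.
\<close>

lemma u_expands:
  assumes p: "p \<in> {1,2,3::nat}"
  shows "expands (u p) (\<lambda>_. 0) (\<lambda>j. real p ^ 2 * (L j / 2)) (\<lambda>j. real p ^ 2 * \<delta> j + real p ^ 3 * \<gamma> j)"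
proof -
  let ?C = "2 * real p ^ 4 / (3 * (1 - b) ^ 3) + 2 * real p ^ 3 / (9 * (1 - b) ^ 4)"
  have "(\<lambda>j. u p j - (0 + real p ^ 2 * (L j / 2) * e j + (real p ^ 2 * \<delta> j + real p ^ 3 * \<gamma> j) * e j ^ 2)) \<in> O(\<lambda>j. e j ^ 3)"
  proof (rule bigoI[of _ ?C], use eventually_large in eventually_elim)
    case (elim j)
    define N where "N = real (n j)"
    define h where "h = real p / N"
    have N: "0 < N" "3 \<le> N" using n_pos[of j] elim by (auto simp: N_def)
    have h: "0 < h" "h \<le> 1" using p N by (auto simp: h_def)
    have dN: "(1 - b) * N \<le> d j" "0 < (1 - b) * N" using d_ge[of j] ab N by (auto simp: N_def)
    define R where "R = lnG p j - (- h * S0 j + h\<^sup>2 / 2 * S1 j - h ^ 3 / 6 * S2 j)"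
    define Q where "Q = S2 j - (1 / real (m j) - 1 / d j)"
    have "\<bar>R\<bar> \<le> N * (h ^ 4 * (2 / (3 * d j ^ 3)))"
      using sum_ln_Gamma_Taylor[OF d_def _ h] elim unfolding R_def lnG_def S0_def S1_def S2_def N_def h_def by blast
    also have "\<dots> \<le> N * (h ^ 4 * (2 / (3 * ((1 - b) * N) ^ 3)))"
      using N h dN ab d_pos[of j] by (intro mult_left_mono divide_left_mono power_mono mult_pos_pos zero_less_power) auto
    also have "\<dots> = 2 * real p ^ 4 / (3 * (1 - b) ^ 3) * (1 / N ^ 2) ^ 3"
    proof -
      have "N * ((r / N) ^ 4 * (2 / (3 * (q * N) ^ 3))) = 2 * r ^ 4 / (3 * q ^ 3) * (1 / N ^ 2) ^ 3" for r q
        using N by (simp add: power_divide power_mult_distrib divide_simps eval_nat_numeral)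
      then show ?thesis unfolding h_def .
    qed
    finally have R: "\<bar>R\<bar> \<le> 2 * real p ^ 4 / (3 * (1 - b) ^ 3) * e j ^ 3" by (simp add: e_def N_def)
    have "\<bar>Q\<bar> \<le> N * ((4 / 3) / d j ^ 4)"
      using sum_Polygamma_2[OF d_def] elim unfolding Q_def S2_def N_def by blast
    also have "\<dots> \<le> N * ((4 / 3) / ((1 - b) * N) ^ 4)"
      using N dN ab d_pos[of j] by (intro mult_left_mono divide_left_mono power_mono mult_pos_pos zero_less_power) auto
    finally have "h ^ 3 / 6 * \<bar>Q\<bar> \<le> h ^ 3 / 6 * (N * ((4 / 3) / ((1 - b) * N) ^ 4))" using h by (intro mult_left_mono) auto
    also have "\<dots> = 2 * real p ^ 3 / (9 * (1 - b) ^ 4) * (1 / N ^ 2) ^ 3"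
    proof -
      have "(r / N) ^ 3 / 6 * (N * ((4 / 3) / (q * N) ^ 4)) = 2 * r ^ 3 / (9 * q ^ 4) * (1 / N ^ 2) ^ 3" for r q
        using N by (simp add: power_divide power_mult_distrib divide_simps eval_nat_numeral)
      then show ?thesis unfolding h_def .
    qed
    finally have Q: "h ^ 3 / 6 * \<bar>Q\<bar> \<le> 2 * real p ^ 3 / (9 * (1 - b) ^ 4) * e j ^ 3" by (simp add: e_def N_def)
    have g1: "real p ^ 3 * \<gamma> j * e j ^ 2 = - (h ^ 3 / 6 * (1 / real (m j) - 1 / d j))"
    proof -
      have md: "real (m j) = d j + N" by (simp add: d_def N_def)
      have pos: "0 < d j" "0 < real (m j)" using d_pos m_pos by auto
      have "\<gamma> j = (N / real (m j))\<^sup>2 / (6 * (d j / real (m j)))" unfolding \<gamma>_def one_minus_c by (simp add: c_eq N_def)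
      also have "\<dots> = N\<^sup>2 / (6 * real (m j) * d j)" using pos by (simp add: field_simps power2_eq_square)
      finally have g: "\<gamma> j = N\<^sup>2 / (6 * real (m j) * d j)" .
      have diff: "1 / real (m j) - 1 / d j = - N / (real (m j) * d j)" using pos md by (simp add: divide_simps)
      show ?thesis unfolding g diff using N pos by (simp add: e_def h_def N_def[symmetric] power_divide field_simps eval_nat_numeral)
    qed
    have d1: "real p ^ 2 * \<delta> j * e j ^ 2 = h\<^sup>2 / 2 * S1 j - real p ^ 2 * (L j / 2) * e j"
    proof -
      have \<delta>e: "\<delta> j * e j ^ 2 = (S1 j - L j) / 2 * e j"
        using N by (simp add: \<delta>_def e_def N_def[symmetric] power2_eq_square)
      have h2: "h\<^sup>2 = real p ^ 2 * e j" by (simp add: h_def e_def N_def power_divide)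
      show ?thesis unfolding mult.assoc[of "real p ^ 2"] \<delta>e h2 by (simp add: field_simps)
    qed
    have "u p j - (0 + real p ^ 2 * (L j / 2) * e j + (real p ^ 2 * \<delta> j + real p ^ 3 * \<gamma> j) * e j ^ 2)
      = lnG p j + h * S0 j - real p ^ 2 * (L j / 2) * e j - real p ^ 2 * \<delta> j * e j ^ 2 - real p ^ 3 * \<gamma> j * e j ^ 2"
      by (simp add: u_def h_def N_def algebra_simps)
    also have "\<dots> = R - h ^ 3 / 6 * Q"
      unfolding g1 d1 by (simp add: R_def Q_def algebra_simps)
    finally have "\<bar>u p j - (0 + real p ^ 2 * (L j / 2) * e j + (real p ^ 2 * \<delta> j + real p ^ 3 * \<gamma> j) * e j ^ 2)\<bar> \<le> \<bar>R\<bar> + h ^ 3 / 6 * \<bar>Q\<bar>"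
      using abs_triangle_ineq4[of R "h ^ 3 / 6 * Q"] h by (simp add: abs_mult)
    also have "\<dots> \<le> ?C * e j ^ 3" using R Q by (simp add: ring_distribs)
    finally show ?case using e_pos[of j] by simp
  qed
  then show ?thesis unfolding expands_def
    by (intro conjI) (auto intro!: bounded_intros bounded_seqs)
qed

lemma gamma_ratio:
  assumes "3 \<le> n j" "p \<in> {1,2,3::nat}"
  shows "(\<Prod>i<n j. Gamma (real (m j) - real i - real p / real (n j)) / Gamma (real (m j) - real i))
     = exp (g j) ^ p * exp (u p j) / real (m j) ^ p"
proof -
  have N: "0 < real (n j)" using n_pos[of j] by simp
  have "(\<Prod>i<n j. Gamma (real (m j) - real i - real p / real (n j)) / Gamma (real (m j) - real i)) = exp (lnG p j)"
    unfolding lnG_def exp_sum[OF finite_lessThan]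
  proof (rule prod.cong)
    fix i assume "i \<in> {..<n j}"
    then have "real i + 1 \<le> real (n j)" "real (n j) + 1 \<le> real (m j)" using n_less_m[of j] by auto
    moreover have "real p / real (n j) \<le> 1" using assms N by auto
    ultimately have "0 < real (m j) - real i - real p / real (n j)" "0 < real (m j) - real i" by linarith+
    then show "Gamma (real (m j) - real i - real p / real (n j)) / Gamma (real (m j) - real i)
       = exp (ln_Gamma (real (m j) - real i - real p / real (n j)) - ln_Gamma (real (m j) - real i))"
      by (simp add: Gamma_real_pos_exp exp_diff)
  qed simp
  also have "lnG p j = real p * g j + u p j - real p * ln (real (m j))"
    using N by (simp add: u_def g_def field_simps)
  also have "exp \<dots> = exp (g j) ^ p * exp (u p j) / real (m j) ^ p"
    using m_pos[of j] by (simp add: exp_add exp_diff exp_of_nat_mult)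
  finally show ?thesis .
qed

end

text \<open>
  The moments of the weighted energy, with \<open>\<nu> = m - p / n\<close>, rewritten in terms of
  \<open>c = n / m\<close> and \<open>1 / n\<^sup>2\<close>. Since
  \<open>\<nu> / m = 1 - p * c / n\<^sup>2\<close>, they have only even powers of \<open>1 / n\<close>.
\<close>

lemma moment1_algebra:
  fixes N mm :: real
  assumes "N \<noteq> 0" "mm \<noteq> 0"
  shows "(P1 / N) ^ 1 * (G ^ 1 * U / mm ^ 1) * ((mm - 1 / N) * (N * P2))
    = G * (U * ((1 - (N / mm) * (1 / N ^ 2)) * (P1 * P2)))"
  using assms by (simp add: field_simps power2_eq_square)

lemma moment2_algebra:
  fixes N mm :: real
  assumes "N \<noteq> 0" "mm \<noteq> 0"
  shows "(P1 / N) ^ 2 * (G ^ 2 * U / mm ^ 2) * ((mm - 2 / N)\<^sup>2 * (N * P2)\<^sup>2 + (mm - 2 / N) * (N * P3))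
    = G ^ 2 * (U * ((1 - 2 * (N / mm) * (1 / N ^ 2)) ^ 2 * (P1 * P2) ^ 2
       + (1 - 2 * (N / mm) * (1 / N ^ 2)) * (N / mm) * (1 / N ^ 2) * (P1 ^ 2 * P3)))"
proof -
  \<comment> \<open>Factors \<open>1 = x * (N * mm)\<close> give all terms the same degrees in \<open>N\<close> and \<open>mm\<close>.\<close>
  define x where "x = (N / mm) * (1 / N ^ 2)"
  have x: "x * (N * mm) = 1" using assms by (simp add: x_def power2_eq_square)
  have nu: "mm - 2 / N = mm * (1 - 2 * x)" using assms by (simp add: x_def field_simps power2_eq_square)
  have "(P1 / N) ^ 2 * (G ^ 2 * U / mm ^ 2) * ((mm * (1 - 2 * x))\<^sup>2 * (N * P2)\<^sup>2 + (mm * (1 - 2 * x)) * (N * P3))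
    = (P1 / N) ^ 2 * (G ^ 2 * U / mm ^ 2) * ((mm * (1 - 2 * x))\<^sup>2 * (N * P2)\<^sup>2 + (mm * (1 - 2 * x)) * (N * P3) * (x * (N * mm)))"
    by (simp add: x)
  also have "\<dots> = G ^ 2 * (U * ((1 - 2 * x) ^ 2 * (P1 * P2) ^ 2 + (1 - 2 * x) * x * (P1 ^ 2 * P3)))"
    using assms by (simp add: field_simps power2_eq_square)
  finally show ?thesis unfolding nu by (simp add: x_def mult.assoc)
qed

lemma moment3_algebra:
  fixes N mm :: real
  assumes "N \<noteq> 0" "mm \<noteq> 0"
  shows "(P1 / N) ^ 3 * (G ^ 3 * U / mm ^ 3) * ((mm - 3 / N) ^ 3 * (N * P2) ^ 3 + 3 * (mm - 3 / N)\<^sup>2 * (N * P2) * (N * P3) + 2 * (mm - 3 / N) * (N * P4))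
    = G ^ 3 * (U * ((1 - 3 * (N / mm) * (1 / N ^ 2)) ^ 3 * (P1 * P2) ^ 3
       + 3 * (1 - 3 * (N / mm) * (1 / N ^ 2)) ^ 2 * (N / mm) * (1 / N ^ 2) * (P1 * P2) * (P1 ^ 2 * P3)
       + 2 * (1 - 3 * (N / mm) * (1 / N ^ 2)) * (N / mm) ^ 2 * (1 / N ^ 2) ^ 2 * (P1 ^ 3 * P4)))"
proof -
  define x where "x = (N / mm) * (1 / N ^ 2)"
  have x: "x * (N * mm) = 1" using assms by (simp add: x_def power2_eq_square)
  have nu: "mm - 3 / N = mm * (1 - 3 * x)" using assms by (simp add: x_def field_simps power2_eq_square)
  define w where "w = 1 - 3 * x"
  have "(P1 / N) ^ 3 * (G ^ 3 * U / mm ^ 3) * ((mm * w) ^ 3 * (N * P2) ^ 3 + 3 * (mm * w)\<^sup>2 * (N * P2) * (N * P3) + 2 * (mm * w) * (N * P4))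
    = (P1 / N) ^ 3 * (G ^ 3 * U / mm ^ 3) * ((mm * w) ^ 3 * (N * P2) ^ 3 + 3 * (mm * w)\<^sup>2 * (N * P2) * (N * P3) * (x * (N * mm)) + 2 * (mm * w) * (N * P4) * (x * (N * mm)) ^ 2)"
    by (simp add: x)
  also have "\<dots> = G ^ 3 * (U * (w ^ 3 * (P1 * P2) ^ 3 + 3 * w ^ 2 * x * (P1 * P2) * (P1 ^ 2 * P3) + 2 * w * x ^ 2 * (P1 ^ 3 * P4)))"
    using assms by (simp add: field_simps power2_eq_square power3_eq_cube)
  also have "x ^ 2 = (N / mm) ^ 2 * (1 / N ^ 2) ^ 2" unfolding x_def power_mult_distrib ..
  finally show ?thesis unfolding nu by (simp only: x_def w_def mult.assoc)
qed

lemma Bseq_imp_bigo_1: "Bseq f \<Longrightarrow> f \<in> O(\<lambda>_. 1 :: real)" for f :: "nat \<Rightarrow> real"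
  by (elim BseqE) (auto intro!: bigoI always_eventually)

theorem proposition3:
  fixes n m k :: "nat \<Rightarrow> nat"
    and c N0 :: "nat \<Rightarrow> real"
    and H :: "nat \<Rightarrow> complex mat"
    and M :: "nat \<Rightarrow> 'a measure"
    and X :: "nat \<Rightarrow> 'a \<Rightarrow> complex mat"
    and W :: "nat \<Rightarrow> 'a \<Rightarrow> real"
    and S :: "nat \<Rightarrow> complex mat"
    and y :: "nat \<Rightarrow> nat \<Rightarrow> real"
    and \<Psi>\<^sub>1 \<Psi>\<^sub>2 \<Psi>\<^sub>3 \<Psi>\<^sub>4 :: "nat \<Rightarrow> real"
    and a b :: real
  assumes n_large: "filterlim n at_top sequentially"
    and c_eq: "\<And>j. c j = real (n j) / real (m j)"
    and ab: "0 < a" "b < 1"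
    and c_range: "\<And>j. a \<le> c j \<and> c j \<le> b"
    and N0_pos: "\<And>j. 0 < N0 j"
    and k_ge: "\<And>j. n j \<le> k j"
    and H_dim: "\<And>j. H j \<in> carrier_mat (n j) (k j)"
    and H_posdef: "\<And>j. positive_definite (n j) (gram (H j))"
    and S_eq: "\<And>j. S j = gram (H j) + complex_of_real (N0 j) \<cdot>\<^sub>m 1\<^sub>m (n j)"
    and prob: "\<And>j. prob_space (M j)"
    and X_gauss: "\<And>j. iid_gaussian_columns (M j) (n j) (m j) (S j) (X j)"
    and W_eq: "\<And>j \<omega>. W j \<omega> = W1 (n j) (X j \<omega>)"
    and y_eigen: "\<And>j. eigenvalue_list (n j) (S j) (y j)"
    and Psi1_eq: "\<And>j. \<Psi>\<^sub>1 j = Psi1 (n j) (y j)"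
    and Psi2_eq: "\<And>j. \<Psi>\<^sub>2 j = Psi_succ 1 (n j) (y j)"
    and Psi3_eq: "\<And>j. \<Psi>\<^sub>3 j = Psi_succ 2 (n j) (y j)"
    and Psi4_eq: "\<And>j. \<Psi>\<^sub>4 j = Psi_succ 3 (n j) (y j)"
    and Psi_bounded: "Bseq (\<lambda>j. \<Psi>\<^sub>1 j * \<Psi>\<^sub>2 j)" "Bseq (\<lambda>j. \<Psi>\<^sub>1 j ^ 2 * \<Psi>\<^sub>3 j)"
      "Bseq (\<lambda>j. \<Psi>\<^sub>1 j ^ 3 * \<Psi>\<^sub>4 j)"
  shows "(\<lambda>j. cumulant1 (M j) (W j)
            - exp 1 * (1 - c j) powr ((1 - c j) / c j) * \<Psi>\<^sub>1 j * \<Psi>\<^sub>2 j)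
          \<in> O(\<lambda>j. 1 / real (n j) ^ 2)
    \<and> (\<lambda>j. cumulant2 (M j) (W j)
            - 1 / real (n j) ^ 2 * \<Psi>\<^sub>1 j ^ 2 * exp 1 ^ 2
              * (1 - c j) powr (2 * ((1 - c j) / c j))
              * ((ln (1 / (1 - c j)) - 2 * c j) * \<Psi>\<^sub>2 j ^ 2 + c j * \<Psi>\<^sub>3 j))
          \<in> O(\<lambda>j. 1 / real (n j) ^ 4)
    \<and> (\<lambda>j. cumulant3 (M j) (W j)
            - 1 / real (n j) ^ 4 * \<Psi>\<^sub>1 j ^ 3 * exp 1 ^ 3
              * (1 - c j) powr (3 * ((1 - c j) / c j))
              * ((c j ^ 2 * (- 10 + 9 * c j) / (- 1 + c j)
                    + 3 * ln (1 - c j) * (4 * c j + ln (1 - c j))) * \<Psi>\<^sub>2 j ^ 3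
                 - 3 * c j * (3 * c j + 2 * ln (1 - c j)) * \<Psi>\<^sub>2 j * \<Psi>\<^sub>3 j
                 + 2 * c j ^ 2 * \<Psi>\<^sub>4 j))
          \<in> O(\<lambda>j. 1 / real (n j) ^ 6)"
proof -
  interpret G: proportional_growth n m c a b
    by unfold_locales (fact n_large c_eq ab c_range)+
  let ?e = "G.e" and ?g0 = "G.g0"
  define \<mu> where "\<mu> p j = moment (M j) (W j) p" for p j
  define p2 where "p2 j = \<Psi>\<^sub>1 j * \<Psi>\<^sub>2 j" for j
  define p3 where "p3 j = \<Psi>\<^sub>1 j ^ 2 * \<Psi>\<^sub>3 j" for j
  define p4 where "p4 j = \<Psi>\<^sub>1 j ^ 3 * \<Psi>\<^sub>4 j" for j
  have pb: "p2 \<in> O(\<lambda>_. 1)" "p3 \<in> O(\<lambda>_. 1)" "p4 \<in> O(\<lambda>_. 1)"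
    using Psi_bounded[THEN Bseq_imp_bigo_1] by (simp_all add: p2_def[abs_def] p3_def[abs_def] p4_def[abs_def])
  have W: "W j = (\<lambda>\<omega>. W1 (n j) (X j \<omega>))" for j using W_eq by auto
  have sums: "(\<Sum>i<n j. y j i) = real (n j) * \<Psi>\<^sub>2 j" "(\<Sum>i<n j. y j i ^ 2) = real (n j) * \<Psi>\<^sub>3 j"
    "(\<Sum>i<n j. y j i ^ 3) = real (n j) * \<Psi>\<^sub>4 j" for j
    using G.n_pos[of j] by (simp_all add: Psi2_eq Psi3_eq Psi4_eq Psi_succ_def)
  \<comment> \<open>The exact moment, in terms of the moment \<open>E\<close> of the weighted energy.\<close>
  have mom: "\<mu> p j = (\<Psi>\<^sub>1 j / real (n j)) ^ p * (exp (G.g j) ^ p * exp (G.u p j) / real (m j) ^ p) * E"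
    if n3: "3 \<le> n j" and p: "p \<in> {1,2,3}"
      and E: "(\<And>i. i < n j \<Longrightarrow> 0 < y j i) \<Longrightarrow>
       gauss_integral (n j) (m j) (\<lambda>Z. gram_det (n j) (m j) Z powr (- (real p / real (n j))) * weighted_energy (n j) (m j) (y j) Z ^ p)
       = ennreal E * gauss_integral (n j) (m j) (\<lambda>Z. gram_det (n j) (m j) Z powr (- (real p / real (n j))))"
       "(\<And>i. i < n j \<Longrightarrow> 0 < y j i) \<Longrightarrow> 0 \<le> E" for p j E
  proof -
    \<comment> \<open>For \<open>n \<ge> 3\<close> the exponent \<open>p / n\<close> is at most 1, below the bound \<open>m - n + 1\<close> where the negative moment becomes infinite.\<close>
    have "real p / real (n j) \<le> 1" using p n3 by auto
    then have lt: "real p / real (n j) < real (m j) - real (n j) + 1" using G.n_less_m[of j] by linarith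
    have "\<mu> p j = (Psi1 (n j) (y j) / real (n j)) ^ p
       * (\<Prod>i<n j. Gamma (real (m j) - real i - real p / real (n j)) / Gamma (real (m j) - real i)) * E"
      unfolding \<mu>_def W
      by (rule moment_W1[OF prob X_gauss H_dim N0_pos S_eq y_eigen G.n_pos _ _ lt E])
         (use p G.n_less_m[of j] in auto)
    then show ?thesis unfolding G.gamma_ratio[OF n3 p] Psi1_eq .
  qed
  have wt: "gram_det_weight (m j) (real p / real (n j))" if "3 \<le> n j" "p \<in> {1,2,3}" for p j
  proof -
    have "real p / real (n j) \<le> 1" using that by auto
    moreover have "1 < real (m j)" using that G.n_less_m[of j] by simp
    ultimately have "real p / real (n j) < real (m j)" by simp
    then show ?thesis using that by unfold_locales auto
  qed
  have mu1: "eventually (\<lambda>j. \<mu> 1 j = exp (G.g j) * (exp (G.u 1 j) * ((1 - c j * ?e j) * p2 j))) sequentially"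
    using G.eventually_large
  proof eventually_elim
    case (elim j)
    interpret gram_det_weight "n j" "m j" "real 1 / real (n j)" using wt[of j 1] elim by simp
    let ?\<nu> = "real (m j) - 1 / real (n j)"
    have nu: "\<nu> = ?\<nu>" unfolding \<nu>_def by simp
    have "\<mu> 1 j = (\<Psi>\<^sub>1 j / real (n j)) ^ 1 * (exp (G.g j) ^ 1 * exp (G.u 1 j) / real (m j) ^ 1) * (?\<nu> * (real (n j) * \<Psi>\<^sub>2 j))"
    proof (rule mom)
      assume y0: "\<And>i. i < n j \<Longrightarrow> 0 < y j i"
      then have y0': "\<And>i. i < n j \<Longrightarrow> 0 \<le> y j i" by (simp add: less_imp_le)
      show "gauss_integral (n j) (m j) (\<lambda>Z. gram_det (n j) (m j) Z powr (- (real 1 / real (n j))) * weighted_energy (n j) (m j) (y j) Z ^ 1)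
       = ennreal (?\<nu> * (real (n j) * \<Psi>\<^sub>2 j)) * gauss_integral (n j) (m j) (\<lambda>Z. gram_det (n j) (m j) Z powr (- (real 1 / real (n j))))"
        using weighted_energy_moment1[where y = "y j", OF y0'] unfolding nu sums power_one_right by simp
      show "0 \<le> ?\<nu> * (real (n j) * \<Psi>\<^sub>2 j)"
        unfolding sums(1)[symmetric] nu[symmetric] using nu_pos y0' by (intro mult_nonneg_nonneg sum_nonneg) auto
    qed (use elim in auto)
    also have "\<dots> = exp (G.g j) * (exp (G.u 1 j) * ((1 - c j * ?e j) * p2 j))"
      unfolding c_eq G.e_def p2_def by (rule moment1_algebra) (use G.n_pos[of j] G.m_pos[of j] in auto)
    finally show ?case .
  qed
  have mu2: "eventually (\<lambda>j. \<mu> 2 j = exp (G.g j) ^ 2 * (exp (G.u 2 j) *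
        ((1 - 2 * c j * ?e j) ^ 2 * p2 j ^ 2 + (1 - 2 * c j * ?e j) * c j * ?e j * p3 j))) sequentially"
    using G.eventually_large
  proof eventually_elim
    case (elim j)
    interpret gram_det_weight "n j" "m j" "real 2 / real (n j)" using wt[of j 2] elim by simp
    let ?\<nu> = "real (m j) - 2 / real (n j)"
    have nu: "\<nu> = ?\<nu>" unfolding \<nu>_def by simp
    have "\<mu> 2 j = (\<Psi>\<^sub>1 j / real (n j)) ^ 2 * (exp (G.g j) ^ 2 * exp (G.u 2 j) / real (m j) ^ 2)
       * (?\<nu>\<^sup>2 * (real (n j) * \<Psi>\<^sub>2 j)\<^sup>2 + ?\<nu> * (real (n j) * \<Psi>\<^sub>3 j))"
    proof (rule mom)
      assume y0: "\<And>i. i < n j \<Longrightarrow> 0 < y j i"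
      then have y0': "\<And>i. i < n j \<Longrightarrow> 0 \<le> y j i" by (simp add: less_imp_le)
      show "gauss_integral (n j) (m j) (\<lambda>Z. gram_det (n j) (m j) Z powr (- (real 2 / real (n j))) * weighted_energy (n j) (m j) (y j) Z ^ 2)
       = ennreal (?\<nu>\<^sup>2 * (real (n j) * \<Psi>\<^sub>2 j)\<^sup>2 + ?\<nu> * (real (n j) * \<Psi>\<^sub>3 j)) * gauss_integral (n j) (m j) (\<lambda>Z. gram_det (n j) (m j) Z powr (- (real 2 / real (n j))))"
        using weighted_energy_moment2[where y = "y j", OF y0'] unfolding nu sums .
      show "0 \<le> ?\<nu>\<^sup>2 * (real (n j) * \<Psi>\<^sub>2 j)\<^sup>2 + ?\<nu> * (real (n j) * \<Psi>\<^sub>3 j)"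
        unfolding sums[symmetric] nu[symmetric] using nu_pos y0' by (intro add_nonneg_nonneg mult_nonneg_nonneg sum_nonneg) auto
    qed (use elim in auto)
    also have "\<dots> = exp (G.g j) ^ 2 * (exp (G.u 2 j) *
        ((1 - 2 * c j * ?e j) ^ 2 * p2 j ^ 2 + (1 - 2 * c j * ?e j) * c j * ?e j * p3 j))"
      unfolding c_eq G.e_def p2_def p3_def by (rule moment2_algebra) (use G.n_pos[of j] G.m_pos[of j] in auto)
    finally show ?case .
  qed
  have mu3: "eventually (\<lambda>j. \<mu> 3 j = exp (G.g j) ^ 3 * (exp (G.u 3 j) *
        ((1 - 3 * c j * ?e j) ^ 3 * p2 j ^ 3 + 3 * (1 - 3 * c j * ?e j) ^ 2 * c j * ?e j * p2 j * p3 j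
          + 2 * (1 - 3 * c j * ?e j) * c j ^ 2 * ?e j ^ 2 * p4 j))) sequentially"
    using G.eventually_large
  proof eventually_elim
    case (elim j)
    interpret gram_det_weight "n j" "m j" "real 3 / real (n j)" using wt[of j 3] elim by simp
    let ?\<nu> = "real (m j) - 3 / real (n j)"
    have nu: "\<nu> = ?\<nu>" unfolding \<nu>_def by simp
    let ?E = "?\<nu> ^ 3 * (real (n j) * \<Psi>\<^sub>2 j) ^ 3 + 3 * ?\<nu>\<^sup>2 * (real (n j) * \<Psi>\<^sub>2 j) * (real (n j) * \<Psi>\<^sub>3 j) + 2 * ?\<nu> * (real (n j) * \<Psi>\<^sub>4 j)"
    have "\<mu> 3 j = (\<Psi>\<^sub>1 j / real (n j)) ^ 3 * (exp (G.g j) ^ 3 * exp (G.u 3 j) / real (m j) ^ 3) * ?E"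
    proof (rule mom)
      assume y0: "\<And>i. i < n j \<Longrightarrow> 0 < y j i"
      then have y0': "\<And>i. i < n j \<Longrightarrow> 0 \<le> y j i" by (simp add: less_imp_le)
      show "gauss_integral (n j) (m j) (\<lambda>Z. gram_det (n j) (m j) Z powr (- (real 3 / real (n j))) * weighted_energy (n j) (m j) (y j) Z ^ 3)
       = ennreal ?E * gauss_integral (n j) (m j) (\<lambda>Z. gram_det (n j) (m j) Z powr (- (real 3 / real (n j))))"
        using weighted_energy_moment3[where y = "y j", OF y0'] unfolding nu sums .
      show "0 \<le> ?E"
        unfolding sums[symmetric] nu[symmetric] using nu_pos y0' by (intro add_nonneg_nonneg mult_nonneg_nonneg sum_nonneg zero_le_power) auto
    qed (use elim in auto)
    also have "\<dots> = exp (G.g j) ^ 3 * (exp (G.u 3 j) *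
        ((1 - 3 * c j * ?e j) ^ 3 * p2 j ^ 3 + 3 * (1 - 3 * c j * ?e j) ^ 2 * c j * ?e j * p2 j * p3 j
          + 2 * (1 - 3 * c j * ?e j) * c j ^ 2 * ?e j ^ 2 * p4 j))"
      unfolding c_eq G.e_def p2_def p3_def p4_def by (rule moment3_algebra) (use G.n_pos[of j] G.m_pos[of j] in auto)
    finally show ?case .
  qed
  have e0: "exp (?g0 j) = exp 1 * (1 - c j) powr ((1 - c j) / c j)" for j
    using G.c01[of j] by (simp add: G.g0_def powr_def exp_add)
  have e2: "exp (?g0 j) ^ 2 = exp 1 ^ 2 * (1 - c j) powr (2 * ((1 - c j) / c j))" for j
    unfolding e0 power_mult_distrib by (simp add: powr_power_nat mult.commute)
  have e3: "exp (?g0 j) ^ 3 = exp 1 ^ 3 * (1 - c j) powr (3 * ((1 - c j) / c j))" for j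
    unfolding e0 power_mult_distrib by (simp add: powr_power_nat mult.commute)
  have en: "?e j = 1 / real (n j) ^ 2" "?e j ^ 2 = 1 / real (n j) ^ 4" "?e j ^ 3 = 1 / real (n j) ^ 6" for j
    by (simp_all add: G.e_def power_one_over flip: power_mult)
  note approx = G.bounded_seqs(2,3,6,4) pb G.bounded_seqs(5) G.g_approx G.u_expands mu1 mu2 mu3
  have k1: "(\<lambda>j. \<mu> 1 j - exp (?g0 j) * p2 j) \<in> O(?e)"
    by (rule G.cumulant1_approx[OF approx])
  have k2: "(\<lambda>j. (\<mu> 2 j - \<mu> 1 j ^ 2) - ?e j * exp (?g0 j) ^ 2 * ((G.L j - 2 * c j) * p2 j ^ 2 + c j * p3 j)) \<in> O(\<lambda>j. ?e j ^ 2)"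
    by (rule G.cumulant2_approx[OF approx])
  have k3: "(\<lambda>j. (\<mu> 3 j - 3 * \<mu> 2 j * \<mu> 1 j + 2 * \<mu> 1 j ^ 3) - ?e j ^ 2 * exp (?g0 j) ^ 3 *
     ((3 * (G.L j - 2 * c j) ^ 2 + 6 * G.\<gamma> j - 3 * c j ^ 2) * p2 j ^ 3 - 3 * c j * (3 * c j - 2 * G.L j) * p2 j * p3 j + 2 * c j ^ 2 * p4 j)) \<in> O(\<lambda>j. ?e j ^ 3)"
    by (rule G.cumulant3_approx[OF approx])
  have t1: "\<mu> 1 j - exp (?g0 j) * p2 j = cumulant1 (M j) (W j)
            - exp 1 * (1 - c j) powr ((1 - c j) / c j) * \<Psi>\<^sub>1 j * \<Psi>\<^sub>2 j" for j
    unfolding e0 by (simp add: cumulant1_def \<mu>_def p2_def mult.assoc)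
  have t2: "(\<mu> 2 j - \<mu> 1 j ^ 2) - ?e j * exp (?g0 j) ^ 2 * ((G.L j - 2 * c j) * p2 j ^ 2 + c j * p3 j)
     = cumulant2 (M j) (W j)
            - 1 / real (n j) ^ 2 * \<Psi>\<^sub>1 j ^ 2 * exp 1 ^ 2
              * (1 - c j) powr (2 * ((1 - c j) / c j))
              * ((ln (1 / (1 - c j)) - 2 * c j) * \<Psi>\<^sub>2 j ^ 2 + c j * \<Psi>\<^sub>3 j)" for j
  proof -
    have "ln (1 / (1 - c j)) = G.L j" using G.c01[of j] by (simp add: G.L_def ln_div)
    moreover have "(G.L j - 2 * c j) * p2 j ^ 2 + c j * p3 j = \<Psi>\<^sub>1 j ^ 2 * ((G.L j - 2 * c j) * \<Psi>\<^sub>2 j ^ 2 + c j * \<Psi>\<^sub>3 j)"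
      by (simp add: p2_def p3_def power_mult_distrib ring_distribs mult_ac)
    ultimately show ?thesis unfolding e2 en(1) cumulant2_def \<mu>_def by (simp only: mult_ac)
  qed
  have t3: "(\<mu> 3 j - 3 * \<mu> 2 j * \<mu> 1 j + 2 * \<mu> 1 j ^ 3) - ?e j ^ 2 * exp (?g0 j) ^ 3 *
     ((3 * (G.L j - 2 * c j) ^ 2 + 6 * G.\<gamma> j - 3 * c j ^ 2) * p2 j ^ 3 - 3 * c j * (3 * c j - 2 * G.L j) * p2 j * p3 j + 2 * c j ^ 2 * p4 j)
     = cumulant3 (M j) (W j)
            - 1 / real (n j) ^ 4 * \<Psi>\<^sub>1 j ^ 3 * exp 1 ^ 3
              * (1 - c j) powr (3 * ((1 - c j) / c j))
              * ((c j ^ 2 * (- 10 + 9 * c j) / (- 1 + c j)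
                    + 3 * ln (1 - c j) * (4 * c j + ln (1 - c j))) * \<Psi>\<^sub>2 j ^ 3
                 - 3 * c j * (3 * c j + 2 * ln (1 - c j)) * \<Psi>\<^sub>2 j * \<Psi>\<^sub>3 j
                 + 2 * c j ^ 2 * \<Psi>\<^sub>4 j)" for j
  proof -
    let ?l = "ln (1 - c j)"
    \<comment> \<open>Partial fractions turn the rational term of the statement into the one of \<open>expands_cumulant3\<close>.\<close>
    have "c j ^ 2 * (- 10 + 9 * c j) / (- 1 + c j) = 9 * c j ^ 2 + c j ^ 2 / (1 - c j)"
      using G.c01[of j] by (simp add: divide_simps) (simp add: algebra_simps power2_eq_square)
    moreover have "6 * (x / (6 * z)) = x / z" for x z :: real by simp
    then have "6 * G.\<gamma> j = c j ^ 2 / (1 - c j)" unfolding G.\<gamma>_def .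
    ultimately have A: "3 * (G.L j - 2 * c j) ^ 2 + 6 * G.\<gamma> j - 3 * c j ^ 2 = c j ^ 2 * (- 10 + 9 * c j) / (- 1 + c j) + 3 * ?l * (4 * c j + ?l)"
      by (simp add: G.L_def algebra_simps power2_eq_square)
    have B: "3 * c j - 2 * G.L j = 3 * c j + 2 * ?l" by (simp add: G.L_def)
    have "(c j ^ 2 * (- 10 + 9 * c j) / (- 1 + c j) + 3 * ?l * (4 * c j + ?l)) * p2 j ^ 3 - 3 * c j * (3 * c j + 2 * ?l) * p2 j * p3 j + 2 * c j ^ 2 * p4 j
       = \<Psi>\<^sub>1 j ^ 3 * ((c j ^ 2 * (- 10 + 9 * c j) / (- 1 + c j) + 3 * ?l * (4 * c j + ?l)) * \<Psi>\<^sub>2 j ^ 3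
         - 3 * c j * (3 * c j + 2 * ?l) * \<Psi>\<^sub>2 j * \<Psi>\<^sub>3 j + 2 * c j ^ 2 * \<Psi>\<^sub>4 j)" (is "?x * _ - ?z * _ * _ + _ = _")
      unfolding p2_def p3_def p4_def by (simp only: power_mult_distrib ring_distribs right_diff_distrib power2_eq_square power3_eq_cube mult_ac)
    then show ?thesis unfolding A B e3 en(2) cumulant3_def \<mu>_def by (simp only: mult_ac)
  qed
  show ?thesis
    using k1[unfolded t1] k2[unfolded t2] k3[unfolded t3] unfolding en(2,3) unfolding en(1)[abs_def] by blast
qed

end
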